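(* Let $T=-T_{\mathfrak p}Q|_{\mathfrak p}+T_1Q|_{\mathfrak k_1}+\cdots+T_{r+s}Q|_{\mathfrak k_{r+s}}$ be a left-invariant $(0,2)$-tensor field on $G$ with $T_{\mathfrak p},T_1,\dots,T_{r+s}>0$. Consider the conditions $$\text{(A)}\quad \sum_{i=1}^{r+s}\frac{n^2\kappa_iT_{\mathfrak p}^2-d_i^2(1-\kappa_i)T_i^2}{nT_{\mathfrak p}T_i}-2n<0,$$ $$\text{(B)}\quad \frac{\kappa_m\,\mathrm{tr}_QT}{T_m}<\dim\mathfrak k+d_m(1-\kappa_m)-3n,$$ where $m\in\{1,\dots,r\}$ is an index with $\frac{\kappa_m}{T_m}=\max_{i=1,\dots,r}\frac{\kappa_i}{T_i}$. Then: (1) If (A) holds, there exists at least one pair $(g,c)\in\mathcal M_K\times(0,\infty)$ with $\mathrm{Ric}(g)=cT$. (2) If both (A) and (B) hold, there exist at least two pairs $(g,c)\in\mathcal M_K\times(0,\infty)$ with $\mathrm{Ric}(g)=cT$ whose metrics $g$ are not homothetic. (3) Suppose $r+s=2$, and define $a,b,c,d,D,R_t,R_d,R_s$ from $T_{\mathfrak p},T_1,T_2$ by $a=nd_2(1-\kappa_2)T_{\mathfrak p}$, $b=d_1^2(1-\kappa_1)T_1-d_2^2(1-\kappa_2)T_2+2n^2T_{\mathfrak p}-\frac{n^2\kappa_1T_{\mathfrak p}^2}{T_1}$, $c=-2nd_2T_2+\frac{2nd_2\kappa_1T_{\mathfrak p}T_2}{T_1}-nd_2\kappa_2T_{\mathfrak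 p}$, $d=-\frac{d_2^2\kappa_1T_2^2}{T_1}+\kappa_2d_2^2T_2$, $D=18abcd-4b^3d+b^2c^2-4ac^3-27a^2d^2$, $R_t=-\frac b{3a}$, and (when $b^2\ne3ac$) $R_d=\frac{9ad-bc}{2(b^2-3ac)}$, $R_s=\frac{4abc-9a^2d-b^3}{a(b^2-3ac)}$. If one of the following holds: (i) $D=0$, $b^2=3ac$, $\frac{d_2T_2}{nT_{\mathfrak p}}<R_t$; (ii) $D=0$, $b^2\ne3ac$, $R_s\le\frac{d_2T_2}{nT_{\mathfrak p}}<R_d$; (iii) $D=0$, $b^2\ne3ac$, $\frac{d_2T_2}{nT_{\mathfrak p}}<R_s<R_d$; (iv) $D=0$, $b^2\ne3ac$, $\frac{d_2T_2}{nT_{\mathfrak p}}<R_d<R_s$; then there exists at least one pair $(g,c')\in\mathcal M_K\times(0,\infty)$ with $\mathrm{Ric}(g)=c'T$.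
   Context: Let $G$ be a connected non-compact simple Lie group with Lie algebra $\mathfrak g$, $K$ a maximal compact subgroup with Lie algebra $\mathfrak k$, $B$ the Killing form of $\mathfrak g$, and $\mathfrak p$ the $B$-orthogonal complement of $\mathfrak k$ in $\mathfrak g$. Let $Q=B|_{\mathfrak p}-B|_{\mathfrak k}$ (an inner product; $\mathrm{tr}_QT=-nT_{\mathfrak p}+\sum_id_iT_i$). Write $\mathfrak k=\mathfrak k_1\oplus\cdots\oplus\mathfrak k_{r+s}$, where $\mathfrak k_1,\dots,\mathfrak k_r$ are the simple ideals of $[\mathfrak k,\mathfrak k]$, $\mathfrak k_{r+1}$ is the centre of $\mathfrak k$, and $s=1$ if the centre is nontrivial, $s=0$ otherwise. Let $n=\dim\mathfrak p$, $d_i=\dim\mathfrak k_i$, and define $\kappa_i$ by $B_i=\kappa_iB|_{\mathfrak k_i}$, $B_i$ the Killing form of $\mathfrak k_i$. Left-invariant tensor fields on $G$ are identified with bilinear forms on $\mathfrak g$; $Q|_{\mathfrak u}$ denotes $Q$ restricted to $\mathfrak u$ and extended by zero on its $Q$-orthogonal complement. $\mathcal M_K$ is the set of left-invariant metrics on $G$ naturally reductive with respect to $G\times K$ (acting by $(x,k)y=xyk^{-1}$), which by a theorem of Gordon are exactly the metrics $\beta Q|_{\mathfrak p}+\sum_i\alpha_iQ|_{\mathfrak k_i}$ with $\beta,\alpha_i>0$. *)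

theory Defs
  imports "HOL-Analysis.Analysis"
begin

text \<open>A finite-dimensional real Lie algebra is modelled on a Euclidean space type 'g
  (only its real vector space structure matters; the Euclidean inner product is used
  only as an auxiliary device to compute traces, which are basis independent).\<close>

definition lie_algebra :: "('g::euclidean_space \<Rightarrow> 'g \<Rightarrow> 'g) \<Rightarrow> bool" where
  "lie_algebra br \<longleftrightarrow> (\<forall>x. linear (br x)) \<and> (\<forall>y. linear (\<lambda>x. br x y))
     \<and> (\<forall>x y. br x y = - br y x)
     \<and> (\<forall>x y z. br x (br y z) + br y (br z x) + br z (br x y) = 0)"

definition trace_lin :: "('g::euclidean_space \<Rightarrow> 'g) \<Rightarrow> real" where
  "trace_lin f = (\<Sum>b\<in>Basis. f b \<bullet> b)"

text \<open>Trace of a linear map f with f(V) \<subseteq> V, restricted to the subspace V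
  (computed as the trace of f composed with any projection onto V).\<close>
definition trace_on :: "'g::euclidean_space set \<Rightarrow> ('g \<Rightarrow> 'g) \<Rightarrow> real" where
  "trace_on V f = trace_lin (f \<circ> (SOME P. linear P \<and> range P = V \<and> (\<forall>v\<in>V. P v = v)))"

definition killing :: "('g::euclidean_space \<Rightarrow> 'g \<Rightarrow> 'g) \<Rightarrow> 'g \<Rightarrow> 'g \<Rightarrow> real" where
  "killing br x y = trace_lin (br x \<circ> br y)"

definition killing_on :: "('g::euclidean_space \<Rightarrow> 'g \<Rightarrow> 'g) \<Rightarrow> 'g set \<Rightarrow> 'g \<Rightarrow> 'g \<Rightarrow> real" where
  "killing_on br V x y = trace_on V (br x \<circ> br y)"

definition lie_subalgebra :: "('g::euclidean_space \<Rightarrow> 'g \<Rightarrow> 'g) \<Rightarrow> 'g set \<Rightarrow> bool" where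
  "lie_subalgebra br A \<longleftrightarrow> subspace A \<and> (\<forall>x\<in>A. \<forall>y\<in>A. br x y \<in> A)"

definition ideal_of :: "('g::euclidean_space \<Rightarrow> 'g \<Rightarrow> 'g) \<Rightarrow> 'g set \<Rightarrow> 'g set \<Rightarrow> bool" where
  "ideal_of br A I \<longleftrightarrow> subspace I \<and> I \<subseteq> A \<and> (\<forall>x\<in>A. \<forall>y\<in>I. br x y \<in> I)"

definition simple_sub :: "('g::euclidean_space \<Rightarrow> 'g \<Rightarrow> 'g) \<Rightarrow> 'g set \<Rightarrow> bool" where
  "simple_sub br A \<longleftrightarrow> lie_subalgebra br A \<and> (\<exists>x\<in>A. \<exists>y\<in>A. br x y \<noteq> 0)
     \<and> (\<forall>I. ideal_of br A I \<longrightarrow> I = {0} \<or> I = A)"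

definition derived :: "('g::euclidean_space \<Rightarrow> 'g \<Rightarrow> 'g) \<Rightarrow> 'g set \<Rightarrow> 'g set" where
  "derived br A = span {br x y | x y. x \<in> A \<and> y \<in> A}"

definition centre :: "('g::euclidean_space \<Rightarrow> 'g \<Rightarrow> 'g) \<Rightarrow> 'g set \<Rightarrow> 'g set" where
  "centre br A = {z\<in>A. \<forall>x\<in>A. br z x = 0}"

definition noncompact :: "('g::euclidean_space \<Rightarrow> 'g \<Rightarrow> 'g) \<Rightarrow> bool" where
  "noncompact br \<longleftrightarrow> \<not> (\<forall>x. x \<noteq> 0 \<longrightarrow> killing br x x < 0)"

definition orthB :: "('g::euclidean_space \<Rightarrow> 'g \<Rightarrow> 'g) \<Rightarrow> 'g set \<Rightarrow> 'g set" where
  "orthB br k = {x. \<forall>y\<in>k. killing br x y = 0}"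

text \<open>k is the Lie algebra of a maximal compact subgroup: a Cartan decomposition
  g = k + p, B negative definite on k and positive definite on p.\<close>
definition cartan_k :: "('g::euclidean_space \<Rightarrow> 'g \<Rightarrow> 'g) \<Rightarrow> 'g set \<Rightarrow> bool" where
  "cartan_k br k \<longleftrightarrow> lie_subalgebra br k
     \<and> (\<forall>x\<in>k. x \<noteq> 0 \<longrightarrow> killing br x x < 0)
     \<and> (\<forall>x\<in>orthB br k. x \<noteq> 0 \<longrightarrow> killing br x x > 0)
     \<and> (\<forall>x. \<exists>u\<in>k. \<exists>v\<in>orthB br k. x = u + v)"

definition kpart :: "('g::euclidean_space \<Rightarrow> 'g \<Rightarrow> 'g) \<Rightarrow> 'g set \<Rightarrow> 'g \<Rightarrow> 'g" where
  "kpart br k x = (THE u. u \<in> k \<and> x - u \<in> orthB br k)"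

definition Qform :: "('g::euclidean_space \<Rightarrow> 'g \<Rightarrow> 'g) \<Rightarrow> 'g set \<Rightarrow> 'g \<Rightarrow> 'g \<Rightarrow> real" where
  "Qform br k x y = killing br (x - kpart br k x) (y - kpart br k y)
                    - killing br (kpart br k x) (kpart br k y)"

definition qproj :: "('g::euclidean_space \<Rightarrow> 'g \<Rightarrow> 'g) \<Rightarrow> 'g set \<Rightarrow> 'g set \<Rightarrow> 'g \<Rightarrow> 'g" where
  "qproj br k U x = (THE w. w \<in> U \<and> (\<forall>z\<in>U. Qform br k (x - w) z = 0))"

text \<open>Q|_U : Q restricted to U, extended by zero on its Q-orthogonal complement.\<close>
definition Qres :: "('g::euclidean_space \<Rightarrow> 'g \<Rightarrow> 'g) \<Rightarrow> 'g set \<Rightarrow> 'g set \<Rightarrow> 'g \<Rightarrow> 'g \<Rightarrow> real" where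
  "Qres br k U x y = Qform br k (qproj br k U x) (qproj br k U y)"

definition k_decomp :: "('g::euclidean_space \<Rightarrow> 'g \<Rightarrow> 'g) \<Rightarrow> 'g set \<Rightarrow> nat \<Rightarrow> nat \<Rightarrow> (nat \<Rightarrow> 'g set) \<Rightarrow> bool" where
  "k_decomp br k r s kk \<longleftrightarrow> s \<le> 1 \<and> inj_on kk {1..r}
     \<and> kk ` {1..r} = {I. ideal_of br (derived br k) I \<and> simple_sub br I}
     \<and> (s = 1 \<longleftrightarrow> centre br k \<noteq> {0})
     \<and> (s = 1 \<longrightarrow> kk (r + 1) = centre br k)"

text \<open>The set M_K (via Gordon's theorem, as in the paper).\<close>
definition MK :: "('g::euclidean_space \<Rightarrow> 'g \<Rightarrow> 'g) \<Rightarrow> 'g set \<Rightarrow> nat \<Rightarrow> nat \<Rightarrow> (nat \<Rightarrow> 'g set) \<Rightarrow> ('g \<Rightarrow> 'g \<Rightarrow> real) set" where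
  "MK br k r s kk = {g. \<exists>\<beta> \<alpha>. \<beta> > 0 \<and> (\<forall>i\<in>{1..r+s}. \<alpha> i > 0) \<and>
      g = (\<lambda>x y. \<beta> * Qres br k (orthB br k) x y + (\<Sum>i=1..r+s. \<alpha> i * Qres br k (kk i) x y))}"

definition tensorT :: "('g::euclidean_space \<Rightarrow> 'g \<Rightarrow> 'g) \<Rightarrow> 'g set \<Rightarrow> nat \<Rightarrow> (nat \<Rightarrow> 'g set) \<Rightarrow> real \<Rightarrow> (nat \<Rightarrow> real) \<Rightarrow> 'g \<Rightarrow> 'g \<Rightarrow> real" where
  "tensorT br k N kk Tp T = (\<lambda>x y. - Tp * Qres br k (orthB br k) x y + (\<Sum>i=1..N. T i * Qres br k (kk i) x y))"

text \<open>Levi-Civita connection of a left-invariant metric g on left-invariant fields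
  (Koszul formula), its curvature and Ricci tensor.\<close>
definition lc :: "('g::euclidean_space \<Rightarrow> 'g \<Rightarrow> real) \<Rightarrow> ('g \<Rightarrow> 'g \<Rightarrow> 'g) \<Rightarrow> 'g \<Rightarrow> 'g \<Rightarrow> 'g" where
  "lc g br X Y = (THE U. \<forall>Z. 2 * g U Z = g (br X Y) Z - g (br Y Z) X + g (br Z X) Y)"

definition curv :: "('g::euclidean_space \<Rightarrow> 'g \<Rightarrow> real) \<Rightarrow> ('g \<Rightarrow> 'g \<Rightarrow> 'g) \<Rightarrow> 'g \<Rightarrow> 'g \<Rightarrow> 'g \<Rightarrow> 'g" where
  "curv g br X Y Z = lc g br X (lc g br Y Z) - lc g br Y (lc g br X Z) - lc g br (br X Y) Z"

definition ric :: "('g::euclidean_space \<Rightarrow> 'g \<Rightarrow> real) \<Rightarrow> ('g \<Rightarrow> 'g \<Rightarrow> 'g) \<Rightarrow> 'g \<Rightarrow> 'g \<Rightarrow> real" where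
  "ric g br X Y = trace_lin (\<lambda>Z. curv g br Z X Y)"

definition homothetic :: "('g \<Rightarrow> 'g \<Rightarrow> real) \<Rightarrow> ('g \<Rightarrow> 'g \<Rightarrow> real) \<Rightarrow> bool" where
  "homothetic g1 g2 \<longleftrightarrow> (\<exists>t>0. g1 = (\<lambda>x y. t * g2 x y))"

end

theory Submission
  imports Defs
begin

text \<open>By bilinearity and Schur's lemma everything reduces to scalars. First \<open>[p,p] \<subseteq> k\<close>, which is not part of the
  definition of \<^const>\<open>cartan_k\<close>; since g is simple, k then acts irreducibly on p, so the Casimir operator
  of each \<open>k\<^sub>i\<close> on p is the scalar \<open>d\<^sub>i (1 - \<kappa>\<^sub>i) / n\<close>, and these scalars add up to \<open>1/2\<close>. Computing with
  \<open>Ric(X,Y) = - tr (S\<^sub>X S\<^sub>Y)\<close>, where \<open>S\<^sub>X Z = \<nabla>\<^sub>Z X\<close>, the Ricci tensor of the metric with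
  \<open>\<beta> = 1\<close> and \<open>\<alpha>\<^sub>i = x\<^sub>i\<close> is \<open>- (1/2 + (1/2) \<Sum> x\<^sub>i d\<^sub>i (1 - \<kappa>\<^sub>i) / n)\<close> on p and
  \<open>(\<kappa>\<^sub>i + (1 - \<kappa>\<^sub>i) x\<^sub>i\<^sup>2) / 4\<close> on \<open>k\<^sub>i\<close>. Eliminating the \<open>x\<^sub>i\<close> from \<open>Ric(g) = c T\<close> leaves one equation
  \<open>F c = 0\<close> with \<open>F\<close> continuous and unbounded above. At a critical point \<open>F\<close> is at most the left-hand
  side of (A), at the left end of its domain it is positive under (B), and if \<open>r + s = 2\<close> its sign at the
  critical point is that of minus a cubic with coefficients \<open>a, b, c, d\<close>.\<close>

subsection \<open>Traces and orthonormal bases of an inner form\<close>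

text \<open>Two forms compete throughout. The Killing form is invariant under the whole algebra but
  indefinite; \<open>Qform\<close> is definite, hence yields orthonormal bases, squares and the
  vanishing of vectors, but invariance is available only under k. Most computations therefore move a
  bracket with the Killing form and read the result off with \<open>Qform\<close>, the sign
  depending on whether an argument lies in k or in p. The main obstacle is that
  \<open>cartan_k\<close> speaks only about the signs of the Killing form: no involution is given,
  so the bracket relation on p has to be extracted from a norm identity. The Ricci tensor does not
  change when a metric is rescaled, so \<open>\<beta> = 1\<close> costs nothing and the unknowns are
  the ratios of the coefficients together with \<open>c\<close>. For the same reason homothetic
  solutions have equal \<open>c\<close>, so two different roots of \<open>F\<close> give metrics
  that are not homothetic.\<close>

lemma trace_lin_comp_commute:
  fixes f g :: "'a::euclidean_space \<Rightarrow> 'a"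
  assumes "linear f" "linear g"
  shows "trace_lin (f \<circ> g) = trace_lin (g \<circ> f)"
proof -
  have expand: "trace_lin (u \<circ> v) = (\<Sum>b\<in>Basis. \<Sum>c\<in>Basis. (v b \<bullet> c) * (u c \<bullet> b))"
    if "linear u" for u v :: "'a \<Rightarrow> 'a"
  proof -
    have "u (v b) \<bullet> b = (\<Sum>c\<in>Basis. (v b \<bullet> c) * (u c \<bullet> b))" for b
    proof -
      have "u (v b) = u (\<Sum>c\<in>Basis. (v b \<bullet> c) *\<^sub>R c)"
        by (simp add: euclidean_representation)
      also have "\<dots> = (\<Sum>c\<in>Basis. (v b \<bullet> c) *\<^sub>R u c)"
        by (simp add: linear_sum[OF that] linear_scale[OF that])
      finally show ?thesis by (simp add: inner_sum_left)
    qed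
    then show ?thesis by (simp add: trace_lin_def)
  qed
  show ?thesis
    unfolding expand[OF assms(1)] expand[OF assms(2)]
    by (subst sum.swap) (simp add: mult.commute)
qed

lemma trace_lin_add: "trace_lin (\<lambda>x. f x + g x) = trace_lin f + trace_lin g"
  by (simp add: trace_lin_def inner_add_left sum.distrib)

lemma trace_lin_diff: "trace_lin (\<lambda>x. f x - g x) = trace_lin f - trace_lin g"
  by (simp add: trace_lin_def inner_diff_left sum_subtractf)

text \<open>An abstract inner product, unrelated to the one carried by the type. It is interpreted
  with \<open>Qform\<close>, in whose orthonormal bases all traces are evaluated.\<close>

locale inner_form =
  fixes q :: "'g::euclidean_space \<Rightarrow> 'g \<Rightarrow> real"
  assumes q_bilinear: "bilinear q"
    and q_sym: "q x y = q y x"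
    and q_pos: "x \<noteq> 0 \<Longrightarrow> q x x > 0"
begin

lemma q_linear_left: "linear (\<lambda>x. q x y)" and q_linear_right: "linear (q x)"
  using q_bilinear by (auto simp: bilinear_def)

lemmas q_add_left = linear_add[OF q_linear_left]
  and q_add_right = linear_add[OF q_linear_right]
  and q_diff_left = linear_diff[OF q_linear_left]
  and q_minus_left = linear_neg[OF q_linear_left]
  and q_minus_right = linear_neg[OF q_linear_right]
  and q_scale_left = linear_scale[OF q_linear_left]
  and q_scale_right = linear_scale[OF q_linear_right]
  and q_zero_left = linear_0[OF q_linear_left]
  and q_zero_right = linear_0[OF q_linear_right]
  and q_sum_left = linear_sum[OF q_linear_left]

lemma q_nonneg: "q x x \<ge> 0"
  using q_pos[of x] by (cases "x = 0") (auto simp: q_zero_left)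

lemma q_eq_0: "q x x = 0 \<longleftrightarrow> x = 0"
  using q_pos[of x] by (cases "x = 0") (auto simp: q_zero_left)

text \<open>Completeness is encoded as the Fourier expansion of the elements of \<open>U\<close>,
  the shape in which bases are used below; independence and the dimension are recovered in
  \<open>onb_dim\<close>.\<close>

definition onb :: "'g set \<Rightarrow> 'g set \<Rightarrow> bool" where
  "onb U E \<longleftrightarrow> finite E \<and> E \<subseteq> U \<and> (\<forall>x\<in>E. \<forall>y\<in>E. q x y = (if x = y then 1 else 0))
     \<and> (\<forall>x\<in>U. x = (\<Sum>e\<in>E. q x e *\<^sub>R e))"

text \<open>Gram-Schmidt as an induction on the dimension: a unit vector is split off, and the
  induction hypothesis supplies a basis of its orthogonal complement in \<open>U\<close>.\<close>

lemma onb_exists: "subspace U \<Longrightarrow> \<exists>E. onb U E"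
proof (induction "dim U" arbitrary: U rule: less_induct)
  case less
  show ?case
  proof (cases "U \<subseteq> {0}")
    case True
    then have "onb U {}" by (auto simp: onb_def)
    then show ?thesis ..
  next
    case False
    then obtain x0 where x0: "x0 \<in> U" "x0 \<noteq> 0" by blast
    define x where "x = (1 / sqrt (q x0 x0)) *\<^sub>R x0"
    have x: "x \<in> U" "q x x = 1"
      using x0 q_pos[of x0] less.prems
      by (auto simp: x_def subspace_scale q_scale_left q_scale_right)
    define V where "V = {y \<in> U. q y x = 0}"
    have V: "subspace V" using less.prems
      by (auto simp: V_def subspace_def q_add_left q_scale_left q_zero_left)
    have "x \<notin> V" "V \<subseteq> U" using x by (auto simp: V_def)
    then have "V \<subset> U" using x by blast
    then have "dim V < dim U"
      using V less.prems by (metis dim_psubset span_eq_iff)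
    from less.hyps[OF this V] obtain E where E: "onb V E" ..
    have [simp]: "x \<notin> E" using E x by (auto simp: onb_def V_def)
    have E0: "q e x = 0" "q x e = 0" if "e \<in> E" for e
      using E that by (auto simp: onb_def V_def q_sym[of x])
    have "onb U (insert x E)" unfolding onb_def
    proof (intro conjI ballI)
      fix y assume y: "y \<in> U"
      have "y - q y x *\<^sub>R x \<in> V"
        using y x less.prems by (auto simp: V_def subspace_diff subspace_scale q_diff_left q_scale_left)
      then have "y - q y x *\<^sub>R x = (\<Sum>e\<in>E. q (y - q y x *\<^sub>R x) e *\<^sub>R e)"
        using E unfolding onb_def by blast
      also have "\<dots> = (\<Sum>e\<in>E. q y e *\<^sub>R e)"
        by (intro sum.cong) (auto simp: q_diff_left q_scale_left E0)
      finally show "y = (\<Sum>e\<in>insert x E. q y e *\<^sub>R e)"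
        using E by (simp add: onb_def algebra_simps)
    qed (use E E0 x in \<open>auto simp: onb_def V_def\<close>)
    then show ?thesis ..
  qed
qed

lemma onb_D:
  assumes "onb U E"
  shows "finite E" "E \<subseteq> U" "e \<in> E \<Longrightarrow> q e e = 1" "e \<in> E \<Longrightarrow> e' \<in> E \<Longrightarrow> e \<noteq> e' \<Longrightarrow> q e e' = 0"
    "x \<in> U \<Longrightarrow> (\<Sum>e\<in>E. q x e *\<^sub>R e) = x"
  using assms unfolding onb_def by (auto intro: sym)

lemma onb_functional:
  assumes "onb U E" "x \<in> U" "linear (\<phi> :: 'g \<Rightarrow> 'b::real_vector)"
  shows "(\<Sum>e\<in>E. q x e *\<^sub>R \<phi> e) = \<phi> x"
proof -
  have "\<phi> x = \<phi> (\<Sum>e\<in>E. q x e *\<^sub>R e)" using onb_D(5)[OF assms(1,2)] by simp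
  then show ?thesis by (simp add: linear_sum[OF assms(3)] linear_scale[OF assms(3)])
qed

lemma onb_inner:
  assumes "onb U E" "x \<in> U"
  shows "(\<Sum>e\<in>E. q x e * q y e) = q x y"
  using onb_functional[OF assms q_linear_right[of y]] q_sym[of x y] by simp

lemma onb_dim:
  assumes "onb U E"
  shows "dim U = card E"
proof -
  have "independent E"
  proof (rule independent_if_scalars_zero[OF onb_D(1)[OF assms]])
    fix f e assume f: "(\<Sum>x\<in>E. f x *\<^sub>R x) = 0" and e: "e \<in> E"
    have "0 = q (\<Sum>x\<in>E. f x *\<^sub>R x) e" by (simp add: f q_zero_left)
    also have "\<dots> = (\<Sum>x\<in>E. f x * q x e)" by (simp add: q_sum_left q_scale_left)
    also have "\<dots> = (\<Sum>x\<in>E. if x = e then f e else 0)"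
      using onb_D[OF assms] e by (intro sum.cong) auto
    finally show "f e = 0" using onb_D(1)[OF assms] e by simp
  qed
  moreover have "U \<subseteq> span E"
  proof
    fix x assume "x \<in> U"
    then show "x \<in> span E"
      by (subst onb_D(5)[OF assms, symmetric]) (auto intro: span_sum span_scale span_base)
  qed
  ultimately show ?thesis
    using onb_D(2)[OF assms] basis_card_eq_dim by metis
qed

lemma trace_lin_onb:
  assumes "linear f" and E: "\<And>x. (\<Sum>e\<in>E. q x e *\<^sub>R e) = x"
  shows "trace_lin f = (\<Sum>e\<in>E. q (f e) e)"
proof -
  have "f b \<bullet> b = (\<Sum>e\<in>E. q b e * (f e \<bullet> b))" for b
    by (subst (1) E[of b, symmetric])
      (simp add: linear_sum[OF assms(1)] linear_scale[OF assms(1)] inner_sum_left)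
  then have "trace_lin f = (\<Sum>b\<in>Basis. \<Sum>e\<in>E. q b e * (f e \<bullet> b))"
    by (simp add: trace_lin_def)
  also have "\<dots> = (\<Sum>e\<in>E. \<Sum>b\<in>Basis. (f e \<bullet> b) * q b e)"
    by (subst sum.swap) (simp add: mult.commute)
  also have "\<dots> = (\<Sum>e\<in>E. q (\<Sum>b\<in>Basis. (f e \<bullet> b) *\<^sub>R b) e)"
    by (simp add: q_sum_left q_scale_left)
  finally show ?thesis by (simp add: euclidean_representation)
qed

text \<open>Two projections \<open>P\<close>, \<open>P'\<close> onto \<open>U\<close> satisfy \<open>P P' = P'\<close>, so cyclicity of the
  trace makes the choice of the projection in \<^const>\<open>trace_on\<close> irrelevant.\<close>

lemma trace_on_onb:
  assumes f: "linear f" and fU: "\<And>x. x \<in> U \<Longrightarrow> f x \<in> U" and E: "onb U E" and U: "subspace U"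
  shows "trace_on U f = (\<Sum>e\<in>E. q (f e) e)"
proof -
  define P0 where "P0 x = (\<Sum>e\<in>E. q x e *\<^sub>R e)" for x
  have P0_lin: "linear P0"
    by (auto intro!: linearI simp: P0_def q_add_left q_scale_left algebra_simps sum.distrib
        scaleR_sum_right)
  have P0_U: "P0 x \<in> U" for x
    using onb_D[OF E] U by (auto simp: P0_def intro!: subspace_sum subspace_scale)
  have P0_id: "P0 x = x" if "x \<in> U" for x
    using onb_D(5)[OF E that] by (simp add: P0_def)
  define P where "P = (SOME P. linear P \<and> range P = U \<and> (\<forall>v\<in>U. P v = v))"
  have "linear P0 \<and> range P0 = U \<and> (\<forall>v\<in>U. P0 v = v)"
  proof (intro conjI ballI)
    show "range P0 = U" using P0_U P0_id by (metis image_eqI UNIV_I subsetI image_subsetI subset_antisym)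
  qed (use P0_lin P0_id in auto)
  then have "linear P \<and> range P = U \<and> (\<forall>v\<in>U. P v = v)"
    unfolding P_def by (rule someI[where P = "\<lambda>P. linear P \<and> range P = U \<and> (\<forall>v\<in>U. P v = v)"])
  then have P: "linear P" "range P = U" "\<forall>v\<in>U. P v = v" by auto
  have fP: "f \<circ> P = P0 \<circ> (f \<circ> P)" using P(2) fU P0_id by fastforce
  have "trace_on U f = trace_lin (f \<circ> P)" by (simp add: trace_on_def P_def)
  also have "\<dots> = trace_lin ((f \<circ> P) \<circ> P0)"
    by (subst fP) (rule trace_lin_comp_commute[OF P0_lin linear_compose[OF P(1) f]])
  also have "(f \<circ> P) \<circ> P0 = f \<circ> P0" using P(3) P0_U by fastforce
  also have "trace_lin (f \<circ> P0) = (\<Sum>b\<in>Basis. \<Sum>e\<in>E. q b e * (f e \<bullet> b))"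
    by (simp add: trace_lin_def P0_def linear_sum[OF f] linear_scale[OF f] inner_sum_left)
  also have "\<dots> = (\<Sum>e\<in>E. \<Sum>b\<in>Basis. (f e \<bullet> b) * q b e)"
    by (subst sum.swap) (simp add: mult.commute)
  also have "\<dots> = (\<Sum>e\<in>E. q (\<Sum>b\<in>Basis. (f e \<bullet> b) *\<^sub>R b) e)"
    by (simp add: q_sum_left q_scale_left)
  finally show ?thesis by (simp add: euclidean_representation)
qed

end

subsection \<open>Cartan decompositions\<close>

locale lie =
  fixes br :: "'g::euclidean_space \<Rightarrow> 'g \<Rightarrow> 'g"
  assumes lie: "lie_algebra br"
begin

abbreviation B where "B \<equiv> killing br"

lemma br_linear_right: "linear (br x)" and br_linear_left: "linear (\<lambda>x. br x y)"
  and br_anti: "br x y = - br y x"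
  and br_cyclic: "br x (br y z) + br y (br z x) + br z (br x y) = 0"
  using lie unfolding lie_algebra_def by blast+

lemmas br_add_left = linear_add[OF br_linear_left]
  and br_add_right = linear_add[OF br_linear_right]
  and br_diff_left = linear_diff[OF br_linear_left]
  and br_diff_right = linear_diff[OF br_linear_right]
  and br_minus_left = linear_neg[OF br_linear_left]
  and br_minus_right = linear_neg[OF br_linear_right]
  and br_scale_left = linear_scale[OF br_linear_left]
  and br_scale_right = linear_scale[OF br_linear_right]
  and br_zero_left = linear_0[OF br_linear_left]
  and br_zero_right = linear_0[OF br_linear_right]

lemma br_self: "br x x = 0"
proof -
  have "br x x + br x x = 0" using br_anti[of x x] by (metis add.right_inverse)
  then show ?thesis by (metis scaleR_2 scaleR_eq_0_iff zero_neq_numeral)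
qed

lemma br_deriv: "br x (br y z) = br (br x y) z + br y (br x z)"
  using br_cyclic[of x y z] br_anti[of z "br x y"] br_anti[of z x]
  by (simp add: br_minus_right algebra_simps)

lemma killing_sym: "B x y = B y x"
  unfolding killing_def by (rule trace_lin_comp_commute) (rule br_linear_right)+

lemma killing_linear_left: "linear (\<lambda>x. B x y)"
  by (rule linearI) (simp_all add: killing_def trace_lin_def br_add_left br_scale_left
      inner_add_left sum.distrib sum_distrib_left)

lemma killing_linear_right: "linear (B x)"
proof -
  have "B x = (\<lambda>y. B y x)" by (rule ext) (rule killing_sym)
  then show ?thesis using killing_linear_left[of x] by simp
qed

lemmas killing_add_left = linear_add[OF killing_linear_left]
  and killing_add_right = linear_add[OF killing_linear_right]
  and killing_diff_left = linear_diff[OF killing_linear_left]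
  and killing_diff_right = linear_diff[OF killing_linear_right]
  and killing_minus_left = linear_neg[OF killing_linear_left]
  and killing_minus_right = linear_neg[OF killing_linear_right]
  and killing_scale_left = linear_scale[OF killing_linear_left]
  and killing_scale_right = linear_scale[OF killing_linear_right]
  and killing_zero_left = linear_0[OF killing_linear_left]
  and killing_zero_right = linear_0[OF killing_linear_right]
  and killing_sum_left = linear_sum[OF killing_linear_left]

text \<open>By the Jacobi identity \<open>br (br x y)\<close> is a commutator of operators, so each
  side is a difference of two traces of triple products; these match by cyclicity.\<close>

lemma killing_inv: "B (br x y) z = B x (br y z)"
proof -
  have "B (br x y) z = trace_lin (\<lambda>v. br x (br y (br z v)) - br y (br x (br z v)))"
    by (simp add: killing_def comp_def br_deriv[of x y])
  also have "\<dots> = trace_lin (br x \<circ> (br y \<circ> br z)) - trace_lin (br y \<circ> (br x \<circ> br z))"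
    by (simp add: trace_lin_diff comp_def)
  also have "trace_lin (br y \<circ> (br x \<circ> br z)) = trace_lin ((br x \<circ> br z) \<circ> br y)"
    by (intro trace_lin_comp_commute linear_compose br_linear_right)
  also have "trace_lin (br x \<circ> (br y \<circ> br z)) - \<dots> = trace_lin (\<lambda>v. br x (br y (br z v)) - br x (br z (br y v)))"
    by (simp add: trace_lin_diff comp_def)
  also have "\<dots> = B x (br y z)"
    by (simp add: killing_def comp_def br_deriv[of y z] br_add_right)
  finally show ?thesis .
qed

lemma killing_skew: "B (br x y) z = - B y (br x z)"
  by (metis br_anti killing_inv killing_minus_left)

end

locale cartan = lie br for br :: "'g::euclidean_space \<Rightarrow> 'g \<Rightarrow> 'g" +
  fixes k :: "'g set"
  assumes cartan: "cartan_k br k"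
begin

abbreviation p where "p \<equiv> orthB br k"
abbreviation Q where "Q \<equiv> Qform br k"

lemma k_subspace: "subspace k"
  and k_br: "x \<in> k \<Longrightarrow> y \<in> k \<Longrightarrow> br x y \<in> k"
  and k_neg: "x \<in> k \<Longrightarrow> x \<noteq> 0 \<Longrightarrow> B x x < 0"
  and p_pos: "x \<in> p \<Longrightarrow> x \<noteq> 0 \<Longrightarrow> B x x > 0"
  and kp_decomp: "\<exists>u\<in>k. \<exists>v\<in>p. x = u + v"
  using cartan by (auto simp: cartan_k_def lie_subalgebra_def)

lemma p_subspace: "subspace p"
  by (auto simp: subspace_def orthB_def killing_add_left killing_scale_left killing_zero_left)

lemma kp_orth: "x \<in> k \<Longrightarrow> y \<in> p \<Longrightarrow> B x y = 0" and pk_orth: "x \<in> k \<Longrightarrow> y \<in> p \<Longrightarrow> B y x = 0"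
  by (auto simp: orthB_def killing_sym)

lemma p_iff: "x \<in> p \<longleftrightarrow> (\<forall>y\<in>k. B x y = 0)"
  by (simp add: orthB_def)

lemma kp_Int: "x \<in> k \<Longrightarrow> x \<in> p \<Longrightarrow> x = 0"
  using k_neg[of x] kp_orth[of x x] by force

lemma kpart_eqI:
  assumes "u \<in> k" "x - u \<in> p"
  shows "kpart br k x = u"
  unfolding kpart_def
proof (rule the_equality)
  fix u' assume "u' \<in> k \<and> x - u' \<in> p"
  then have "u' - u \<in> k" "(x - u) - (x - u') \<in> p"
    using assms by (blast intro: subspace_diff k_subspace p_subspace)+
  then show "u' = u" using kp_Int[of "u' - u"] by simp
qed (use assms in auto)

lemma kpart_k: "kpart br k x \<in> k" and kpart_p: "x - kpart br k x \<in> p"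
proof -
  obtain u v where "u \<in> k" "v \<in> p" "x = u + v" using kp_decomp by blast
  then have "u \<in> k" "x - u \<in> p" by auto
  with kpart_eqI show "kpart br k x \<in> k" "x - kpart br k x \<in> p" by auto
qed

lemma kpart_of_k: "x \<in> k \<Longrightarrow> kpart br k x = x"
  by (rule kpart_eqI) (auto simp: subspace_0 p_subspace)

lemma kpart_of_p: "x \<in> p \<Longrightarrow> kpart br k x = 0"
  by (rule kpart_eqI) (auto simp: subspace_0 k_subspace)

lemma kpart_linear: "linear (kpart br k)"
proof (rule linearI; rule kpart_eqI)
  fix x y :: 'g and c :: real
  show "kpart br k x + kpart br k y \<in> k" "c *\<^sub>R kpart br k x \<in> k"
    by (auto intro: subspace_add subspace_scale kpart_k k_subspace)
  show "x + y - (kpart br k x + kpart br k y) \<in> p"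
    using subspace_add[OF p_subspace kpart_p[of x] kpart_p[of y]] by (simp add: algebra_simps)
  show "c *\<^sub>R x - c *\<^sub>R kpart br k x \<in> p"
    using subspace_scale[OF p_subspace kpart_p[of x], of c] by (simp add: algebra_simps)
qed

sublocale inner_form Q
proof
  have "linear (\<lambda>x. Q x y)" for y
    by (rule linearI) (simp_all add: Qform_def linear_add[OF kpart_linear]
      linear_scale[OF kpart_linear] killing_add_left killing_diff_left killing_scale_left algebra_simps)
  moreover show sym: "Q x y = Q y x" for x y by (simp add: Qform_def killing_sym)
  ultimately show "bilinear Q" by (simp add: bilinear_def)
  fix x :: 'g assume "x \<noteq> 0"
  have "B (kpart br k x) (kpart br k x) \<le> 0" "B (x - kpart br k x) (x - kpart br k x) \<ge> 0"
    using k_neg[OF kpart_k[of x]] p_pos[OF kpart_p[of x]]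
    by (force simp: killing_zero_left intro: less_imp_le)+
  moreover have "B (kpart br k x) (kpart br k x) < 0 \<or> B (x - kpart br k x) (x - kpart br k x) > 0"
    using k_neg[OF kpart_k[of x]] p_pos[OF kpart_p[of x]] \<open>x \<noteq> 0\<close>
    by (cases "kpart br k x = 0") auto
  ultimately show "Q x x > 0" unfolding Qform_def by linarith
qed

text \<open>Knowing one argument is enough: k and p are orthogonal, so only the matching component
  of the other argument counts. With \<open>Q_p\<close> this is the dictionary between the two
  forms.\<close>

lemma Q_k: "x \<in> k \<Longrightarrow> Q x y = - B x y"
  using kp_orth[OF _ kpart_p[of y]]
  by (simp add: Qform_def kpart_of_k killing_zero_left killing_diff_right)

lemma Q_p: "x \<in> p \<Longrightarrow> Q x y = B x y"
  using pk_orth[OF kpart_k[of y]]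
  by (simp add: Qform_def kpart_of_p killing_zero_left killing_diff_right)

lemma Q_kp: "x \<in> k \<Longrightarrow> y \<in> p \<Longrightarrow> Q x y = 0" and Q_pk: "x \<in> k \<Longrightarrow> y \<in> p \<Longrightarrow> Q y x = 0"
  by (simp_all add: Q_k Q_p kp_orth pk_orth)

lemma br_kp: "u \<in> k \<Longrightarrow> y \<in> p \<Longrightarrow> br u y \<in> p"
  unfolding p_iff by (metis br_anti k_br killing_inv killing_sym)

lemma br_pk: "u \<in> k \<Longrightarrow> y \<in> p \<Longrightarrow> br y u \<in> p"
  using br_kp[of u y] br_anti[of y u] p_subspace by (simp add: subspace_neg)

lemma kpart_br: "u \<in> k \<Longrightarrow> kpart br k (br u x) = br u (kpart br k x)"
  using br_kp[OF _ kpart_p[of x], of u] by (intro kpart_eqI k_br kpart_k) (auto simp: br_diff_right)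

text \<open>Bracketing with \<open>u\<close> commutes with the projection to k and is skew for the
  Killing form, hence skew for each of the two terms of \<open>Qform\<close>.\<close>

lemma Q_skew: "u \<in> k \<Longrightarrow> Q (br u x) y = - Q x (br u y)"
  by (simp add: Qform_def kpart_br br_diff_right[symmetric] killing_skew)

text \<open>One basis per subspace is fixed by choice, so that sums over it can appear in
  statements; \<open>onb_trace_indep\<close> allows a change of basis.\<close>

definition qb :: "'g set \<Rightarrow> 'g set" where "qb U = (SOME E. onb U E)"

lemma onb_qb: "subspace U \<Longrightarrow> onb U (qb U)"
  unfolding qb_def using onb_exists by (rule someI_ex)

lemmas Ek = onb_qb[OF k_subspace] and Ep = onb_qb[OF p_subspace]

lemma onb_kp: "(\<Sum>e\<in>qb k \<union> qb p. Q x e *\<^sub>R e) = x"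
proof -
  have "qb k \<inter> qb p = {}"
    using onb_D(2)[OF Ek] onb_D(2)[OF Ep] onb_D(3)[OF Ek] kp_Int q_zero_left
    by (metis disjoint_iff subsetD zero_neq_one)
  then have "(\<Sum>e\<in>qb k \<union> qb p. Q x e *\<^sub>R e) = (\<Sum>e\<in>qb k. Q x e *\<^sub>R e) + (\<Sum>e\<in>qb p. Q x e *\<^sub>R e)"
    using onb_D(1)[OF Ek] onb_D(1)[OF Ep] by (rule sum.union_disjoint[rotated 2])
  also have "(\<Sum>e\<in>qb k. Q x e *\<^sub>R e) = (\<Sum>e\<in>qb k. Q (kpart br k x) e *\<^sub>R e)"
    using onb_D(2)[OF Ek] Q_pk[OF _ kpart_p[of x]]
    by (intro sum.cong) (auto simp: q_diff_left)
  also have "\<dots> = kpart br k x" by (rule onb_D(5)[OF Ek kpart_k])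
  also have "(\<Sum>e\<in>qb p. Q x e *\<^sub>R e) = (\<Sum>e\<in>qb p. Q (x - kpart br k x) e *\<^sub>R e)"
    using onb_D(2)[OF Ep] Q_kp[OF kpart_k[of x]]
    by (intro sum.cong) (auto simp: q_diff_left)
  also have "\<dots> = x - kpart br k x" by (rule onb_D(5)[OF Ep kpart_p])
  finally show ?thesis by simp
qed

lemma trace_kp:
  assumes "linear f"
  shows "trace_lin f = (\<Sum>u\<in>qb k. Q (f u) u) + (\<Sum>y\<in>qb p. Q (f y) y)"
proof -
  have "qb k \<inter> qb p = {}"
    using onb_D(2)[OF Ek] onb_D(2)[OF Ep] onb_D(3)[OF Ek] kp_Int q_zero_left
    by (metis disjoint_iff subsetD zero_neq_one)
  then show ?thesis
    unfolding trace_lin_onb[OF assms onb_kp]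
    using onb_D(1)[OF Ek] onb_D(1)[OF Ep] by (rule sum.union_disjoint[rotated 2])
qed

end

subsection \<open>The bracket of two elements of p lies in k\<close>

text \<open>On the left the two factors are contractions over \<open>M\<close> and over
  \<open>G\<close>. Exchanging summations contracts the outer indices instead, which gives factors
  that can be evaluated.\<close>

lemma sum_contract:
  fixes a b c e :: "'i \<Rightarrow> 'j \<Rightarrow> real"
  shows "(\<Sum>z\<in>F. \<Sum>v\<in>F'. (\<Sum>m\<in>M. a z m * b v m) * (\<Sum>u\<in>G. c z u * e v u))
    = (\<Sum>m\<in>M. \<Sum>u\<in>G. (\<Sum>z\<in>F. a z m * c z u) * (\<Sum>v\<in>F'. b v m * e v u))"
proof -
  let ?t = "\<lambda>z v m u. a z m * c z u * (b v m * e v u)"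
  have "(\<Sum>z\<in>F. \<Sum>v\<in>F'. (\<Sum>m\<in>M. a z m * b v m) * (\<Sum>u\<in>G. c z u * e v u))
      = (\<Sum>z\<in>F. \<Sum>v\<in>F'. \<Sum>m\<in>M. \<Sum>u\<in>G. ?t z v m u)"
    by (simp add: sum_product mult_ac)
  also have "\<dots> = (\<Sum>z\<in>F. \<Sum>m\<in>M. \<Sum>v\<in>F'. \<Sum>u\<in>G. ?t z v m u)"
    by (rule sum.cong[OF refl], rule sum.swap)
  also have "\<dots> = (\<Sum>m\<in>M. \<Sum>z\<in>F. \<Sum>v\<in>F'. \<Sum>u\<in>G. ?t z v m u)"
    by (rule sum.swap)
  also have "\<dots> = (\<Sum>m\<in>M. \<Sum>z\<in>F. \<Sum>u\<in>G. \<Sum>v\<in>F'. ?t z v m u)"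
    by (rule sum.cong[OF refl], rule sum.cong[OF refl], rule sum.swap)
  also have "\<dots> = (\<Sum>m\<in>M. \<Sum>u\<in>G. \<Sum>z\<in>F. \<Sum>v\<in>F'. ?t z v m u)"
    by (rule sum.cong[OF refl], rule sum.swap)
  finally show ?thesis by (simp add: sum_product)
qed

lemma sum_rotate:
  "(\<Sum>x\<in>F. \<Sum>y\<in>F. \<Sum>z\<in>F. h y z x) = (\<Sum>x\<in>F. \<Sum>y\<in>F. \<Sum>z\<in>F. (h x y z :: real))"
  by (subst sum.swap) (rule sum.cong[OF refl], rule sum.swap)

context inner_form begin

lemma onb_zero:
  assumes "onb U E" "linear (\<phi> :: 'g \<Rightarrow> 'b::real_vector)" "\<And>e. e \<in> E \<Longrightarrow> \<phi> e = 0" "x \<in> U"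
  shows "\<phi> x = 0"
  using onb_functional[OF assms(1,4,2)] assms(3) by simp

lemma orth_decomp:
  assumes "subspace U"
  shows "\<exists>a\<in>U. \<forall>y\<in>U. q (x - a) y = 0"
proof -
  obtain E where E: "onb U E" using onb_exists[OF assms] ..
  define a where "a = (\<Sum>e\<in>E. q x e *\<^sub>R e)"
  have "a \<in> U" using onb_D(2)[OF E] assms
    by (auto simp: a_def intro!: subspace_sum subspace_scale)
  moreover have "q (x - a) y = 0" if y: "y \<in> U" for y
  proof -
    have "q a y = (\<Sum>e\<in>E. q x e * q e y)"
      unfolding a_def q_sum_left q_scale_left
      by simp
    also have "\<dots> = (\<Sum>e\<in>E. q y e * q x e)"
      by (intro sum.cong refl) (simp only: q_sym[of _ y] mult.commute)
    also have "\<dots> = q x y" using onb_inner[OF E y, of x] q_sym[of x y] by simp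
    finally show ?thesis by (simp add: q_diff_left)
  qed
  ultimately show ?thesis by blast
qed

end

context cartan begin

lemma p_expand:
  assumes "a \<in> p" "linear \<phi>"
  shows "(\<Sum>z\<in>qb p. B a z * \<phi> z) = (\<phi> a :: real)"
  using onb_functional[OF Ep assms] by (simp add: Q_p assms)

text \<open>The two bases together are pseudo-orthonormal for the Killing form, with sign plus on p
  and minus on k. The projections drop out because each basis vector sees only its own
  component.\<close>

lemma killing_expand:
  "B a b = (\<Sum>m\<in>qb p. B a m * B b m) - (\<Sum>u\<in>qb k. B a u * B b u)"
proof -
  let ?a = "kpart br k a" and ?b = "kpart br k b"
  have "B (a - ?a) (b - ?b) = Q (a - ?a) (b - ?b)" by (simp add: Q_p kpart_p)
  also have "\<dots> = (\<Sum>m\<in>qb p. Q (a - ?a) m * Q (b - ?b) m)" by (rule onb_inner[OF Ep kpart_p, symmetric])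
  also have "\<dots> = (\<Sum>m\<in>qb p. B a m * B b m)"
  proof (intro sum.cong refl)
    fix m assume "m \<in> qb p"
    then have "m \<in> p" using onb_D(2)[OF Ep] by auto
    then have "Q (x - kpart br k x) m = B x m" for x
      using kp_orth[OF kpart_k[of x], of m] by (simp only: Q_p kpart_p killing_diff_left diff_0_right)
    then show "Q (a - ?a) m * Q (b - ?b) m = B a m * B b m" by simp
  qed
  finally have 1: "B (a - ?a) (b - ?b) = \<dots>" .
  have "- B ?a ?b = Q ?a ?b" by (simp add: Q_k kpart_k)
  also have "\<dots> = (\<Sum>u\<in>qb k. Q ?a u * Q ?b u)" by (rule onb_inner[OF Ek kpart_k, symmetric])
  also have "\<dots> = (\<Sum>u\<in>qb k. B a u * B b u)"
  proof (intro sum.cong refl)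
    fix u assume "u \<in> qb k"
    then have "u \<in> k" using onb_D(2)[OF Ek] by auto
    then have "Q (kpart br k x) u = - B x u" for x
      using pk_orth[OF _ kpart_p[of x], of u] by (simp only: Q_k kpart_k killing_diff_left right_minus_eq)
    then show "Q ?a u * Q ?b u = B a u * B b u" by simp
  qed
  finally have 2: "B ?a ?b = - \<dots>" by simp
  have "B (a - ?a + ?a) (b - ?b + ?b) = B (a - ?a) (b - ?b) + B ?a ?b"
    using kp_orth[OF kpart_k kpart_p, of a b] pk_orth[OF kpart_k kpart_p, of a b]
    by (simp only: killing_add_left killing_add_right add_0_left add_0_right)
  then have "B a b = B (a - ?a) (b - ?b) + B ?a ?b" by simp
  then show ?thesis using 1 2 by simp
qed

text \<open>Infinitesimal invariance of the trilinear form \<open>B (br y z) m\<close> under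
  \<open>u\<close>; it becomes a cyclic identity in \<open>sum_squares_vanish\<close>.\<close>

lemma killing_k_inv:
  "B (br (br u y) z) m + B (br y (br u z)) m + B (br y z) (br u m) = 0"
  using killing_skew[of u "br y z" m] by (simp add: br_deriv[of u y z] killing_add_left)

text \<open>The sum is minus the trace of \<open>br m \<circ> br u\<close>, and that trace is
  \<open>B m u = 0\<close>. The basis of k contributes nothing to it, since
  \<open>br m (br u v)\<close> lies in p for \<open>v\<close> in k.\<close>

lemma sum_bracket_pk:
  assumes m: "m \<in> p" and u: "u \<in> k"
  shows "(\<Sum>y\<in>qb p. \<Sum>z\<in>qb p. B (br y z) m * B (br y z) u) = 0"
proof -
  have "0 = B m u" using pk_orth[OF u m] by simp
  also have "\<dots> = (\<Sum>v\<in>qb k. Q (br m (br u v)) v) + (\<Sum>y\<in>qb p. Q (br m (br u y)) y)"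
    unfolding killing_def by (subst trace_kp) (auto intro!: linear_compose br_linear_right)
  also have "(\<Sum>v\<in>qb k. Q (br m (br u v)) v) = 0"
    using onb_D(2)[OF Ek] u m by (intro sum.neutral) (auto intro!: Q_pk br_pk k_br)
  also have "(\<Sum>y\<in>qb p. Q (br m (br u y)) y)
      = - (\<Sum>y\<in>qb p. \<Sum>z\<in>qb p. B (br y z) m * B (br y z) u)"
  proof -
    have "Q (br m (br u y)) y = - (\<Sum>z\<in>qb p. B (br y z) m * B (br y z) u)" if "y \<in> qb p" for y
    proof -
      have y: "y \<in> p" using that onb_D(2)[OF Ep] by auto
      have "Q (br m (br u y)) y = - B (br u y) (br m y)"
        using y by (metis Q_p q_sym killing_sym killing_skew)
      also have "B (br u y) (br m y) = (\<Sum>z\<in>qb p. B (br u y) z * B (br m y) z)"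
        using p_expand[OF br_kp[OF u y] killing_linear_right[of "br m y"]]
        by (simp add: killing_sym[of "br m y"])
      also have "\<dots> = (\<Sum>z\<in>qb p. B (br y z) m * B (br y z) u)"
        by (intro sum.cong refl) (metis killing_inv killing_sym mult.commute)
      finally show ?thesis .
    qed
    then show ?thesis by (simp add: sum_negf)
  qed
  finally show ?thesis by simp
qed

text \<open>With \<open>P\<close> and \<open>F\<close> the contractions of the p-part and of the k-part of the bracket on p,
  the Jacobi identity says that the cyclic sums of \<open>P\<close> and \<open>F\<close> agree. Pairing this with \<open>P\<close>
  and using \<open>B(k,p) = 0\<close> gives \<open>|cyc P|\<^sup>2 / 3 + X = 0\<close>, where \<open>X\<close> is the sum of squares
  which is seen to vanish here.\<close>

lemma sum_squares_vanish:
  "(\<Sum>x\<in>qb p. \<Sum>y\<in>qb p. \<Sum>m\<in>qb p. \<Sum>u\<in>qb k. (B (br (br u y) x) m)^2) \<le> 0"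
proof -
  let ?F = "qb p" and ?G = "qb k"
  have Fp: "x \<in> p" if "x \<in> ?F" for x using that onb_D(2)[OF Ep] by auto
  have Gk: "x \<in> k" if "x \<in> ?G" for x using that onb_D(2)[OF Ek] by auto
  \<comment> \<open>\<open>w\<close> is alternating: cyclic rotations of its arguments are free and
    transpositions cost a sign.\<close>
  define w where "w x y z = B (br x y) z" for x y z
  have w12: "w y x z = - w x y z" and w23: "w x z y = - w x y z" for x y z
    unfolding w_def by (metis br_anti killing_minus_left, metis killing_skew killing_sym)
  define P where "P x y z v = (\<Sum>m\<in>?F. w y z m * w x v m)" for x y z v
  define F where "F x y z v = (\<Sum>u\<in>?G. w y z u * w x v u)" for x y z v
  define C where "C x y z v = P x y z v + P y z x v + P z x y v" for x y z v
  define tot where "tot f = (\<Sum>x\<in>?F. \<Sum>y\<in>?F. \<Sum>z\<in>?F. \<Sum>v\<in>?F. (f x y z v :: real))" for f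
  have tot_rot: "tot (\<lambda>x y z v. f y z x v) = tot f" for f
    unfolding tot_def by (rule sum_rotate[where h = "\<lambda>x y z. \<Sum>v\<in>?F. f x y z v"])
  have tot_swap: "tot (\<lambda>x y z v. f x z y v) = tot f" for f
    unfolding tot_def by (rule sum.cong[OF refl], rule sum.swap)
  have tot_add: "tot (\<lambda>x y z v. f x y z v + g x y z v) = tot f + tot g" for f g
    by (simp add: tot_def sum.distrib)
  have PF: "B (br y z) (br x v) = P x y z v - F x y z v" for x y z v
    unfolding P_def F_def w_def by (rule killing_expand)
  have C_F: "C x y z v = F x y z v + F y z x v + F z x y v" for x y z v
  proof -
    have "B (br (br y z) x + br (br z x) y + br (br x y) z) v = 0"
      using br_cyclic[of x y z] br_anti[of "br y z" x] br_anti[of "br z x" y] br_anti[of "br x y" z]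
      by (metis killing_zero_left minus_add_distrib minus_zero)
    then have "B (br y z) (br x v) + B (br z x) (br y v) + B (br x y) (br z v) = 0"
      by (simp add: killing_add_left killing_inv[of _ _ v])
    then show ?thesis unfolding PF C_def by simp
  qed
  \<comment> \<open>\<open>C\<close> is unchanged when \<open>x\<close>, \<open>y\<close>,
    \<open>z\<close> are rotated, so its squared norm is three times its pairing with
    \<open>P\<close> alone.\<close>
  have sq: "3 * tot (\<lambda>x y z v. P x y z v * C x y z v) \<ge> 0"
  proof -
    let ?h = "\<lambda>x y z v. P x y z v * C x y z v"
    have "tot (\<lambda>x y z v. C x y z v * C x y z v)
        = tot ?h + tot (\<lambda>x y z v. ?h y z x v) + tot (\<lambda>x y z v. ?h z x y v)"
    proof -
      have "C x y z v * C x y z v = ?h x y z v + ?h y z x v + ?h z x y v" for x y z v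
      proof -
        have "C x y z v * C x y z v = (P x y z v + P y z x v + P z x y v) * C x y z v"
          by (simp only: C_def)
        moreover have "C y z x v = C x y z v" "C z x y v = C x y z v" by (simp_all add: C_def)
        ultimately show ?thesis by (simp only: distrib_right)
      qed
      then show ?thesis unfolding tot_add[symmetric] by presburger
    qed
    also have "tot (\<lambda>x y z v. ?h z x y v) = tot (\<lambda>x y z v. ?h y z x v)"
      by (rule tot_rot[of "\<lambda>x y z v. ?h y z x v"])
    also have "tot (\<lambda>x y z v. ?h y z x v) = tot ?h" by (rule tot_rot)
    finally have "3 * tot ?h = tot (\<lambda>x y z v. C x y z v * C x y z v)" by simp
    also have "\<dots> \<ge> 0" by (simp add: tot_def sum_nonneg)
    finally show ?thesis .
  qed
  \<comment> \<open>Paired in the same position, \<open>P\<close> and \<open>F\<close> contract each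
    of the two index pairs separately, and every such contraction is the sum in
    \<open>sum_bracket_pk\<close>.\<close>
  have PF0: "tot (\<lambda>x y z v. P x y z v * F x y z v) = 0"
  proof -
    let ?f = "\<lambda>a m. w (fst a) (snd a) m"
    have pairs: "(\<Sum>a\<in>?F\<times>?F. g a) = (\<Sum>y\<in>?F. \<Sum>z\<in>?F. g (y, z))" for g :: "'g \<times> 'g \<Rightarrow> real"
      by (simp add: sum.cartesian_product)
    have "tot (\<lambda>x y z v. P x y z v * F x y z v)
        = (\<Sum>x\<in>?F. \<Sum>y\<in>?F. \<Sum>z\<in>?F. \<Sum>v\<in>?F. P z x y v * F z x y v)"
      unfolding tot_def
      by (rule sum_rotate[where h = "\<lambda>x y z. \<Sum>v\<in>?F. P z x y v * F z x y v"])
    also have "\<dots> = (\<Sum>a\<in>?F\<times>?F. \<Sum>b\<in>?F\<times>?F. (\<Sum>m\<in>?F. ?f a m * ?f b m) * (\<Sum>u\<in>?G. ?f a u * ?f b u))"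
      by (simp add: pairs P_def F_def)
    also have "\<dots> = (\<Sum>m\<in>?F. \<Sum>u\<in>?G. (\<Sum>a\<in>?F\<times>?F. ?f a m * ?f a u) * (\<Sum>a\<in>?F\<times>?F. ?f a m * ?f a u))"
      by (rule sum_contract)
    also have "\<dots> = 0"
      by (intro sum.neutral ballI)
        (simp add: pairs w_def sum_bracket_pk Fp Gk)
    finally show ?thesis .
  qed
  \<comment> \<open>The other two rotations of \<open>F\<close> pair with \<open>P\<close> to the
    same number: exchanging \<open>y\<close> and \<open>z\<close> carries one into the other, and
    the signs from \<open>P\<close> and \<open>F\<close> cancel. Hence \<open>S\<close> is half the
    nonnegative pairing of \<open>P\<close> with \<open>C\<close>.\<close>
  define S where "S = tot (\<lambda>x y z v. P x y z v * F y z x v)"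
  have S2: "tot (\<lambda>x y z v. P x y z v * F z x y v) = S"
  proof -
    have "P x y z v * F z x y v = P x z y v * F z y x v" for x y z v
      unfolding P_def F_def by (simp only: w12[of y z] w12[of x y] mult_minus_left mult_minus_right
        sum_negf minus_minus)
    then have "(\<lambda>x y z v. P x y z v * F z x y v) = (\<lambda>x y z v. P x z y v * F z y x v)"
      by (intro ext)
    then show ?thesis
      using tot_swap[of "\<lambda>x y z v. P x y z v * F y z x v"] by (simp only: S_def)
  qed
  have P_C: "tot (\<lambda>x y z v. P x y z v * C x y z v) = 2 * S"
    using PF0 S2 S_def by (simp add: C_F distrib_left tot_add)
  define T where "T f = (\<Sum>x\<in>?F. \<Sum>y\<in>?F. \<Sum>m\<in>?F. \<Sum>u\<in>?G. (f u x y m :: real))" for f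
  have T_add: "T (\<lambda>u x y m. f u x y m + g u x y m) = T f + T g" for f g
    by (simp add: T_def sum.distrib)
  have T_cong: "T f = T g"
    if "\<And>u x y m. \<lbrakk>u \<in> ?G; x \<in> ?F; y \<in> ?F; m \<in> ?F\<rbrakk> \<Longrightarrow> f u x y m = g u x y m" for f g
    unfolding T_def using that by (intro sum.cong refl)
  have T_rot: "T (\<lambda>u x y m. f u y m x) = T f" for f
    unfolding T_def by (rule sum_rotate[where h = "\<lambda>x y m. \<Sum>u\<in>?G. f u x y m"])
  define a1 where "a1 u x y m = w (br u x) y m" for u x y m
  have S_T: "S = T (\<lambda>u x y m. a1 u x y m * a1 u y m x)"
  proof -
    have "S = (\<Sum>x\<in>?F. \<Sum>y\<in>?F. \<Sum>m\<in>?F. \<Sum>u\<in>?G.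
       (\<Sum>z\<in>?F. w y z m * w z x u) * (\<Sum>v\<in>?F. w x v m * w y v u))"
      unfolding S_def tot_def P_def F_def
      by (rule sum.cong[OF refl], rule sum.cong[OF refl], rule sum_contract)
    also have "\<dots> = T (\<lambda>u x y m. w y (br x u) m * w x (br u y) m)"
      unfolding T_def
    proof (intro sum.cong refl arg_cong2[where f = "(*)"])
      fix x y m u assume h: "x \<in> ?F" "y \<in> ?F" "m \<in> ?F" "u \<in> ?G"
      have l: "linear (\<lambda>z. w y z m)" for y
        unfolding w_def using linear_compose[OF br_linear_right killing_linear_left]
        by (simp add: comp_def)
      have "(\<Sum>z\<in>?F. w y z m * w z x u) = (\<Sum>z\<in>?F. B (br x u) z * w y z m)"
        by (intro sum.cong refl) (metis w_def killing_inv killing_sym mult.commute)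
      also have "\<dots> = w y (br x u) m"
        by (rule p_expand[OF _ l]) (use h Fp Gk br_pk in auto)
      finally show "(\<Sum>z\<in>?F. w y z m * w z x u) = w y (br x u) m" .
      have "(\<Sum>v\<in>?F. w x v m * w y v u) = (\<Sum>v\<in>?F. B (br u y) v * w x v m)"
        by (intro sum.cong refl) (metis w_def killing_inv killing_sym mult.commute)
      also have "\<dots> = w x (br u y) m"
        by (rule p_expand[OF _ l]) (use h Fp Gk br_kp in auto)
      finally show "(\<Sum>v\<in>?F. w x v m * w y v u) = w x (br u y) m" .
    qed
    also have "\<dots> = T (\<lambda>u x y m. a1 u x y m * a1 u y m x)"
    proof (rule T_cong)
      fix u x y m
      have "w y (br x u) m = w (br u x) y m"
        unfolding w_def using br_anti[of y "br x u"] br_anti[of x u] by (simp add: br_minus_left)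
      moreover have "w x (br u y) m = w (br u y) m x"
        by (metis w12 w23 minus_minus)
      ultimately show "w y (br x u) m * w x (br u y) m = a1 u x y m * a1 u y m x"
        by (simp add: a1_def)
    qed
    finally show ?thesis .
  qed
  \<comment> \<open>Multiplied by \<open>a1\<close> and summed, this says that the sum of squares
    plus \<open>2 * S\<close> is 0, while \<open>S \<ge> 0\<close>.\<close>
  have inv: "a1 u x y m + a1 u y m x + a1 u m x y = 0" for u x y m
  proof -
    have "w (br u x) y m + w x (br u y) m + w x y (br u m) = 0"
      unfolding w_def by (rule killing_k_inv)
    moreover have "w x (br u y) m = w (br u y) m x" by (metis w12 w23 minus_minus)
    moreover have "w x y (br u m) = w (br u m) x y" by (metis w12 w23 minus_minus)
    ultimately show ?thesis by (simp add: a1_def)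
  qed
  have "T (\<lambda>u x y m. a1 u x y m * (a1 u x y m + a1 u y m x + a1 u m x y)) = 0"
    by (simp add: inv T_def)
  then have "T (\<lambda>u x y m. a1 u x y m * a1 u x y m) + T (\<lambda>u x y m. a1 u x y m * a1 u y m x)
      + T (\<lambda>u x y m. a1 u x y m * a1 u m x y) = 0"
    by (simp add: distrib_left T_add)
  moreover have "T (\<lambda>u x y m. a1 u x y m * a1 u m x y) = T (\<lambda>u x y m. a1 u x y m * a1 u y m x)"
    using T_rot[of "\<lambda>u x y m. a1 u x y m * a1 u m x y"] by (simp add: mult.commute)
  ultimately have "T (\<lambda>u x y m. a1 u x y m * a1 u x y m) \<le> 0"
    using S_T P_C sq by simp
  moreover have "T (\<lambda>u x y m. a1 u x y m * a1 u x y m)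
     = (\<Sum>x\<in>qb p. \<Sum>y\<in>qb p. \<Sum>m\<in>qb p. \<Sum>u\<in>qb k. (B (br (br u y) x) m)^2)"
    unfolding T_def by (subst sum.swap) (simp add: a1_def w_def power2_eq_square)
  ultimately show ?thesis by simp
qed

text \<open>A sum of squares that is not positive kills every term on basis vectors; linearity in
  each of the four arguments then removes the bases one at a time.\<close>

lemma br_kpp_zero:
  assumes "u \<in> k" "y \<in> p" "z \<in> p" "m \<in> p"
  shows "B (br (br u y) z) m = 0"
proof -
  let ?F = "qb p" and ?G = "qb k"
  let ?t = "\<lambda>x y m u. (B (br (br u y) x) m)^2"
  note fin = onb_D(1)[OF Ep] onb_D(1)[OF Ek]
  have base: "B (br (br u y) x) m = 0" if "x \<in> ?F" "y \<in> ?F" "m \<in> ?F" "u \<in> ?G" for x y m u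
  proof -
    have "?t x y m u \<le> (\<Sum>u\<in>?G. ?t x y m u)"
      using that fin by (intro member_le_sum[where f = "\<lambda>u. ?t x y m u"]) auto
    also have "\<dots> \<le> (\<Sum>m\<in>?F. \<Sum>u\<in>?G. ?t x y m u)"
      using that fin by (intro member_le_sum[where f = "\<lambda>m. \<Sum>u\<in>?G. ?t x y m u"]) (auto intro: sum_nonneg)
    also have "\<dots> \<le> (\<Sum>y\<in>?F. \<Sum>m\<in>?F. \<Sum>u\<in>?G. ?t x y m u)"
      using that fin by (intro member_le_sum[where f = "\<lambda>y. \<Sum>m\<in>?F. \<Sum>u\<in>?G. ?t x y m u"]) (auto intro!: sum_nonneg)
    also have "\<dots> \<le> (\<Sum>x\<in>?F. \<Sum>y\<in>?F. \<Sum>m\<in>?F. \<Sum>u\<in>?G. ?t x y m u)"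
      using that fin by (intro member_le_sum[where f = "\<lambda>x. \<Sum>y\<in>?F. \<Sum>m\<in>?F. \<Sum>u\<in>?G. ?t x y m u"]) (auto intro!: sum_nonneg)
    also have "\<dots> \<le> 0" by (rule sum_squares_vanish)
    finally show ?thesis by simp
  qed
  have lu: "linear (\<lambda>u. B (br (br u y) x) m)" and ly: "linear (\<lambda>y. B (br (br u y) x) m)"
    and lx: "linear (\<lambda>x. B (br (br u y) x) m)" for u x y m
    by (rule linearI; simp add: br_add_left br_add_right br_scale_left br_scale_right
        killing_add_left killing_scale_left)+
  have 1: "B (br (br u y) x) m = 0" if "x \<in> ?F" "y \<in> ?F" "m \<in> ?F" for x y m
    using onb_zero[OF Ek lu _ assms(1)] base that by blast
  have 2: "B (br (br u y) x) m = 0" if "x \<in> ?F" "m \<in> ?F" for x m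
    using onb_zero[OF Ep ly _ assms(2)] 1 that by blast
  have 3: "B (br (br u y) z) m = 0" if "m \<in> ?F" for m
    using onb_zero[OF Ep lx _ assms(3)] 2 that by blast
  show ?thesis
    using onb_zero[OF Ep killing_linear_right _ assms(4)] 3 by blast
qed

text \<open>The set \<open>R\<close> of elements of p whose brackets with p have no component in p
  is shown to be all of p. It contains the brackets of k with p, so the part \<open>b\<close> of
  \<open>x\<close> orthogonal to \<open>R\<close> commutes with k. Then \<open>br b\<close>
  preserves p and is skew there, which makes \<open>B b b\<close> nonpositive and forces
  \<open>b = 0\<close>.\<close>

lemma br_pp:
  assumes "x \<in> p" "y \<in> p"
  shows "br x y \<in> k"
proof -
  define R where "R = {x \<in> p. \<forall>z\<in>p. \<forall>m\<in>p. B (br x z) m = 0}"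
  have R: "subspace R" using p_subspace
    by (auto simp: R_def subspace_def br_zero_left killing_zero_left br_add_left killing_add_left
        br_scale_left killing_scale_left)
  have kR: "br u z \<in> R" if "u \<in> k" "z \<in> p" for u z
    using that br_kp br_kpp_zero by (auto simp: R_def)
  from orth_decomp[OF R, of x] obtain a where a: "a \<in> R" "\<And>z. z \<in> R \<Longrightarrow> Q (x - a) z = 0" by blast
  define b where "b = x - a"
  have b: "b \<in> p" "\<And>z. z \<in> R \<Longrightarrow> Q b z = 0"
    using a assms(1) p_subspace by (auto simp: b_def R_def intro: subspace_diff)
  have bk: "br u b = 0" if u: "u \<in> k" for u
  proof -
    have "Q (br u b) (br u b) = - Q b (br u (br u b))" by (rule Q_skew[OF u])
    also have "\<dots> = 0" using b(2)[OF kR[OF u br_kp[OF u b(1)]]] by simp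
    finally show ?thesis by (simp add: q_eq_0)
  qed
  have bp: "br b z \<in> p" if "z \<in> p" for z
  proof -
    have "B (br b z) u = 0" if "u \<in> k" for u
      using b(1) bk[OF that] by (metis br_anti killing_inv killing_sym killing_zero_left minus_zero)
    then show ?thesis by (simp add: p_iff)
  qed
  have "B b b = (\<Sum>u\<in>qb k. Q (br b (br b u)) u) + (\<Sum>z\<in>qb p. Q (br b (br b z)) z)"
    unfolding killing_def by (subst trace_kp) (auto intro!: linear_compose br_linear_right)
  also have "(\<Sum>u\<in>qb k. Q (br b (br b u)) u) = 0"
  proof (intro sum.neutral ballI)
    fix u assume "u \<in> qb k"
    then have "br b u = 0" using bk br_anti[of b u] onb_D(2)[OF Ek] by auto
    then show "Q (br b (br b u)) u = 0" by (simp add: br_zero_right q_zero_left)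
  qed
  also have "(\<Sum>z\<in>qb p. Q (br b (br b z)) z) \<le> 0"
  proof (rule sum_nonpos)
    fix z assume "z \<in> qb p"
    then have z: "z \<in> p" using onb_D(2)[OF Ep] by auto
    have "Q (br b (br b z)) z = - B (br b z) (br b z)"
      using z by (metis Q_p q_sym killing_sym killing_skew)
    also have "\<dots> = - Q (br b z) (br b z)" using bp[OF z] by (simp add: Q_p)
    finally show "Q (br b (br b z)) z \<le> 0" using q_nonneg by simp
  qed
  finally have "b = 0" using p_pos[OF b(1)] by force
  then have "x \<in> R" using a by (simp add: b_def)
  then have 0: "B (br x y) m = 0" if "m \<in> p" for m using assms(2) that by (simp add: R_def)
  \<comment> \<open>The component of the bracket in p is orthogonal to p, hence to itself.\<close>
  let ?v = "br x y - kpart br k (br x y)"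
  have "B ?v ?v = 0"
    using 0[OF kpart_p] kp_orth[OF kpart_k kpart_p] by (simp add: killing_diff_left)
  then have "?v = 0" using p_pos[OF kpart_p[of "br x y"]] by force
  then show ?thesis using kpart_k[of "br x y"] by simp
qed

end

subsection \<open>Decomposition of k and irreducibility of p\<close>

context cartan begin

lemma derived_subspace: "subspace (derived br A)"
  by (simp add: derived_def)

lemma br_in_derived: "x \<in> A \<Longrightarrow> y \<in> A \<Longrightarrow> br x y \<in> derived br A"
  unfolding derived_def by (rule span_base) blast

lemma derived_subset:
  assumes "lie_subalgebra br A" shows "derived br A \<subseteq> A"
  unfolding derived_def by (rule span_minimal) (use assms in \<open>auto simp: lie_subalgebra_def\<close>)

lemma derived_k: "derived br k \<subseteq> k"
  by (rule derived_subset) (simp add: lie_subalgebra_def k_subspace k_br)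

text \<open>Invariance moves the bracket onto \<open>z\<close>, which gives one direction. For the
  other, the squared norm of \<open>br z x\<close> is the product of \<open>z\<close> with an
  element of the derived algebra, and definiteness concludes.\<close>

lemma centre_iff: "z \<in> centre br k \<longleftrightarrow> z \<in> k \<and> (\<forall>y\<in>derived br k. Q z y = 0)"
proof safe
  assume z: "z \<in> centre br k"
  show zk: "z \<in> k" using z by (simp add: centre_def)
  fix y assume "y \<in> derived br k"
  then show "Q z y = 0"
    unfolding derived_def
  proof (rule linear_eq_0_on_span[OF q_linear_right[of z], rotated])
    fix y assume "y \<in> {br x y |x y. x \<in> k \<and> y \<in> k}"
    then obtain a b where y: "y = br a b" "a \<in> k" "b \<in> k" by blast
    have "Q z y = - B (br z a) b" using zk y by (simp add: Q_k killing_inv)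
    also have "\<dots> = 0" using z y by (simp add: centre_def killing_zero_left)
    finally show "Q z y = 0" .
  qed
next
  assume z: "z \<in> k" "\<forall>y\<in>derived br k. Q z y = 0"
  have "br z x = 0" if x: "x \<in> k" for x
  proof -
    have "Q (br z x) (br z x) = - B z (br x (br z x))"
      using z x by (simp add: Q_k k_br killing_inv)
    also have "\<dots> = Q z (br x (br z x))" using z by (simp add: Q_k)
    also have "\<dots> = 0" using z x by (auto intro: br_in_derived k_br)
    finally show ?thesis by (simp add: q_eq_0)
  qed
  with z show "z \<in> centre br k" by (simp add: centre_def)
qed

lemma centre_decomp:
  assumes "x \<in> k" shows "\<exists>d\<in>derived br k. x - d \<in> centre br k"
proof -
  obtain d where d: "d \<in> derived br k" "\<forall>y\<in>derived br k. Q (x - d) y = 0"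
    using orth_decomp[OF derived_subspace[of k], of x] by blast
  moreover have "x - d \<in> k" using d assms derived_k by (auto intro: subspace_diff k_subspace)
  ultimately show ?thesis using centre_iff by blast
qed

text \<open>By \<open>centre_decomp\<close> elements of k differ from elements of the derived
  algebra by central ones, which act trivially on \<open>J\<close>.\<close>

lemma ideal_derived_k:
  assumes J: "ideal_of br (derived br k) J"
  shows "ideal_of br k J"
  unfolding ideal_of_def
proof (intro conjI ballI)
  show "subspace J" "J \<subseteq> k" using J derived_k by (auto simp: ideal_of_def)
  fix x y assume x: "x \<in> k" and y: "y \<in> J"
  then obtain d where d: "d \<in> derived br k" "x - d \<in> centre br k" using centre_decomp by blast
  have "br (x - d) y = 0" using d y \<open>J \<subseteq> k\<close> by (auto simp: centre_def)
  then have "br x y = br d y" by (simp add: br_diff_left)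
  then show "br x y \<in> J" using J d y by (simp add: ideal_of_def)
qed

abbreviation simple_ideal where
  "simple_ideal I \<equiv> ideal_of br (derived br k) I \<and> simple_sub br I"

lemma simple_ideal_nonzero: "simple_ideal I \<Longrightarrow> I \<noteq> {0}"
  by (auto simp: simple_sub_def br_zero_left)

lemma simple_derived:
  assumes "simple_sub br I" shows "derived br I = I"
proof -
  have I: "lie_subalgebra br I" using assms by (simp add: simple_sub_def)
  have "ideal_of br I (derived br I)"
    using derived_subset[OF I] derived_subspace br_in_derived by (auto simp: ideal_of_def)
  moreover have "derived br I \<noteq> {0}"
    using assms br_in_derived unfolding simple_sub_def by blast
  ultimately show ?thesis using assms unfolding simple_sub_def by blast
qed

text \<open>The bracket lies in \<open>I \<inter> J\<close>, which is an ideal of both; simplicity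
  and \<open>I \<noteq> J\<close> make it trivial.\<close>

lemma simple_ideals_commute:
  assumes I: "simple_ideal I" and J: "simple_ideal J" and "I \<noteq> J" and x: "x \<in> I" and y: "y \<in> J"
  shows "br x y = 0"
proof -
  have sub: "subspace (I \<inter> J)"
    using I J by (auto simp: ideal_of_def intro: subspace_inter)
  have "ideal_of br I (I \<inter> J)" "ideal_of br J (I \<inter> J)"
    using I J sub by (auto simp: ideal_of_def)
  then have "(I \<inter> J = {0} \<or> I \<inter> J = I) \<and> (I \<inter> J = {0} \<or> I \<inter> J = J)"
    using I J by (auto simp: simple_sub_def)
  then have 0: "I \<inter> J = {0}" using \<open>I \<noteq> J\<close> by blast
  have "br x y \<in> J" using I J x y unfolding ideal_of_def by blast
  moreover have "br y x \<in> I" using I J x y unfolding ideal_of_def by blast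
  then have "br x y \<in> I" using br_anti[of x y] I by (simp add: ideal_of_def subspace_neg)
  ultimately show ?thesis using 0 by blast
qed

text \<open>A simple ideal is its own derived algebra, so \<open>y\<close> is a combination of
  brackets \<open>br a b\<close> inside \<open>J\<close>, and invariance moves \<open>a\<close> next
  to \<open>x\<close>, with which it commutes.\<close>

lemma simple_ideals_orth:
  assumes I: "simple_ideal I" and J: "simple_ideal J" and "I \<noteq> J" and x: "x \<in> I" and y: "y \<in> J"
  shows "Q x y = 0"
proof -
  have xk: "x \<in> k" using I x derived_k by (auto simp: ideal_of_def)
  have "y \<in> span {br a b |a b. a \<in> J \<and> b \<in> J}"
    using simple_derived J y unfolding derived_def by blast
  then show ?thesis
  proof (rule linear_eq_0_on_span[OF q_linear_right[of x], rotated])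
    fix y assume "y \<in> {br a b |a b. a \<in> J \<and> b \<in> J}"
    then obtain a b where y: "y = br a b" "a \<in> J" "b \<in> J" by blast
    then have "br x a = 0" using simple_ideals_commute[OF I J \<open>I \<noteq> J\<close> x] by blast
    then show "Q x y = 0" using xk y by (simp add: Q_k killing_inv[symmetric] killing_zero_left)
  qed
qed

lemma orth_ideal:
  assumes "ideal_of br k I" "x \<in> k" "y \<in> k" "\<forall>z\<in>I. Q y z = 0" "z \<in> I"
  shows "Q (br x y) z = 0"
  using assms by (simp add: Q_skew ideal_of_def)

text \<open>A nonzero ideal of k inside the derived algebra is not abelian, so one of minimal dimension
  is simple; hence the simple ideals have no orthogonal complement.\<close>

lemma orth_simple_ideals:
  assumes x: "x \<in> derived br k" and orth: "\<And>I y. simple_ideal I \<Longrightarrow> y \<in> I \<Longrightarrow> Q x y = 0"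
  shows "x = 0"
proof (rule ccontr)
  assume "x \<noteq> 0"
  define V where "V = {x \<in> derived br k. \<forall>I y. simple_ideal I \<longrightarrow> y \<in> I \<longrightarrow> Q x y = 0}"
  have Vsub: "subspace V" using derived_subspace[of k]
    by (auto simp: V_def subspace_def q_zero_left q_add_left q_scale_left)
  have V: "ideal_of br k V"
    unfolding ideal_of_def
  proof (intro conjI ballI)
    show "V \<subseteq> k" using derived_k by (auto simp: V_def)
    fix x y assume xy: "x \<in> k" "y \<in> V"
    then have "y \<in> k" using \<open>V \<subseteq> k\<close> by blast
    then show "br x y \<in> V"
      using xy orth_ideal[OF ideal_derived_k, of _ x y] unfolding V_def
      by (auto intro!: br_in_derived)
  qed (rule Vsub)
  let ?A = "\<lambda>J. ideal_of br k J \<and> J \<subseteq> V \<and> J \<noteq> {0}"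
  have "x \<in> V" using x orth by (auto simp: V_def)
  then have "?A V" using V \<open>x \<noteq> 0\<close> by auto
  then obtain I where I: "?A I" and min: "\<And>J. ?A J \<Longrightarrow> dim I \<le> dim J"
    using ex_has_least_nat[of ?A V dim] by blast
  have Isub: "subspace I" and Ik: "I \<subseteq> k" and Ider: "I \<subseteq> derived br k"
    using I by (auto simp: ideal_of_def V_def)
  have "simple_ideal I"
    unfolding simple_sub_def
  proof (intro conjI allI impI)
    show "ideal_of br (derived br k) I"
      using I derived_k Ider by (auto simp: ideal_of_def)
    show "lie_subalgebra br I" using I Ik by (auto simp: lie_subalgebra_def ideal_of_def)
    show "\<exists>x\<in>I. \<exists>y\<in>I. br x y \<noteq> 0"
    proof (rule ccontr)
      assume "\<not> ?thesis"
      then have ab: "br x y = 0" if "x \<in> I" "y \<in> I" for x y using that by blast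
      \<comment> \<open>An abelian ideal is central, by the norm of \<open>br x y\<close>. But
        \<open>I\<close> also lies in the derived algebra, which meets the centre only in 0.\<close>
      have "I \<subseteq> centre br k"
      proof
        fix y assume y: "y \<in> I"
        have "br y x = 0" if xk: "x \<in> k" for x
        proof -
          have xy: "br x y \<in> I" using I xk y by (simp add: ideal_of_def)
          have "Q (br x y) (br x y) = - B x (br y (br x y))"
            using xy Ik by (subst Q_k) (auto simp: killing_inv)
          also have "\<dots> = 0" using ab[OF y xy] by (simp add: killing_zero_right)
          finally show ?thesis using br_anti[of y x] by (simp add: q_eq_0)
        qed
        then show "y \<in> centre br k" using y Ik by (auto simp: centre_def)
      qed
      then have "y = 0" if "y \<in> I" for y
        using that Ider centre_iff[of y] q_eq_0[of y] by blast
      then show False using I Isub subspace_0[OF Isub] by blast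
    qed
    fix J assume J: "ideal_of br I J"
    have JI: "J \<subseteq> I" and Jsub: "subspace J" using J by (auto simp: ideal_of_def)
    \<comment> \<open>The component of \<open>x\<close> orthogonal to \<open>I\<close> commutes with
      \<open>I\<close>, since its brackets with \<open>I\<close> lie both in \<open>I\<close> and in
      the orthogonal complement. So \<open>J\<close> is an ideal of k and competes with
      \<open>I\<close> for minimal dimension.\<close>
    have "ideal_of br k J"
      unfolding ideal_of_def
    proof (intro conjI ballI)
      show "J \<subseteq> k" using JI Ik by blast
      fix x y assume x: "x \<in> k" and y: "y \<in> J"
      obtain a where a: "a \<in> I" "\<forall>z\<in>I. Q (x - a) z = 0" using orth_decomp[OF Isub] by blast
      have xa: "x - a \<in> k" using x a Ik by (auto intro: subspace_diff k_subspace)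
      have "br (x - a) y \<in> I" using I xa y JI by (auto simp: ideal_of_def)
      moreover have "Q (br y (x - a)) z = 0" if "z \<in> I" for z
        using orth_ideal[of I y "x - a" z] I that y JI Ik xa a by blast
      then have "Q (br (x - a) y) z = 0" if "z \<in> I" for z
        using that br_anti[of "x - a" y] by (simp add: q_minus_left)
      ultimately have "br (x - a) y = 0" using q_eq_0 by blast
      then have "br x y = br a y" by (simp add: br_diff_left)
      then show "br x y \<in> J" using J a y by (simp add: ideal_of_def)
    qed (rule Jsub)
    then show "J = {0} \<or> J = I"
      using min[of J] JI I Jsub Isub subspace_dim_equal[of J I] by blast
  qed
  moreover obtain y where "y \<in> I" "y \<noteq> 0" using I subspace_0[OF Isub] by blast
  ultimately have "Q y y = 0" using I unfolding V_def by blast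
  then show False using \<open>y \<noteq> 0\<close> by (simp add: q_eq_0)
qed

end

section \<open>The blocks of k and their action on p\<close>

locale cartan_simple = cartan br k for br :: "'g::euclidean_space \<Rightarrow> 'g \<Rightarrow> 'g" and k +
  fixes r s :: nat and kk :: "nat \<Rightarrow> 'g set"
  assumes simple: "simple_sub br UNIV" and nc: "noncompact br" and kdec: "k_decomp br k r s kk"
begin

lemma kk_cases:
  assumes "i \<in> {1..r+s}"
  obtains "i \<in> {1..r}" "simple_ideal (kk i)" | "i = r + 1" "s = 1" "kk i = centre br k"
proof (cases "i \<le> r")
  case True
  then have "kk i \<in> kk ` {1..r}" using assms by auto
  then have "simple_ideal (kk i)" using kdec unfolding k_decomp_def by blast
  then show thesis using that(1) True assms by auto
next
  case False
  then have "i = r + 1" "s = 1" using assms kdec by (auto simp: k_decomp_def)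
  then show thesis using that(2) kdec by (auto simp: k_decomp_def)
qed

lemma simple_ideal_kk: "simple_ideal I \<Longrightarrow> \<exists>i\<in>{1..r+s}. I = kk i"
proof -
  assume "simple_ideal I"
  then have "I \<in> kk ` {1..r}" using kdec unfolding k_decomp_def by blast
  then show ?thesis by force
qed

lemma centre_subspace: "subspace (centre br k)"
  using k_subspace
  by (auto simp: centre_def subspace_def br_zero_left br_add_left br_scale_left)

lemma kk_ideal: "i \<in> {1..r+s} \<Longrightarrow> ideal_of br k (kk i)"
proof (erule kk_cases)
  assume "simple_ideal (kk i)"
  then show ?thesis using ideal_derived_k by blast
next
  assume c: "kk i = centre br k"
  have "br x y = 0" if "x \<in> k" "y \<in> centre br k" for x y
    using that br_anti[of x y] by (simp add: centre_def)
  then show ?thesis using centre_subspace unfolding c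
    by (auto simp: ideal_of_def subspace_0) (simp add: centre_def)
qed

lemma kk_subspace: "i \<in> {1..r+s} \<Longrightarrow> subspace (kk i)"
  and kk_k: "i \<in> {1..r+s} \<Longrightarrow> x \<in> kk i \<Longrightarrow> x \<in> k"
  and kk_br: "i \<in> {1..r+s} \<Longrightarrow> u \<in> k \<Longrightarrow> x \<in> kk i \<Longrightarrow> br u x \<in> kk i"
  using kk_ideal by (auto simp: ideal_of_def)

lemma kk_nonzero: "i \<in> {1..r+s} \<Longrightarrow> kk i \<noteq> {0}"
  by (erule kk_cases) (use simple_ideal_nonzero kdec in \<open>auto simp: k_decomp_def\<close>)

lemma simple_ideal_derived: "simple_ideal I \<Longrightarrow> x \<in> I \<Longrightarrow> x \<in> derived br k"
  by (auto simp: ideal_of_def)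

lemma kk_orth:
  assumes i: "i \<in> {1..r+s}" and j: "j \<in> {1..r+s}" and "i \<noteq> j" and x: "x \<in> kk i" and y: "y \<in> kk j"
  shows "Q x y = 0"
proof (rule kk_cases[OF i]; rule kk_cases[OF j])
  assume "i \<in> {1..r}" "j \<in> {1..r}" and si: "simple_ideal (kk i)" "simple_ideal (kk j)"
  moreover have "inj_on kk {1..r}" using kdec by (simp add: k_decomp_def)
  ultimately have "kk i \<noteq> kk j" using \<open>i \<noteq> j\<close> inj_onD[of kk "{1..r}" i j] by blast
  then show ?thesis using simple_ideals_orth si x y by blast
next
  assume "simple_ideal (kk i)" "kk j = centre br k"
  then show ?thesis using x y centre_iff[of y] simple_ideal_derived q_sym[of x y] by auto
next
  assume "simple_ideal (kk j)" "kk i = centre br k"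
  then show ?thesis using x y centre_iff[of x] simple_ideal_derived by auto
qed (use \<open>i \<noteq> j\<close> in auto)

lemma kk_commute:
  assumes i: "i \<in> {1..r+s}" and j: "j \<in> {1..r+s}" and "i \<noteq> j" and x: "x \<in> kk i" and y: "y \<in> kk j"
  shows "br x y = 0"
proof -
  have "br x y \<in> kk j" using kk_br[OF j] kk_k[OF i] x y by blast
  moreover have "br x y \<in> kk i"
    using kk_br[OF i] kk_k[OF j] x y br_anti[of x y] kk_subspace[OF i] by (simp add: subspace_neg)
  ultimately have "Q (br x y) (br x y) = 0" using kk_orth[OF i j \<open>i \<noteq> j\<close>] by blast
  then show ?thesis by (simp add: q_eq_0)
qed

abbreviation Ei where "Ei i \<equiv> qb (kk i)"

lemma onb_kk: "i \<in> {1..r+s} \<Longrightarrow> onb (kk i) (Ei i)"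
  by (rule onb_qb[OF kk_subspace])

text \<open>The residue \<open>y\<close> is orthogonal to all blocks. Its central part vanishes,
  either because the centre is itself block \<open>r + 1\<close> or because it is trivial; the rest
  lies in the derived algebra, where \<open>orth_simple_ideals\<close> applies.\<close>

lemma k_expand:
  assumes x: "x \<in> k"
  shows "(\<Sum>i=1..r+s. \<Sum>e\<in>Ei i. Q x e *\<^sub>R e) = x"
proof -
  define y where "y = x - (\<Sum>i=1..r+s. \<Sum>e\<in>Ei i. Q x e *\<^sub>R e)"
  have "(\<Sum>i=1..r+s. \<Sum>e\<in>Ei i. Q x e *\<^sub>R e) \<in> k"
    using k_subspace onb_D(2)[OF onb_kk] kk_k
    by (intro subspace_sum subspace_scale) auto
  then have yk: "y \<in> k" using x k_subspace by (simp add: y_def subspace_diff)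
  have yz: "Q y z = 0" if j: "j \<in> {1..r+s}" and z: "z \<in> kk j" for j z
  proof -
    have "Q (\<Sum>i=1..r+s. \<Sum>e\<in>Ei i. Q x e *\<^sub>R e) z
        = (\<Sum>i=1..r+s. if i = j then Q x z else 0)"
      unfolding q_sum_left
    proof (rule sum.cong[OF refl])
      fix i assume i: "i \<in> {1..r+s}"
      show "(\<Sum>e\<in>Ei i. Q (Q x e *\<^sub>R e) z) = (if i = j then Q x z else 0)"
      proof (cases "i = j")
        case True
        have "(\<Sum>e\<in>Ei i. Q (Q x e *\<^sub>R e) z) = (\<Sum>e\<in>Ei j. Q z e * Q x e)"
          using True by (simp add: q_sym[of _ z] q_scale_right mult.commute)
        then show ?thesis using onb_inner[OF onb_kk[OF j] z, of x] True q_sym[of x z] by simp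
      next
        case False
        then show ?thesis using kk_orth[OF i j False _ z] onb_D(2)[OF onb_kk[OF i]]
          by (auto simp: q_scale_left intro!: sum.neutral)
      qed
    qed
    also have "\<dots> = Q x z" using j by simp
    finally show ?thesis by (simp add: y_def q_diff_left)
  qed
  obtain d where d: "d \<in> derived br k" "y - d \<in> centre br k" using centre_decomp[OF yk] by blast
  have "y - d = 0"
  proof (cases "s = 1")
    case True
    then have "r + 1 \<in> {1..r+s}" "kk (r + 1) = centre br k" using kdec by (auto simp: k_decomp_def)
    then have "Q y (y - d) = 0" using yz d by metis
    moreover have "Q d (y - d) = 0" using d centre_iff[of "y - d"] q_sym[of d] by simp
    ultimately have "Q (y - d) (y - d) = 0" by (simp add: q_diff_left)
    then show ?thesis by (simp add: q_eq_0)
  next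
    case False
    then show ?thesis using d kdec by (auto simp: k_decomp_def)
  qed
  then have "y \<in> derived br k" using d by simp
  moreover have "Q y z = 0" if "simple_ideal I" "z \<in> I" for I z
    using yz simple_ideal_kk[OF that(1)] that(2) by blast
  ultimately have "y = 0" by (rule orth_simple_ideals)
  then show ?thesis by (simp add: y_def)
qed

lemma k_not_UNIV: "k \<noteq> UNIV"
  using nc k_neg by (auto simp: noncompact_def)

lemma p_nonzero: "\<exists>y\<in>p. y \<noteq> 0"
proof (rule ccontr)
  assume "\<not> ?thesis"
  then have "x - kpart br k x = 0" for x using kpart_p[of x] by blast
  then have "x \<in> k" for x using kpart_k[of x] by simp
  then show False using k_not_UNIV by blast
qed

lemma ideal_UNIV: "ideal_of br UNIV I \<Longrightarrow> I \<noteq> {0} \<Longrightarrow> I = UNIV"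
  using simple by (auto simp: simple_sub_def)

text \<open>A block commuting with p would be a nonzero ideal of the simple algebra, hence
  everything, whereas k is proper in the non-compact case. This makes \<open>\<kappa> i < 1\<close>
  strict.\<close>

lemma kk_acts:
  assumes i: "i \<in> {1..r+s}"
  shows "\<exists>x\<in>kk i. \<exists>y\<in>p. br x y \<noteq> 0"
proof (rule ccontr)
  assume "\<not> ?thesis"
  then have 0: "br y x = 0" if "x \<in> kk i" "y \<in> p" for x y using that br_anti[of y x] by simp
  have "ideal_of br UNIV (kk i)"
    unfolding ideal_of_def
  proof (intro conjI ballI)
    fix z x assume x: "x \<in> kk i"
    have "br (z - kpart br k z) x = 0" using 0[OF x kpart_p] .
    then have "br z x = br (kpart br k z) x" by (simp add: br_diff_left)
    then show "br z x \<in> kk i" using kk_br[OF i kpart_k x] by simp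
  qed (use kk_subspace[OF i] in auto)
  then have "kk i = UNIV" using ideal_UNIV kk_nonzero[OF i] by blast
  then show False using kk_k[OF i] k_not_UNIV by blast
qed

text \<open>\<open>V\<close> together with its brackets spans an ideal of the simple algebra. The
  crucial fact is \<open>comm\<close>: elements of p orthogonal to \<open>V\<close> commute with
  \<open>V\<close>, so only the components in k and in \<open>V\<close> act. Brackets of
  \<open>V\<close> lie in k, so the ideal reaches nothing in p outside \<open>V\<close>.\<close>

lemma p_irreducible:
  assumes V: "subspace V" "V \<subseteq> p" and inv: "\<And>u v. u \<in> k \<Longrightarrow> v \<in> V \<Longrightarrow> br u v \<in> V" and "V \<noteq> {0}"
  shows "V = p"
proof -
  let ?G = "V \<union> {br a b |a b. a \<in> V \<and> b \<in> V}"
  have comm: "br y v = 0" if y: "y \<in> p" "\<forall>v\<in>V. Q y v = 0" and v: "v \<in> V" for y v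
  proof -
    \<comment> \<open>Being in k, the bracket preserves \<open>V\<close>; so its squared norm pairs
      \<open>y\<close> with an element of \<open>V\<close>.\<close>
    have yv: "br y v \<in> k" using br_pp y v V by blast
    then have "Q (br y v) (br y v) = - B y (br v (br y v))" by (simp add: Q_k killing_inv)
    also have "\<dots> = Q y (br (br y v) v)"
      using y br_anti[of v "br y v"] by (simp add: Q_p killing_minus_right)
    also have "\<dots> = 0" using y inv[OF yv v] by blast
    finally show ?thesis by (simp add: q_eq_0)
  qed
  have gen: "br x g \<in> span ?G" if g: "g \<in> ?G" for x g
  proof -
    let ?u = "kpart br k x"
    obtain a where a: "a \<in> V" "\<forall>z\<in>V. Q (x - ?u - a) z = 0" using orth_decomp[OF V(1)] by blast
    define y where "y = x - ?u - a"
    have y: "y \<in> p" "\<forall>v\<in>V. Q y v = 0"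
      using a V kpart_p[of x] by (auto simp: y_def intro: subspace_diff p_subspace)
    have x: "x = ?u + a + y" by (simp add: y_def)
    have *: "br x g = br ?u g + br a g + br y g"
      by (subst x) (simp only: br_add_left)
    from g consider "g \<in> V" | b c where "g = br b c" "b \<in> V" "c \<in> V" by blast
    then show ?thesis
    proof cases
      case 1
      then have "br ?u g \<in> ?G" "br a g \<in> ?G" "br y g = 0" using inv kpart_k a comm[OF y] by auto
      then show ?thesis unfolding * by (auto intro: span_add span_base)
    next
      case 2
      have "br ?u b \<in> V" "br ?u c \<in> V" using inv kpart_k 2 by auto
      then have "br (br ?u b) c \<in> ?G" "br b (br ?u c) \<in> ?G" using 2 by auto
      then have 1: "br ?u g \<in> span ?G"
        unfolding 2 br_deriv[of ?u b c] by (intro span_add span_base)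
      have "g \<in> k" using 2 V br_pp by blast
      then have "br g a \<in> V" using inv a by blast
      then have "br a g \<in> ?G" using br_anti[of a g] V by (simp add: subspace_neg)
      moreover have "br y g = 0"
        unfolding 2 br_deriv[of y b c] using comm[OF y] 2 by (simp add: br_zero_left br_zero_right)
      ultimately show ?thesis unfolding * using 1 by (auto intro!: span_add intro: span_base)
    qed
  qed
  have "ideal_of br UNIV (span ?G)"
    unfolding ideal_of_def
  proof (intro conjI ballI)
    fix x y assume "y \<in> span ?G"
    then show "br x y \<in> span ?G"
    proof (induction rule: span_induct_alt)
      case base
      then show ?case by (simp add: br_zero_right span_zero)
    next
      case (step c a b)
      then show ?case unfolding br_add_right br_scale_right
        by (blast intro: span_add span_scale gen)
    qed
  qed auto
  moreover obtain v where v: "v \<in> V" "v \<noteq> 0" using \<open>V \<noteq> {0}\<close> subspace_0[OF V(1)] by blast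
  then have "v \<in> span ?G" by (auto intro: span_base)
  then have "span ?G \<noteq> {0}" using v by blast
  ultimately have UN: "span ?G = UNIV" by (rule ideal_UNIV)
  have "y \<in> V" if y: "y \<in> p" for y
  proof -
    obtain a where a: "a \<in> V" "\<forall>z\<in>V. Q (y - a) z = 0" using orth_decomp[OF V(1)] by blast
    have ya: "y - a \<in> p" using y a V by (auto intro: subspace_diff p_subspace)
    have "Q (y - a) z = 0" if "z \<in> span ?G" for z
      using that
    proof (rule linear_eq_0_on_span[OF q_linear_right, rotated])
      fix z assume "z \<in> ?G"
      then show "Q (y - a) z = 0" using a Q_pk[OF br_pp ya] V by blast
    qed
    then have "Q (y - a) (y - a) = 0" using UN by blast
    then show ?thesis using a by (simp add: q_eq_0)
  qed
  then show ?thesis using V by blast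
qed

end

subsection \<open>Casimir operators\<close>

context inner_form begin

lemma onb_trace_indep:
  fixes \<phi> :: "'g \<Rightarrow> 'g \<Rightarrow> real"
  assumes E: "onb U E" and E': "onb U E'" and \<phi>: "bilinear \<phi>"
  shows "(\<Sum>e\<in>E. \<phi> e e) = (\<Sum>e\<in>E'. \<phi> e e)"
proof -
  have l: "linear (\<phi> x)" "linear (\<lambda>x. \<phi> x y)" for x y
    using \<phi> by (auto simp: bilinear_def)
  have "(\<Sum>e\<in>E. \<phi> e e) = (\<Sum>e\<in>E. \<Sum>e'\<in>E'. q e e' * \<phi> e' e)"
    using onb_functional[OF E' _ l(2)] onb_D(2)[OF E] by (intro sum.cong refl) auto
  also have "\<dots> = (\<Sum>e'\<in>E'. \<Sum>e\<in>E. q e' e * \<phi> e' e)"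
    by (subst sum.swap) (simp add: q_sym)
  also have "\<dots> = (\<Sum>e\<in>E'. \<phi> e e)"
    using onb_functional[OF E _ l(1)] onb_D(2)[OF E'] by (intro sum.cong refl) auto
  finally show ?thesis .
qed

end

lemma quadratic_nonneg_imp_zero:
  fixes a b :: real
  assumes "\<And>t. 2 * t * a + t\<^sup>2 * b \<ge> 0" "b \<ge> 0"
  shows "a = 0"
proof (rule ccontr)
  assume "a \<noteq> 0"
  \<comment> \<open>The minimum is at \<open>- a / b\<close>; the shift to \<open>b + 1\<close> also
    covers \<open>b = 0\<close> and still gives a negative value.\<close>
  have "2 * (- a / (b + 1)) * a + (- a / (b + 1))\<^sup>2 * b = - (a\<^sup>2 * (b + 2)) / (b + 1)\<^sup>2"
    using assms(2) by (simp add: divide_simps power2_eq_square) (simp add: algebra_simps)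
  moreover have "a\<^sup>2 * (b + 2) > 0" using \<open>a \<noteq> 0\<close> assms(2) by simp
  then have "- (a\<^sup>2 * (b + 2)) / (b + 1)\<^sup>2 < 0"
    using assms(2) by (intro divide_neg_pos) auto
  ultimately show False using assms(1)[of "- a / (b + 1)"] by linarith
qed

context cartan_simple begin

text \<open>A maximal Rayleigh quotient proves this: with \<open>c\<close> the maximum of
  \<open>\<phi> y y / Q y y\<close>, the form \<open>c * Q x y - \<phi> x y\<close> is positive
  semidefinite on p and vanishes at a maximiser, so its radical is a nonzero invariant subspace and
  hence p.\<close>

lemma invariant_form_scalar:
  assumes bl: "bilinear \<phi>" and sym: "\<And>x y. \<phi> x y = \<phi> y x"
    and inv: "\<And>u x y. \<lbrakk>u \<in> k; x \<in> p; y \<in> p\<rbrakk> \<Longrightarrow> \<phi> (br u x) y = - \<phi> x (br u y)"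
  shows "\<exists>c::real. \<forall>x\<in>p. \<forall>y\<in>p. \<phi> x y = c * Q x y"
proof -
  have l: "linear (\<phi> x)" "linear (\<lambda>x. \<phi> x y)" for x y
    using bl by (auto simp: bilinear_def)
  \<comment> \<open>The auxiliary Euclidean norm serves only for compactness: the quotient
    \<open>f\<close> is homogeneous of degree 0, so its maximum on this sphere is its maximum on p
    without 0.\<close>
  define S where "S = {y \<in> p. norm y = 1}"
  define f where "f y = \<phi> y y / Q y y" for y
  have "S = p \<inter> sphere 0 1" by (auto simp: S_def)
  then have "compact S"
    by (simp only: closed_Int_compact[OF closed_subspace[OF p_subspace] compact_sphere])
  moreover obtain y where "y \<in> p" "y \<noteq> 0" using p_nonzero by blast
  then have "(1 / norm y) *\<^sub>R y \<in> S" by (auto simp: S_def subspace_scale[OF p_subspace])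
  then have "S \<noteq> {}" by blast
  moreover have "continuous_on S f"
  proof -
    have nz: "Q y y \<noteq> 0" if "y \<in> S" for y using that by (auto simp: S_def q_eq_0)
    have "continuous_on S (\<lambda>y. \<phi> y y)" "continuous_on S (\<lambda>y. Q y y)"
      using bounded_bilinear.continuous_on[OF _ continuous_on_id continuous_on_id] bl q_bilinear
      unfolding bilinear_conv_bounded_bilinear by blast+
    then show ?thesis unfolding f_def using nz by (intro continuous_on_divide) auto
  qed
  ultimately obtain y0 where y0: "y0 \<in> S" "\<And>y. y \<in> S \<Longrightarrow> f y \<le> f y0"
    using continuous_attains_sup by metis
  define c where "c = f y0"
  define g where "g x y = c * Q x y - \<phi> x y" for x y
  have g_lin: "linear (g x)" "linear (\<lambda>x. g x y)" for x y
    unfolding g_def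
    by (auto intro!: linearI simp: linear_add[OF l(1)] linear_add[OF l(2)] linear_scale[OF l(1)]
        linear_scale[OF l(2)] q_add_left q_add_right q_scale_left q_scale_right algebra_simps)
  have g_sym: "g x y = g y x" for x y unfolding g_def using sym[of x y] q_sym[of x y] by simp
  have g_nonneg: "g y y \<ge> 0" if y: "y \<in> p" for y
  proof (cases "y = 0")
    case True
    then show ?thesis by (simp add: linear_0[OF g_lin(1)])
  next
    case False
    have "(1 / norm y) *\<^sub>R y \<in> S" using y False by (auto simp: S_def subspace_scale[OF p_subspace])
    from y0(2)[OF this] have "\<phi> y y / Q y y \<le> c"
      using False by (simp add: f_def c_def linear_scale[OF l(1)] linear_scale[OF l(2)] q_scale_left q_scale_right)
    then show ?thesis using q_pos[OF False] by (simp add: g_def divide_le_eq)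
  qed
  have y0p: "y0 \<in> p" "y0 \<noteq> 0" using y0(1) by (auto simp: S_def)
  have g0: "g y0 y0 = 0" using q_pos[OF y0p(2)] by (simp add: g_def c_def f_def)
  have null: "g y0 z = 0" if z: "z \<in> p" for z
  proof (rule quadratic_nonneg_imp_zero[OF _ g_nonneg[OF z]])
    fix t :: real
    have "y0 + t *\<^sub>R z \<in> p" using y0p z p_subspace by (simp add: subspace_add subspace_scale)
    from g_nonneg[OF this] have "0 \<le> g (y0 + t *\<^sub>R z) (y0 + t *\<^sub>R z)" .
    also have "\<dots> = 2 * t * g y0 z + t\<^sup>2 * g z z"
      using g0 g_sym[of z y0]
      by (simp add: linear_add[OF g_lin(1)] linear_add[OF g_lin(2)] linear_scale[OF g_lin(1)]
        linear_scale[OF g_lin(2)] power2_eq_square distrib_left)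
    finally show "0 \<le> 2 * t * g y0 z + t\<^sup>2 * g z z" .
  qed
  define V where "V = {y \<in> p. \<forall>z\<in>p. g y z = 0}"
  have "V = p"
  proof (rule p_irreducible)
    show "subspace V" using p_subspace
      by (auto simp: V_def subspace_def linear_0[OF g_lin(2)] linear_add[OF g_lin(2)] linear_scale[OF g_lin(2)])
    show "V \<subseteq> p" by (auto simp: V_def)
    have "y0 \<in> V" using y0p null by (auto simp: V_def)
    then show "V \<noteq> {0}" using y0p by blast
    fix u v assume u: "u \<in> k" and v: "v \<in> V"
    have "g (br u v) z = 0" if z: "z \<in> p" for z
    proof -
      have "g (br u v) z = - g v (br u z)"
        using inv[OF u _ z, of v] v Q_skew[OF u, of v z] by (simp add: g_def V_def)
      also have "\<dots> = 0" using v br_kp[OF u z] by (simp add: V_def)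
      finally show ?thesis .
    qed
    then show "br u v \<in> V" using u v br_kp by (auto simp: V_def)
  qed
  then have "x \<in> V" if "x \<in> p" for x using that by simp
  then have "\<phi> x y = c * Q x y" if "x \<in> p" "y \<in> p" for x y
    using that by (simp add: V_def g_def)
  then show ?thesis by blast
qed

lemma onb_k_Union: "onb k (\<Union>i\<in>{1..r+s}. Ei i)"
  and Ei_disjoint: "\<lbrakk>i \<in> {1..r+s}; j \<in> {1..r+s}; i \<noteq> j\<rbrakk> \<Longrightarrow> Ei i \<inter> Ei j = {}"
proof -
  have mem: "e \<in> kk i" "Q e e = 1" if "i \<in> {1..r+s}" "e \<in> Ei i" for e i
    using onb_D(2,3)[OF onb_kk[OF that(1)]] that(2) by auto
  have disj: "Ei i \<inter> Ei j = {}" if "i \<in> {1..r+s}" "j \<in> {1..r+s}" "i \<noteq> j" for i j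
    using kk_orth[OF that] mem that by fastforce
  then show "\<lbrakk>i \<in> {1..r+s}; j \<in> {1..r+s}; i \<noteq> j\<rbrakk> \<Longrightarrow> Ei i \<inter> Ei j = {}" .
  have fin: "\<forall>i\<in>{1..r+s}. finite (Ei i)" using onb_D(1)[OF onb_kk] by blast
  have sum: "(\<Sum>e\<in>(\<Union>i\<in>{1..r+s}. Ei i). Q x e *\<^sub>R e) = (\<Sum>i=1..r+s. \<Sum>e\<in>Ei i. Q x e *\<^sub>R e)" for x
    by (rule sum.UNION_disjoint) (use fin disj in auto)
  show "onb k (\<Union>i\<in>{1..r+s}. Ei i)"
    unfolding onb_def sum
  proof (intro conjI ballI)
    fix x y assume "x \<in> (\<Union>i\<in>{1..r+s}. Ei i)" "y \<in> (\<Union>i\<in>{1..r+s}. Ei i)"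
    then obtain i j where ij: "i \<in> {1..r+s}" "x \<in> Ei i" "j \<in> {1..r+s}" "y \<in> Ei j" by blast
    show "Q x y = (if x = y then 1 else 0)"
    proof (cases "i = j")
      case True
      then show ?thesis using ij onb_D(3,4)[OF onb_kk[OF ij(1)]] by auto
    next
      case False
      then show ?thesis using ij mem kk_orth[OF ij(1,3) False] disj by fastforce
    qed
  next
    show "(\<Union>i\<in>{1..r+s}. Ei i) \<subseteq> k" using mem kk_k by blast
  qed (use fin k_expand in auto)
qed

lemma sum_qb_k:
  assumes "bilinear \<phi>"
  shows "(\<Sum>u\<in>qb k. \<phi> u u) = (\<Sum>i=1..r+s. \<Sum>u\<in>Ei i. (\<phi> u u :: real))"
proof -
  have "(\<Sum>u\<in>qb k. \<phi> u u) = (\<Sum>u\<in>(\<Union>i\<in>{1..r+s}. Ei i). \<phi> u u)"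
    by (rule onb_trace_indep[OF Ek onb_k_Union assms])
  also have "\<dots> = (\<Sum>i=1..r+s. \<Sum>u\<in>Ei i. \<phi> u u)"
    by (rule sum.UNION_disjoint) (use onb_D(1)[OF onb_kk] Ei_disjoint in auto)
  finally show ?thesis .
qed

lemma trace_blocks:
  assumes "linear f"
  shows "trace_lin f = (\<Sum>i=1..r+s. \<Sum>u\<in>Ei i. Q (f u) u) + (\<Sum>y\<in>qb p. Q (f y) y)"
proof -
  have "bilinear (\<lambda>x y. Q (f x) y)"
    unfolding bilinear_def using q_linear_right linear_compose[OF assms q_linear_left]
    by (simp add: comp_def)
  from sum_qb_k[OF this] show ?thesis by (simp add: trace_kp[OF assms])
qed

text \<open>Skewness of \<open>br y\<close> turns the trace defining the Killing form into sums of
  products, in which the contributions of the blocks and of p separate.\<close>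

lemma killing_sum:
  assumes "x \<in> k" "y \<in> k"
  shows "Q x y = (\<Sum>i=1..r+s. \<Sum>u\<in>Ei i. Q (br x u) (br y u)) + (\<Sum>z\<in>qb p. Q (br x z) (br y z))"
proof -
  have "- Q x y = B y x" using assms by (simp add: Q_k killing_sym)
  also have "\<dots> = (\<Sum>i=1..r+s. \<Sum>u\<in>Ei i. Q (br y (br x u)) u) + (\<Sum>z\<in>qb p. Q (br y (br x z)) z)"
    unfolding killing_def by (subst trace_blocks) (auto intro!: linear_compose br_linear_right)
  also have "\<dots> = - ((\<Sum>i=1..r+s. \<Sum>u\<in>Ei i. Q (br x u) (br y u)) + (\<Sum>z\<in>qb p. Q (br x z) (br y z)))"
    using assms by (simp add: Q_skew sum_negf)
  finally show ?thesis by linarith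
qed

end

section \<open>Shares of the Killing form carried by the blocks and by p\<close>

locale cartan_kappa = cartan_simple br k r s kk
  for br :: "'g::euclidean_space \<Rightarrow> 'g \<Rightarrow> 'g" and k r s kk +
  fixes \<kappa> :: "nat \<Rightarrow> real"
  assumes kappa: "\<forall>i\<in>{1..r+s}. \<forall>x\<in>kk i. \<forall>y\<in>kk i. killing_on br (kk i) x y = \<kappa> i * killing br x y"
begin

lemma sum_kk_i:
  assumes i: "i \<in> {1..r+s}" and x: "x \<in> kk i" and y: "y \<in> kk i"
  shows "(\<Sum>u\<in>Ei i. Q (br x u) (br y u)) = \<kappa> i * Q x y"
proof -
  have "killing_on br (kk i) y x = (\<Sum>u\<in>Ei i. Q ((br y \<circ> br x) u) u)"
    unfolding killing_on_def
    by (rule trace_on_onb)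
      (use i x y kk_br kk_k kk_subspace onb_kk in \<open>auto intro!: linear_compose br_linear_right\<close>)
  also have "\<dots> = - (\<Sum>u\<in>Ei i. Q (br x u) (br y u))"
    using kk_k[OF i y] by (simp add: Q_skew sum_negf)
  finally have "(\<Sum>u\<in>Ei i. Q (br x u) (br y u)) = - (\<kappa> i * B y x)"
    using kappa i x y by simp
  then show ?thesis using kk_k[OF i y] q_sym[of x y] by (simp add: Q_k)
qed

lemma sum_kk:
  assumes i: "i \<in> {1..r+s}" and j: "j \<in> {1..r+s}" and x: "x \<in> kk i" and y: "y \<in> kk j"
  shows "(\<Sum>l=1..r+s. \<Sum>u\<in>Ei l. Q (br x u) (br y u)) = (if i = j then \<kappa> i * Q x y else 0)"
proof -
  have "(\<Sum>u\<in>Ei l. Q (br x u) (br y u)) = (if l = i then if i = j then \<kappa> i * Q x y else 0 else 0)"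
    if l: "l \<in> {1..r+s}" for l
  proof (cases "l = i \<and> i = j")
    case True
    then show ?thesis using sum_kk_i i x y by simp
  next
    case False
    have "Q (br x u) (br y u) = 0" if "u \<in> Ei l" for u
    proof -
      have u: "u \<in> kk l" using that onb_D(2)[OF onb_kk[OF l]] by blast
      have "br x u = 0 \<or> br y u = 0"
        using False kk_commute[OF i l _ x u] kk_commute[OF j l _ y u] by blast
      then show ?thesis by (auto simp: q_zero_left q_zero_right)
    qed
    then show ?thesis using False by (auto intro!: sum.neutral)
  qed
  then have "(\<Sum>l=1..r+s. \<Sum>u\<in>Ei l. Q (br x u) (br y u))
      = (\<Sum>l=1..r+s. if l = i then if i = j then \<kappa> i * Q x y else 0 else 0)"
    by (intro sum.cong refl)
  then show ?thesis using i by simp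
qed

text \<open>Of the total \<open>Q x y\<close> in \<open>killing_sum\<close> the blocks carry the
  share \<open>\<kappa> i\<close>; p carries what remains.\<close>

lemma sum_p:
  assumes i: "i \<in> {1..r+s}" and j: "j \<in> {1..r+s}" and x: "x \<in> kk i" and y: "y \<in> kk j"
  shows "(\<Sum>z\<in>qb p. Q (br x z) (br y z)) = (if i = j then (1 - \<kappa> i) * Q x y else 0)"
  using killing_sum[OF kk_k[OF i x] kk_k[OF j y]] sum_kk[OF assms]
    kk_orth[OF i j _ x y]
  by (auto simp: algebra_simps)

text \<open>Both shares of \<open>Q x x\<close> are sums of squares, and the one on p is nonzero for
  an element that acts nontrivially on p.\<close>

lemma kappa_bounds:
  assumes i: "i \<in> {1..r+s}"
  shows "0 \<le> \<kappa> i" "\<kappa> i < 1"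
proof -
  obtain x y where x: "x \<in> kk i" and y: "y \<in> p" "br x y \<noteq> 0" using kk_acts[OF i] by blast
  have "x \<noteq> 0" using y by (auto simp: br_zero_left)
  then have Qx: "Q x x > 0" by (rule q_pos)
  have "\<kappa> i * Q x x \<ge> 0"
    unfolding sum_kk_i[OF i x x, symmetric] by (intro sum_nonneg q_nonneg)
  then show "0 \<le> \<kappa> i" using Qx by (simp add: zero_le_mult_iff)
  have "(1 - \<kappa> i) * Q x x = (\<Sum>z\<in>qb p. Q (br x z) (br x z))"
    using sum_p[OF i i x x] by simp
  also have "\<dots> > 0"
  proof (rule ccontr)
    assume "\<not> ?thesis"
    then have "(\<Sum>z\<in>qb p. Q (br x z) (br x z)) = 0"
      using sum_nonneg[of "qb p" "\<lambda>z. Q (br x z) (br x z)"] q_nonneg by (meson antisym not_less)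
    then have "br x z = 0" if "z \<in> qb p" for z
      using that onb_D(1)[OF Ep] q_nonneg by (simp add: sum_nonneg_eq_0_iff q_eq_0)
    then have "br x y = 0" using onb_zero[OF Ep br_linear_right _ y(1)] by blast
    then show False using y by simp
  qed
  finally show "\<kappa> i < 1" using Qx by (simp add: zero_less_mult_iff)
qed

lemma kappa_centre:
  assumes "s = 1"
  shows "\<kappa> (r + 1) = 0"
proof -
  have i: "r + 1 \<in> {1..r+s}" and c: "kk (r + 1) = centre br k"
    using assms kdec by (auto simp: k_decomp_def)
  obtain x where x: "x \<in> kk (r + 1)" "x \<noteq> 0"
    using kk_nonzero[OF i] subspace_0[OF kk_subspace[OF i]] by blast
  have "br x u = 0" if u: "u \<in> Ei (r + 1)" for u
  proof -
    have "u \<in> kk (r + 1)" using u onb_D(2)[OF onb_kk[OF i]] by blast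
    then show ?thesis using x(1) unfolding c by (simp add: centre_def)
  qed
  then have "\<kappa> (r + 1) * Q x x = 0"
    unfolding sum_kk_i[OF i x(1) x(1), symmetric] by (simp add: q_zero_left)
  then show ?thesis using x q_eq_0 by simp
qed

definition cas :: "nat \<Rightarrow> real" where
  "cas i = real (dim (kk i)) * (1 - \<kappa> i) / real (dim p)"

lemma dim_p_pos: "dim p > 0"
proof -
  obtain y where "y \<in> p" "y \<noteq> 0" using p_nonzero by blast
  then have "\<not> p \<subseteq> {0}" by blast
  then show ?thesis using dim_eq_0[of p] by (meson gr0I)
qed

lemma dim_kk_pos:
  assumes "i \<in> {1..r+s}" shows "dim (kk i) > 0"
proof -
  have "\<not> kk i \<subseteq> {0}" using kk_nonzero[OF assms] subspace_0[OF kk_subspace[OF assms]] by blast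
  then show ?thesis using dim_eq_0[of "kk i"] by (meson gr0I)
qed

lemma dim_k_sum: "dim k = (\<Sum>i=1..r+s. dim (kk i))"
proof -
  have "dim k = card (\<Union>i\<in>{1..r+s}. Ei i)" by (rule onb_dim[OF onb_k_Union])
  also have "\<dots> = (\<Sum>i=1..r+s. card (Ei i))"
    by (rule card_UN_disjoint) (use onb_D(1)[OF onb_kk] Ei_disjoint in auto)
  also have "\<dots> = (\<Sum>i=1..r+s. dim (kk i))"
    using onb_dim[OF onb_kk] by (intro sum.cong) auto
  finally show ?thesis .
qed

text \<open>The left side is invariant under k because \<open>br v\<close> acts by a skew matrix on
  \<open>kk i\<close>; hence it is a multiple of \<open>Q\<close> on p. The constant comes from a
  trace over p computed twice: once as \<open>c\<close> times the dimension of p, once with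
  \<open>sum_p\<close> as \<open>1 - \<kappa> i\<close> for each basis vector of
  \<open>kk i\<close>.\<close>

lemma casimir_p:
  assumes i: "i \<in> {1..r+s}" and x: "x \<in> p" and y: "y \<in> p"
  shows "(\<Sum>u\<in>Ei i. Q (br u x) (br u y)) = cas i * Q x y"
proof -
  define h where "h x y = (\<Sum>u\<in>Ei i. Q (br u x) (br u y))" for x y
  have uE: "u \<in> kk i" "u \<in> k" if "u \<in> Ei i" for u
    using that onb_D(2)[OF onb_kk[OF i]] kk_k[OF i] by auto
  have l: "linear (h x)" "linear (\<lambda>x. h x y)" for x y
    unfolding h_def
    by (auto intro!: linearI simp: br_add_right br_scale_right q_add_left q_add_right
        q_scale_left q_scale_right sum.distrib sum_distrib_left)
  have inv: "h (br v x) y = - h x (br v y)" if v: "v \<in> k" for v x y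
  proof -
    have step: "Q (br u (br v x)) (br u y) + Q (br u x) (br u (br v y))
      = Q (br (br u v) x) (br u y) + Q (br u x) (br (br u v) y)" for u
      using Q_skew[OF v, of "br u x" "br u y"]
      unfolding br_deriv[of u v] by (simp add: q_add_left q_add_right)
    have e: "(\<Sum>w\<in>Ei i. Q (br u v) w * f w) = f (br u v)" if "u \<in> Ei i" "linear f"
      for u and f :: "'g \<Rightarrow> real"
    proof -
      have "br u v \<in> kk i"
        using kk_br[OF i v uE(1)[OF that(1)]] br_anti[of u v] kk_subspace[OF i] by (simp add: subspace_neg)
      from onb_functional[OF onb_kk[OF i] this that(2)] show ?thesis by simp
    qed
    have "h (br v x) y + h x (br v y)
      = (\<Sum>u\<in>Ei i. Q (br (br u v) x) (br u y)) + (\<Sum>u\<in>Ei i. Q (br u x) (br (br u v) y))"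
      by (simp add: h_def step flip: sum.distrib)
    also have "(\<Sum>u\<in>Ei i. Q (br (br u v) x) (br u y))
      = (\<Sum>u\<in>Ei i. \<Sum>w\<in>Ei i. Q (br u v) w * Q (br w x) (br u y))"
      using linear_compose[OF br_linear_left q_linear_left]
      by (intro sum.cong refl e[symmetric]) (simp_all add: comp_def)
    \<comment> \<open>Transposing the skew matrix of \<open>br v\<close> turns this term into the
      negative of the other one.\<close>
    also have "\<dots> = (\<Sum>w\<in>Ei i. \<Sum>u\<in>Ei i. - (Q (br w v) u * Q (br w x) (br u y)))"
    proof (subst sum.swap, intro sum.cong refl)
      fix u w
      assume "u \<in> Ei i" "w \<in> Ei i"
      have "Q (br u v) w = - Q (br w v) u"
        using Q_skew[OF v, of u w] br_anti[of u v] br_anti[of w v] q_sym[of u "br v w"]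
        by (simp add: q_minus_left)
      then show "Q (br u v) w * Q (br w x) (br u y) = - (Q (br w v) u * Q (br w x) (br u y))"
        by simp
    qed
    also have "\<dots> = - (\<Sum>w\<in>Ei i. \<Sum>u\<in>Ei i. Q (br w v) u * Q (br w x) (br u y))"
      by (simp add: sum_negf)
    also have "(\<Sum>w\<in>Ei i. \<Sum>u\<in>Ei i. Q (br w v) u * Q (br w x) (br u y))
      = (\<Sum>w\<in>Ei i. Q (br w x) (br (br w v) y))"
      using linear_compose[OF br_linear_left q_linear_right]
      by (intro sum.cong refl e) (simp_all add: comp_def)
    finally show ?thesis by simp
  qed
  have "\<exists>c. \<forall>x\<in>p. \<forall>y\<in>p. h x y = c * Q x y"
  proof (rule invariant_form_scalar)
    show "bilinear h" using l by (simp add: bilinear_def)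
    show "h x y = h y x" for x y unfolding h_def by (simp only: q_sym)
  qed (rule inv)
  then obtain c where c: "\<And>x y. \<lbrakk>x \<in> p; y \<in> p\<rbrakk> \<Longrightarrow> h x y = c * Q x y" by blast
  have "(\<Sum>z\<in>qb p. h z z) = (\<Sum>z\<in>qb p. c)"
    using c onb_D(2,3)[OF Ep] by (intro sum.cong refl) (auto simp: subset_iff)
  then have 1: "(\<Sum>z\<in>qb p. h z z) = c * real (dim p)" by (simp add: onb_dim[OF Ep])
  have "(\<Sum>z\<in>qb p. h z z) = (\<Sum>u\<in>Ei i. \<Sum>z\<in>qb p. Q (br u z) (br u z))"
    unfolding h_def by (rule sum.swap)
  also have "\<dots> = (\<Sum>u\<in>Ei i. 1 - \<kappa> i)"
  proof (rule sum.cong[OF refl])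
    fix u assume u: "u \<in> Ei i"
    show "(\<Sum>z\<in>qb p. Q (br u z) (br u z)) = 1 - \<kappa> i"
      using sum_p[OF i i uE(1)[OF u] uE(1)[OF u]] onb_D(3)[OF onb_kk[OF i] u] by simp
  qed
  also have "\<dots> = real (dim (kk i)) * (1 - \<kappa> i)" by (simp add: onb_dim[OF onb_kk[OF i]])
  finally have "c * real (dim p) = real (dim (kk i)) * (1 - \<kappa> i)" using 1 by simp
  moreover have "real (dim p) \<noteq> 0" using dim_p_pos by linarith
  ultimately have "c = cas i" unfolding cas_def by (metis nonzero_mult_div_cancel_right)
  then show ?thesis using c[OF x y] by (simp add: h_def)
qed

text \<open>Since \<open>br y\<close> exchanges k and p, the two halves of the trace
  \<open>B y y\<close> are equal, and each is the sum of all Casimir forms at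
  \<open>y\<close>.\<close>

lemma sum_casimir: "(\<Sum>i=1..r+s. cas i) = 1 / 2"
proof -
  obtain y where y: "y \<in> p" "y \<noteq> 0" using p_nonzero by blast
  have "Q y y = B y y" using y by (simp add: Q_p)
  also have "\<dots> = (\<Sum>u\<in>qb k. Q (br y (br y u)) u) + (\<Sum>z\<in>qb p. Q (br y (br y z)) z)"
    unfolding killing_def by (subst trace_kp) (auto intro!: linear_compose br_linear_right)
  also have "(\<Sum>u\<in>qb k. Q (br y (br y u)) u) = (\<Sum>u\<in>qb k. Q (br u y) (br u y))"
  proof (intro sum.cong refl)
    fix u assume "u \<in> qb k"
    then have u: "u \<in> k" using onb_D(2)[OF Ek] by blast
    have "Q (br y (br y u)) u = B (br y u) (br y u)"
      using u y by (simp add: Q_k br_pp br_pk killing_skew[of y "br y u"])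
    also have "\<dots> = Q (br y u) (br y u)" using u y by (simp add: Q_p br_pk)
    also have "\<dots> = Q (br u y) (br u y)"
      using br_anti[of y u] by (simp add: q_minus_left q_minus_right)
    finally show "Q (br y (br y u)) u = Q (br u y) (br u y)" .
  qed
  also have "(\<Sum>z\<in>qb p. Q (br y (br y z)) z) = (\<Sum>z\<in>qb p. \<Sum>u\<in>qb k. Q (br u y) z * Q (br u y) z)"
  proof (intro sum.cong refl)
    fix z assume "z \<in> qb p"
    then have z: "z \<in> p" using onb_D(2)[OF Ep] by blast
    have yz: "br y z \<in> k" using y z by (simp add: br_pp)
    have "Q (br y (br y z)) z = - B (br y z) (br y z)"
      using y yz by (simp add: Q_p br_pk killing_skew[of y "br y z"])
    also have "\<dots> = Q (br y z) (br y z)" using yz by (simp add: Q_k)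
    also have "\<dots> = (\<Sum>u\<in>qb k. Q (br y z) u * Q (br y z) u)"
      by (rule onb_inner[OF Ek yz, symmetric])
    also have "\<dots> = (\<Sum>u\<in>qb k. Q (br u y) z * Q (br u y) z)"
    proof (rule sum.cong[OF refl])
      fix u assume "u \<in> qb k"
      then have u: "u \<in> k" using onb_D(2)[OF Ek] by blast
      have "Q (br y z) u = - Q (br u y) z"
        using u y yz by (simp add: Q_k Q_p br_kp killing_inv killing_sym[of _ u])
      then show "Q (br y z) u * Q (br y z) u = Q (br u y) z * Q (br u y) z" by simp
    qed
    finally show "Q (br y (br y z)) z = (\<Sum>u\<in>qb k. Q (br u y) z * Q (br u y) z)" .
  qed
  also have "\<dots> = (\<Sum>u\<in>qb k. \<Sum>z\<in>qb p. Q (br u y) z * Q (br u y) z)" by (rule sum.swap)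
  also have "\<dots> = (\<Sum>u\<in>qb k. Q (br u y) (br u y))"
    using onb_inner[OF Ep br_kp[OF _ y(1)]] onb_D(2)[OF Ek] by (intro sum.cong refl) blast
  finally have "Q y y = 2 * (\<Sum>u\<in>qb k. Q (br u y) (br u y))" by simp
  also have "bilinear (\<lambda>u v. Q (br u y) (br v y))"
    unfolding bilinear_def using linear_compose[OF br_linear_left q_linear_left]
      linear_compose[OF br_linear_left q_linear_right] by (simp add: comp_def)
  from sum_qb_k[OF this]
  have "(\<Sum>u\<in>qb k. Q (br u y) (br u y)) = (\<Sum>i=1..r+s. cas i * Q y y)"
    using casimir_p y by simp
  finally show ?thesis using y q_eq_0[of y] by (simp add: sum_distrib_right[symmetric])
qed

end

subsection \<open>The Ricci tensor\<close>

context cartan begin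

lemma qproj_eqI:
  assumes U: "subspace U" and w: "w \<in> U" "\<And>z. z \<in> U \<Longrightarrow> Q (x - w) z = 0"
  shows "qproj br k U x = w"
  unfolding qproj_def
proof (rule the_equality)
  fix w' assume w': "w' \<in> U \<and> (\<forall>z\<in>U. Q (x - w') z = 0)"
  then have m: "w' - w \<in> U" using w U by (simp add: subspace_diff)
  have "Q (w' - w) (w' - w) = Q (x - w) (w' - w) - Q (x - w') (w' - w)"
    by (simp add: q_diff_left)
  also have "\<dots> = 0" using w(2)[OF m] w' m by simp
  finally show "w' = w" by (simp add: q_eq_0)
qed (use w in auto)

lemma qproj_mem: "subspace U \<Longrightarrow> qproj br k U x \<in> U"
  and qproj_orth: "subspace U \<Longrightarrow> z \<in> U \<Longrightarrow> Q (x - qproj br k U x) z = 0"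
proof -
  assume U: "subspace U"
  obtain a where a: "a \<in> U" "\<forall>z\<in>U. Q (x - a) z = 0" using orth_decomp[OF U] by blast
  then have "qproj br k U x = a" using qproj_eqI[OF U] by blast
  then show "qproj br k U x \<in> U" "z \<in> U \<Longrightarrow> Q (x - qproj br k U x) z = 0" using a by auto
qed

lemma qproj_id: "subspace U \<Longrightarrow> x \<in> U \<Longrightarrow> qproj br k U x = x"
  by (rule qproj_eqI) (auto simp: q_zero_left)

lemma qproj_zero: "subspace U \<Longrightarrow> (\<And>z. z \<in> U \<Longrightarrow> Q x z = 0) \<Longrightarrow> qproj br k U x = 0"
  by (rule qproj_eqI) (auto simp: subspace_0)

lemma qproj_linear:
  assumes U: "subspace U"
  shows "linear (qproj br k U)"
proof (rule linearI; rule qproj_eqI[OF U])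
  fix x y :: 'g and c :: real
  show "qproj br k U x + qproj br k U y \<in> U" "c *\<^sub>R qproj br k U x \<in> U"
    using U by (auto intro: subspace_add subspace_scale qproj_mem)
  fix z assume "z \<in> U"
  then show "Q (x + y - (qproj br k U x + qproj br k U y)) z = 0"
    "Q (c *\<^sub>R x - c *\<^sub>R qproj br k U x) z = 0"
    using qproj_orth[OF U, of z x] qproj_orth[OF U, of z y]
    by (simp_all add: q_diff_left q_add_left q_scale_left)
qed

lemma Qres_eq:
  assumes U: "subspace U"
  shows "Qres br k U x y = Q (qproj br k U x) y"
  using qproj_orth[OF U qproj_mem[OF U, of x], of y]
    q_sym[of "qproj br k U x" y] q_sym[of "qproj br k U x" "qproj br k U y"]
  by (simp add: Qres_def q_diff_left)

lemma killing_nondeg: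
  assumes "\<And>z. B a z = 0" shows "a = 0"
proof -
  have "Q (a - kpart br k a) a = 0" using assms by (simp add: Q_p kpart_p killing_sym[of _ a])
  moreover have "Q (kpart br k a) a = 0" using assms by (simp add: Q_k kpart_k killing_sym[of _ a])
  ultimately show ?thesis by (simp add: q_diff_left q_eq_0)
qed

end

context cartan_simple begin

lemma linear_zero_k:
  assumes l: "linear (\<phi> :: 'g \<Rightarrow> 'b::real_vector)"
    and 0: "\<And>i x. i \<in> {1..r+s} \<Longrightarrow> x \<in> kk i \<Longrightarrow> \<phi> x = 0" and x: "x \<in> k"
  shows "\<phi> x = 0"
proof -
  have "\<phi> x = \<phi> (\<Sum>i=1..r+s. \<Sum>e\<in>Ei i. Q x e *\<^sub>R e)" by (simp only: k_expand[OF x])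
  also have "\<dots> = (\<Sum>i=1..r+s. \<Sum>e\<in>Ei i. Q x e *\<^sub>R \<phi> e)"
    by (simp add: linear_sum[OF l] linear_scale[OF l])
  also have "\<dots> = 0"
    using 0 onb_D(2)[OF onb_kk] by (intro sum.neutral ballI) (simp add: subset_iff)
  finally show ?thesis .
qed

lemma linear_zero:
  assumes l: "linear (\<phi> :: 'g \<Rightarrow> 'b::real_vector)"
    and p0: "\<And>x. x \<in> p \<Longrightarrow> \<phi> x = 0" and k0: "\<And>i x. i \<in> {1..r+s} \<Longrightarrow> x \<in> kk i \<Longrightarrow> \<phi> x = 0"
  shows "\<phi> x = 0"
proof -
  have "\<phi> (kpart br k x + (x - kpart br k x)) = 0"
    unfolding linear_add[OF l]
    using linear_zero_k[OF l k0 kpart_k] p0[OF kpart_p] by simp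
  then show ?thesis by simp
qed

text \<open>The operator that represents \<open>form\<close> through the Killing form instead of
  \<open>Q\<close>, so that brackets can be moved freely. The sign on the blocks of k is that of
  \<open>Q\<close> against the Killing form.\<close>

definition Dmap :: "real \<Rightarrow> (nat \<Rightarrow> real) \<Rightarrow> 'g \<Rightarrow> 'g" where
  "Dmap \<beta> \<alpha> x = \<beta> *\<^sub>R qproj br k p x - (\<Sum>i=1..r+s. \<alpha> i *\<^sub>R qproj br k (kk i) x)"

text \<open>The common shape of the metrics, the prescribed tensor and the Ricci tensor; hence the
  coefficients carry no sign condition.\<close>

definition form :: "real \<Rightarrow> (nat \<Rightarrow> real) \<Rightarrow> 'g \<Rightarrow> 'g \<Rightarrow> real" where
  "form \<beta> \<alpha> x y = \<beta> * Qres br k p x y + (\<Sum>i=1..r+s. \<alpha> i * Qres br k (kk i) x y)"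

lemma Dmap_linear: "linear (Dmap \<beta> \<alpha>)"
proof -
  note l = qproj_linear[OF p_subspace]
  have li: "qproj br k (kk i) (x + y) = qproj br k (kk i) x + qproj br k (kk i) y"
    "qproj br k (kk i) (c *\<^sub>R x) = c *\<^sub>R qproj br k (kk i) x" if "i \<in> {1..r+s}" for i x y c
    using linear_add[OF qproj_linear[OF kk_subspace[OF that]]]
      linear_scale[OF qproj_linear[OF kk_subspace[OF that]]] by auto
  show ?thesis
    unfolding Dmap_def
    by (rule linearI) (simp_all add: li linear_add[OF l] linear_scale[OF l] algebra_simps
        sum.distrib scaleR_sum_right)
qed

lemma Dmap_p: "x \<in> p \<Longrightarrow> Dmap \<beta> \<alpha> x = \<beta> *\<^sub>R x"
proof -
  assume x: "x \<in> p"
  have "qproj br k (kk i) x = 0" if "i \<in> {1..r+s}" for i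
    by (rule qproj_zero[OF kk_subspace[OF that]]) (use x Q_pk kk_k that in blast)
  then show ?thesis using x by (simp add: Dmap_def qproj_id p_subspace)
qed

lemma Dmap_kk:
  assumes i: "i \<in> {1..r+s}" and x: "x \<in> kk i"
  shows "Dmap \<beta> \<alpha> x = - \<alpha> i *\<^sub>R x"
proof -
  have "qproj br k p x = 0"
    by (rule qproj_zero[OF p_subspace]) (use x Q_kp kk_k i in blast)
  moreover have "qproj br k (kk j) x = (if j = i then x else 0)" if j: "j \<in> {1..r+s}" for j
    using qproj_id[OF kk_subspace[OF i] x] qproj_zero[OF kk_subspace[OF j]] kk_orth[OF i j _ x]
    by auto
  then have "(\<Sum>j=1..r+s. \<alpha> j *\<^sub>R qproj br k (kk j) x) = (\<Sum>j=1..r+s. if j = i then \<alpha> i *\<^sub>R x else 0)"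
    by (intro sum.cong refl) auto
  ultimately show ?thesis using i by (simp add: Dmap_def)
qed

lemma Dmap_k: "x \<in> k \<Longrightarrow> Dmap \<beta> \<alpha> x \<in> k"
proof -
  assume x: "x \<in> k"
  have "qproj br k p x = 0"
    by (rule qproj_zero[OF p_subspace]) (use x Q_kp in blast)
  moreover have "(\<Sum>i=1..r+s. \<alpha> i *\<^sub>R qproj br k (kk i) x) \<in> k"
    using qproj_mem[OF kk_subspace] kk_k k_subspace by (intro subspace_sum subspace_scale) auto
  ultimately show ?thesis using k_subspace by (simp add: Dmap_def subspace_neg)
qed

lemma form_Dmap: "form \<beta> \<alpha> x y = B (Dmap \<beta> \<alpha> x) y"
proof -
  have "\<alpha> i * Qres br k (kk i) x y = - \<alpha> i * B (qproj br k (kk i) x) y" if "i \<in> {1..r+s}" for i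
    using that qproj_mem[OF kk_subspace[OF that], of x] kk_k
    by (simp add: Qres_eq kk_subspace Q_k)
  then have "(\<Sum>i=1..r+s. \<alpha> i * Qres br k (kk i) x y) = (\<Sum>i=1..r+s. - \<alpha> i * B (qproj br k (kk i) x) y)"
    by (intro sum.cong refl)
  moreover have "Qres br k p x y = B (qproj br k p x) y"
    using qproj_mem[OF p_subspace, of x] by (simp add: Qres_eq p_subspace Q_p)
  ultimately show ?thesis
    by (simp add: form_def Dmap_def killing_diff_left killing_scale_left killing_sum_left sum_negf)
qed

lemma Dmap_sym: "B (Dmap \<beta> \<alpha> x) y = B x (Dmap \<beta> \<alpha> y)"
proof -
  have "form \<beta> \<alpha> x y = form \<beta> \<alpha> y x" by (simp add: form_def Qres_def q_sym)
  then show ?thesis by (simp add: form_Dmap killing_sym[of x])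
qed

lemma form_bilinear: "bilinear (form \<beta> \<alpha>)"
  using linear_compose[OF Dmap_linear killing_linear_left] killing_linear_right
  by (simp add: bilinear_def form_Dmap[abs_def] comp_def)

lemma form_p: "x \<in> p \<Longrightarrow> form \<beta> \<alpha> x y = \<beta> * Q x y"
  by (simp add: form_Dmap Dmap_p killing_scale_left Q_p)

lemma form_kk: "i \<in> {1..r+s} \<Longrightarrow> x \<in> kk i \<Longrightarrow> form \<beta> \<alpha> x y = \<alpha> i * Q x y"
  by (simp add: form_Dmap Dmap_kk killing_scale_left killing_minus_left Q_k kk_k)

end

section \<open>Levi-Civita connection and curvature of a naturally reductive metric\<close>

locale naturally_reductive = cartan_kappa br k r s kk \<kappa>
  for br :: "'g::euclidean_space \<Rightarrow> 'g \<Rightarrow> 'g" and k r s kk \<kappa> +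
  fixes \<beta> :: real and \<alpha> :: "nat \<Rightarrow> real"
  assumes beta_pos: "\<beta> > 0" and alpha_pos: "i \<in> {1..r+s} \<Longrightarrow> \<alpha> i > 0"
begin

abbreviation D where "D \<equiv> Dmap \<beta> \<alpha>"
abbreviation D' where "D' \<equiv> Dmap (1 / \<beta>) (\<lambda>i. 1 / \<alpha> i)"

lemmas D_add = linear_add[OF Dmap_linear]
  and D_diff = linear_diff[OF Dmap_linear]
  and D_scale = linear_scale[OF Dmap_linear]
  and D_zero = linear_0[OF Dmap_linear]
  and D_minus = linear_neg[OF Dmap_linear]

lemma D_D': "D (D' x) = x"
proof -
  have "linear (\<lambda>x. D (D' x) - x)"
    by (rule linearI) (simp_all add: D_add D_scale algebra_simps)
  then have "D (D' x) - x = 0"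
  proof (rule linear_zero)
    show "D (D' x) - x = 0" if "x \<in> p" for x
      using that beta_pos by (simp add: Dmap_p D_scale)
    show "D (D' x) - x = 0" if "i \<in> {1..r+s}" "x \<in> kk i" for i x
      using that alpha_pos[OF that(1)] by (simp add: Dmap_kk D_scale D_minus)
  qed
  then show ?thesis by simp
qed

lemma D'_D: "D' (D x) = x"
proof -
  have "linear (\<lambda>x. D' (D x) - x)"
    by (rule linearI) (simp_all add: D_add D_scale algebra_simps)
  then have "D' (D x) - x = 0"
  proof (rule linear_zero)
    show "D' (D x) - x = 0" if "x \<in> p" for x
      using that beta_pos by (simp add: Dmap_p D_scale)
    show "D' (D x) - x = 0" if "i \<in> {1..r+s}" "x \<in> kk i" for i x
      using that alpha_pos[OF that(1)] by (simp add: Dmap_kk D_scale D_minus)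
  qed
  then show ?thesis by simp
qed

text \<open>The Koszul formula solved explicitly: invariance of the Killing form rewrites it as
  \<open>2 * B (D (nab X Y)) Z = B (D (br X Y) + br X (D Y) - br (D X) Y) Z\<close>, and
  \<open>D'\<close> inverts \<open>D\<close>.\<close>

definition nab :: "'g \<Rightarrow> 'g \<Rightarrow> 'g" where
  "nab X Y = (1/2) *\<^sub>R (br X Y + D' (br X (D Y) - br (D X) Y))"

lemma nab_linear_left: "linear (\<lambda>X. nab X Y)" and nab_linear_right: "linear (nab X)"
  by (rule linearI; simp add: nab_def br_add_left br_add_right br_scale_left br_scale_right
      D_add D_scale D_diff algebra_simps)+

lemma lc_eq: "lc (form \<beta> \<alpha>) br X Y = nab X Y"
  unfolding lc_def
proof (rule the_equality)
  have *: "2 * form \<beta> \<alpha> (nab X Y) Z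
      = form \<beta> \<alpha> (br X Y) Z - form \<beta> \<alpha> (br Y Z) X + form \<beta> \<alpha> (br Z X) Y" for Z
  proof -
    have 1: "form \<beta> \<alpha> (br Y Z) X = B (br (D X) Y) Z"
      unfolding form_Dmap by (metis Dmap_sym killing_inv killing_sym)
    have "form \<beta> \<alpha> (br Z X) Y = B Z (br X (D Y))"
      unfolding form_Dmap Dmap_sym[of _ _ "br Z X"] by (rule killing_inv)
    then have 2: "form \<beta> \<alpha> (br Z X) Y = B (br X (D Y)) Z" by (simp add: killing_sym)
    show ?thesis
      unfolding 1 2
      by (simp add: form_Dmap nab_def D_scale D_add D_D' killing_scale_left killing_add_left
          killing_diff_left)
  qed
  then show "\<forall>Z. 2 * form \<beta> \<alpha> (nab X Y) Z
      = form \<beta> \<alpha> (br X Y) Z - form \<beta> \<alpha> (br Y Z) X + form \<beta> \<alpha> (br Z X) Y" by blast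
  fix U assume U: "\<forall>Z. 2 * form \<beta> \<alpha> U Z
      = form \<beta> \<alpha> (br X Y) Z - form \<beta> \<alpha> (br Y Z) X + form \<beta> \<alpha> (br Z X) Y"
  have "B (D (U - nab X Y)) Z = 0" for Z
    using U[rule_format, of Z] *[of Z] by (simp add: form_Dmap D_diff killing_diff_left)
  then have "D (U - nab X Y) = 0" by (rule killing_nondeg)
  then show "U = nab X Y" using D'_D[of "U - nab X Y"] by (simp add: D_zero)
qed

lemma torsion_free: "br X Y = nab X Y - nab Y X"
proof -
  have "br X (D Y) - br (D X) Y = br Y (D X) - br (D Y) X"
    using br_anti[of Y "D X"] br_anti[of "D Y" X] by simp
  then have "nab X Y - nab Y X = (1/2) *\<^sub>R (br X Y - br Y X)"
    by (simp only: nab_def) (simp add: algebra_simps)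
  then show ?thesis using br_anti[of Y X] by (simp flip: scaleR_2)
qed

text \<open>Unimodularity: each basis vector lies in k or in p, where \<open>Q\<close> is the
  Killing form up to sign, and \<open>B (br Z W) Z\<close> vanishes by invariance.\<close>

lemma trace_br: "trace_lin (\<lambda>Z. br Z W) = 0"
proof -
  have "B (br Z W) Z = 0" for Z
    by (metis br_self killing_inv killing_sym killing_zero_right killing_zero_left)
  then have "Q (br Z W) Z = 0" if "Z \<in> k \<or> Z \<in> p" for Z
    using that by (metis Q_k Q_p q_sym killing_sym neg_equal_0_iff_equal)
  then show ?thesis
    using onb_D(2)[OF Ek] onb_D(2)[OF Ep] by (subst trace_kp[OF br_linear_left]) (simp add: subset_iff)
qed

lemma Q_D'_p: "y \<in> p \<Longrightarrow> Q (D' x) y = (1 / \<beta>) * Q x y"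
  and Q_D'_kk: "i \<in> {1..r+s} \<Longrightarrow> y \<in> kk i \<Longrightarrow> Q (D' x) y = - (1 / \<alpha> i) * Q x y"
proof -
  assume y: "y \<in> p"
  have "Q (D' x) y = B (D' x) y" using y by (metis Q_p q_sym killing_sym)
  also have "\<dots> = (1 / \<beta>) * B x y" unfolding Dmap_sym using y by (simp add: Dmap_p killing_scale_right)
  also have "B x y = Q x y" using y by (metis Q_p q_sym killing_sym)
  finally show "Q (D' x) y = (1 / \<beta>) * Q x y" .
next
  assume i: "i \<in> {1..r+s}" and y: "y \<in> kk i"
  have Qy: "Q z y = - B z y" for z using kk_k[OF i y] by (metis Q_k q_sym killing_sym)
  show "Q (D' x) y = - (1 / \<alpha> i) * Q x y"
    unfolding Qy Dmap_sym using y i by (simp add: Dmap_kk killing_scale_right killing_minus_right)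
qed

text \<open>\<open>D'\<close> is diagonal in the adapted basis, so it only rescales diagonal entries
  that are already 0.\<close>

lemma trace_D'_br: "trace_lin (\<lambda>Z. D' (br Z V)) = 0"
proof -
  have l: "linear (\<lambda>Z. D' (br Z V))"
    using linear_compose[OF br_linear_left Dmap_linear] by (simp add: comp_def)
  have B0: "B (br Z V) Z = 0" for Z
    by (metis br_self killing_inv killing_sym killing_zero_right killing_zero_left)
  then have 0: "Q (br Z V) Z = 0" if "Z \<in> k \<or> Z \<in> p" for Z
    using that by (metis Q_k Q_p q_sym killing_sym neg_equal_0_iff_equal)
  have "Q (D' (br u V)) u = 0" if "i \<in> {1..r+s}" "u \<in> Ei i" for i u
  proof -
    have "u \<in> kk i" using that onb_D(2)[OF onb_kk[OF that(1)]] by blast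
    then show ?thesis using 0 kk_k[OF that(1)] Q_D'_kk[OF that(1)] by simp
  qed
  moreover have "Q (D' (br y V)) y = 0" if "y \<in> qb p" for y
    using that onb_D(2)[OF Ep] 0 Q_D'_p by (simp add: subset_iff)
  ultimately show ?thesis by (subst trace_blocks[OF l]) simp
qed

lemma trace_nab: "trace_lin (\<lambda>Z. nab Z W) = 0"
proof -
  have l: "linear (\<lambda>Z. br Z W)" by (rule br_linear_left)
  have "trace_lin (\<lambda>Z. D' (br (D Z) W)) = trace_lin (D' \<circ> ((\<lambda>Z. br Z W) \<circ> D))"
    by (simp add: comp_def)
  also have "\<dots> = trace_lin (((\<lambda>Z. br Z W) \<circ> D) \<circ> D')"
    by (intro trace_lin_comp_commute linear_compose Dmap_linear l)
  also have "\<dots> = 0" by (simp add: comp_def D_D' trace_br)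
  finally have 3: "trace_lin (\<lambda>Z. D' (br (D Z) W)) = 0" .
  have "trace_lin (\<lambda>Z. nab Z W)
      = (1/2) * trace_lin (\<lambda>Z. (br Z W + D' (br Z (D W))) - D' (br (D Z) W))"
    by (simp add: trace_lin_def nab_def D_diff sum_distrib_left algebra_simps)
  also have "\<dots> = 0"
    unfolding trace_lin_diff trace_lin_add 3 trace_br trace_D'_br by simp
  finally show ?thesis .
qed

text \<open>Vanishing torsion splits the bracket term of the curvature in two. One half cancels the
  second derivative in \<open>X\<close> by cyclicity of the trace, and the term with
  \<open>nab X Y\<close> vanishes by \<open>trace_nab\<close>.\<close>

lemma ric_eq: "ric (form \<beta> \<alpha>) br X Y = - trace_lin (\<lambda>Z. nab (nab Z X) Y)"
proof -
  have "curv (form \<beta> \<alpha>) br Z X Y = nab Z (nab X Y) - nab X (nab Z Y) - (nab (nab Z X) Y - nab (nab X Z) Y)" for Z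
    by (simp add: curv_def lc_eq torsion_free[of Z X] linear_diff[OF nab_linear_left])
  then have "ric (form \<beta> \<alpha>) br X Y
      = trace_lin (\<lambda>Z. nab Z (nab X Y)) - trace_lin (\<lambda>Z. nab X (nab Z Y))
        - (trace_lin (\<lambda>Z. nab (nab Z X) Y) - trace_lin (\<lambda>Z. nab (nab X Z) Y))"
    by (simp add: ric_def trace_lin_diff)
  also have "trace_lin (\<lambda>Z. nab X (nab Z Y)) = trace_lin (\<lambda>Z. nab (nab X Z) Y)"
    using trace_lin_comp_commute[OF nab_linear_right[of X] nab_linear_left[of Y]]
    by (simp add: comp_def)
  finally show ?thesis by (simp add: trace_nab)
qed

lemma half_add_scaleR: "(1/2) *\<^sub>R (v + c *\<^sub>R v) = ((1 + c) / 2) *\<^sub>R v" for v :: 'g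
proof -
  have "v + c *\<^sub>R v = (1 + c) *\<^sub>R v" by (simp add: scaleR_add_left)
  then show ?thesis by simp
qed

abbreviation ratio where "ratio i \<equiv> \<alpha> i / \<beta>"

text \<open>In this and the next three lemmas \<open>D\<close> is scalar on the block of each
  argument, so \<open>nab\<close> collapses to a multiple of one bracket. Where the correction term
  survives, the bracket lies in p, which supplies the factor \<open>1 / \<beta>\<close>.\<close>

lemma nab_pp: "Z \<in> p \<Longrightarrow> Y \<in> p \<Longrightarrow> nab Z Y = (1/2) *\<^sub>R br Z Y"
  by (simp add: nab_def Dmap_p br_scale_left br_scale_right D_zero)

lemma nab_kp:
  assumes i: "i \<in> {1..r+s}" and Z: "Z \<in> kk i" and Y: "Y \<in> p"
  shows "nab Z Y = (1 + ratio i / 2) *\<^sub>R br Z Y"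
proof -
  have eq: "br Z (D Y) - br (D Z) Y = (\<beta> + \<alpha> i) *\<^sub>R br Z Y"
    using i Z Y by (simp add: Dmap_p Dmap_kk br_scale_left br_scale_right br_minus_left scaleR_left.add)
  have "br Z Y \<in> p" using Z Y kk_k[OF i] by (simp add: br_kp)
  moreover have "(\<beta> + \<alpha> i) * (1 / \<beta>) = (1 + ratio i)" using beta_pos by (simp add: field_simps)
  ultimately have "D' ((\<beta> + \<alpha> i) *\<^sub>R br Z Y) = (1 + ratio i) *\<^sub>R br Z Y"
    by (simp only: D_scale Dmap_p scaleR_scaleR)
  then show ?thesis by (simp only: nab_def eq half_add_scaleR) simp
qed

lemma nab_pk:
  assumes i: "i \<in> {1..r+s}" and Y: "Y \<in> kk i" and Z: "Z \<in> p"
  shows "nab Z Y = (- ratio i / 2) *\<^sub>R br Z Y"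
proof -
  have eq: "br Z (D Y) - br (D Z) Y = (- \<alpha> i - \<beta>) *\<^sub>R br Z Y"
    using i Z Y by (simp add: Dmap_p Dmap_kk br_scale_left br_scale_right br_minus_right scaleR_left.diff)
  have "br Z Y \<in> p" using Z Y kk_k[OF i] by (simp add: br_pk)
  moreover have "(- \<alpha> i - \<beta>) * (1 / \<beta>) = (- ratio i - 1)" using beta_pos by (simp add: field_simps)
  ultimately have "D' ((- \<alpha> i - \<beta>) *\<^sub>R br Z Y) = (- ratio i - 1) *\<^sub>R br Z Y"
    by (simp only: D_scale Dmap_p scaleR_scaleR)
  then show ?thesis by (simp only: nab_def eq half_add_scaleR) simp
qed

lemma nab_kk:
  assumes i: "i \<in> {1..r+s}" and j: "j \<in> {1..r+s}" and Z: "Z \<in> kk i" and Y: "Y \<in> kk j"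
  shows "nab Z Y = (1/2) *\<^sub>R br Z Y"
proof -
  have "br Z (D Y) - br (D Z) Y = (\<alpha> i - \<alpha> j) *\<^sub>R br Z Y"
    using i j Z Y
    by (simp add: Dmap_kk br_scale_left br_scale_right br_minus_left br_minus_right scaleR_left.diff)
  also have "\<dots> = 0" using kk_commute[OF i j _ Z Y] by (cases "i = j") auto
  finally show ?thesis by (simp add: nab_def D_zero)
qed

lemma nab_k_k: "Z \<in> k \<Longrightarrow> Y \<in> k \<Longrightarrow> nab Z Y \<in> k"
  unfolding nab_def
  by (intro subspace_scale subspace_add subspace_diff k_subspace Dmap_k k_br)

text \<open>The traces over k and over p contribute equally; together they put the weight
  \<open>1 + ratio i / 2\<close> on each Casimir form, and the constant part of the weights adds up
  through \<open>sum_casimir\<close>.\<close>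

lemma ric_pp:
  assumes X: "X \<in> p" and Y: "Y \<in> p"
  shows "ric (form \<beta> \<alpha>) br X Y = - (1/2 + (1/2) * (\<Sum>i=1..r+s. ratio i * cas i)) * Q X Y"
proof -
  let ?h = "\<lambda>i. (\<Sum>u\<in>Ei i. Q (br u X) (br u Y))"
  have l: "linear (\<lambda>Z. nab (nab Z X) Y)"
    using linear_compose[OF nab_linear_left nab_linear_left] by (simp add: comp_def)
  have "Q (nab (nab u X) Y) u = (1 + ratio i / 2) / 2 * Q (br u X) (br u Y)"
    if i: "i \<in> {1..r+s}" and "u \<in> Ei i" for i u
  proof -
    have u: "u \<in> kk i" using that onb_D(2)[OF onb_kk[OF i]] by blast
    have uk: "u \<in> k" using kk_k[OF i u] .
    have uX: "br u X \<in> p" using uk X by (rule br_kp)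
    have "Q (br (br u X) Y) u = - B (br u X) (br Y u)"
      using uX Y uk by (simp add: Q_k br_pp killing_inv)
    also have "\<dots> = Q (br u X) (br u Y)"
      using uX br_anti[of Y u] by (simp add: Q_p killing_minus_right)
    finally have "Q (br (br u X) Y) u = Q (br u X) (br u Y)" .
    then show ?thesis
      using nab_kp[OF i u X] nab_pp[OF uX Y]
      by (simp add: linear_scale[OF nab_linear_left] linear_neg[OF nab_linear_left]
        q_scale_left q_minus_left)
  qed
  then have 1: "(\<Sum>i=1..r+s. \<Sum>u\<in>Ei i. Q (nab (nab u X) Y) u)
      = (\<Sum>i=1..r+s. (1 + ratio i / 2) / 2 * ?h i)"
    unfolding sum_distrib_left by (intro sum.cong refl)
  have "Q (nab (nab Z X) Y) Z
      = (\<Sum>i=1..r+s. \<Sum>u\<in>Ei i. (1 + ratio i / 2) / 2 * (Q (br u X) Z * Q (br u Y) Z))"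
    if "Z \<in> qb p" for Z
  proof -
    have Z: "Z \<in> p" using that onb_D(2)[OF Ep] by blast
    have w: "br Z X \<in> k" using Z X by (rule br_pp)
    have lw: "linear (\<lambda>w. Q (nab w Y) Z)"
      using linear_compose[OF nab_linear_left q_linear_left] by (simp add: comp_def)
    have "Q (nab (nab Z X) Y) Z = 1/2 * Q (nab (br Z X) Y) Z"
      using Z X by (simp add: nab_pp linear_scale[OF nab_linear_left] linear_neg[OF nab_linear_left]
        q_scale_left q_minus_left)
    \<comment> \<open>The bracket may meet several blocks of k, and the factor in
      \<open>nab_kp\<close> depends on the block.\<close>
    also have "br Z X = (\<Sum>i=1..r+s. \<Sum>u\<in>Ei i. Q (br Z X) u *\<^sub>R u)"
      by (rule k_expand[OF w, symmetric])
    also have "Q (nab \<dots> Y) Z = (\<Sum>i=1..r+s. \<Sum>u\<in>Ei i. Q (br Z X) u * Q (nab u Y) Z)"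
      by (simp add: linear_sum[OF lw] linear_scale[OF lw])
    also have "\<dots> = (\<Sum>i=1..r+s. \<Sum>u\<in>Ei i. (1 + ratio i / 2) * (Q (br u X) Z * Q (br u Y) Z))"
    proof (intro sum.cong refl)
      fix i u assume i: "i \<in> {1..r+s}" and "u \<in> Ei i"
      then have u: "u \<in> kk i" using onb_D(2)[OF onb_kk[OF i]] by blast
      have uk: "u \<in> k" using kk_k[OF i u] .
      have "Q (br Z X) u = - B Z (br X u)" using w by (simp add: Q_k killing_inv)
      also have "\<dots> = B Z (br u X)" using br_anti[of X u] by (simp add: killing_minus_right)
      also have "\<dots> = Q (br u X) Z" using Z q_sym[of "br u X"] by (simp add: Q_p)
      finally show "Q (br Z X) u * Q (nab u Y) Z
          = (1 + ratio i / 2) * (Q (br u X) Z * Q (br u Y) Z)"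
        using nab_kp[OF i u Y] by (simp add: q_scale_left)
    qed
    finally show ?thesis by (simp add: sum_distrib_left)
  qed
  then have "(\<Sum>Z\<in>qb p. Q (nab (nab Z X) Y) Z)
      = (\<Sum>Z\<in>qb p. \<Sum>i=1..r+s. \<Sum>u\<in>Ei i. (1 + ratio i / 2) / 2 * (Q (br u X) Z * Q (br u Y) Z))"
    by (intro sum.cong refl)
  also have "\<dots> = (\<Sum>i=1..r+s. \<Sum>Z\<in>qb p. \<Sum>u\<in>Ei i. (1 + ratio i / 2) / 2 * (Q (br u X) Z * Q (br u Y) Z))"
    by (rule sum.swap)
  also have "\<dots> = (\<Sum>i=1..r+s. \<Sum>u\<in>Ei i. \<Sum>Z\<in>qb p. (1 + ratio i / 2) / 2 * (Q (br u X) Z * Q (br u Y) Z))"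
    by (rule sum.cong[OF refl], rule sum.swap)
  also have "\<dots> = (\<Sum>i=1..r+s. (1 + ratio i / 2) / 2 * ?h i)"
    unfolding sum_distrib_left[symmetric]
  proof (intro sum.cong refl arg_cong2[where f = "(*)"])
    fix i u assume i: "i \<in> {1..r+s}" and "u \<in> Ei i"
    then have "u \<in> k" using onb_D(2)[OF onb_kk[OF i]] kk_k[OF i] by blast
    then show "(\<Sum>Z\<in>qb p. Q (br u X) Z * Q (br u Y) Z) = Q (br u X) (br u Y)"
      using onb_inner[OF Ep br_kp[OF _ X]] by blast
  qed
  finally have "trace_lin (\<lambda>Z. nab (nab Z X) Y) = (\<Sum>i=1..r+s. (1 + ratio i / 2) * ?h i)"
    unfolding trace_blocks[OF l] 1 by (simp flip: sum.distrib)
  also have "\<dots> = (\<Sum>i=1..r+s. (1 + ratio i / 2) * cas i * Q X Y)"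
    using casimir_p[OF _ X Y] by (intro sum.cong refl) simp
  also have "\<dots> = (\<Sum>i=1..r+s. (1 + ratio i / 2) * cas i) * Q X Y"
    by (simp add: sum_distrib_right)
  also have "(\<Sum>i=1..r+s. (1 + ratio i / 2) * cas i)
      = (\<Sum>i=1..r+s. cas i) + (1/2) * (\<Sum>i=1..r+s. ratio i * cas i)"
    unfolding sum_distrib_left sum.distrib[symmetric] by (intro sum.cong refl) (simp add: distrib_right)
  finally show ?thesis unfolding ric_eq sum_casimir by (simp only: mult_minus_left)
qed

lemma ric_kk:
  assumes i: "i \<in> {1..r+s}" and j: "j \<in> {1..r+s}" and X: "X \<in> kk i" and Y: "Y \<in> kk j"
  shows "ric (form \<beta> \<alpha>) br X Y
    = (if i = j then (\<kappa> i + (1 - \<kappa> i) * (ratio i)\<^sup>2) / 4 * Q X Y else 0)"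
proof -
  have l: "linear (\<lambda>Z. nab (nab Z X) Y)"
    using linear_compose[OF nab_linear_left nab_linear_left] by (simp add: comp_def)
  have Xk: "X \<in> k" and Yk: "Y \<in> k" using kk_k[OF i X] kk_k[OF j Y] .
  have br2: "Q (br (br Z X) Y) Z = - Q (br X Z) (br Y Z)" for Z
  proof -
    have "br (br Z X) Y = br Y (br X Z)"
      using br_anti[of "br Z X" Y] br_anti[of Z X] by (simp add: br_minus_right)
    then show ?thesis by (simp add: Q_skew[OF Yk])
  qed
  have p: "Q (nab (nab Z X) Y) Z = - (ratio i * ratio j / 4) * Q (br X Z) (br Y Z)" if "Z \<in> qb p" for Z
  proof -
    have Z: "Z \<in> p" using that onb_D(2)[OF Ep] by blast
    show ?thesis
      using nab_pk[OF i X Z] nab_pk[OF j Y br_pk[OF Xk Z]] br2[of Z]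
      by (simp add: linear_scale[OF nab_linear_left] linear_neg[OF nab_linear_left]
        q_scale_left q_minus_left)
  qed
  have kkl: "Q (nab (nab Z X) Y) Z = - (1/4) * Q (br X Z) (br Y Z)"
    if m: "l \<in> {1..r+s}" and "Z \<in> Ei l" for Z l
  proof -
    have Z: "Z \<in> kk l" using that onb_D(2)[OF onb_kk[OF m]] by blast
    have "br Z X \<in> kk i" using kk_br[OF i kk_k[OF m Z] X] .
    from nab_kk[OF i j this Y] show ?thesis
      using nab_kk[OF m i Z X] br2[of Z]
      by (simp add: linear_scale[OF nab_linear_left] linear_neg[OF nab_linear_left]
        q_scale_left q_minus_left)
  qed
  have "trace_lin (\<lambda>Z. nab (nab Z X) Y)
    = (\<Sum>l=1..r+s. \<Sum>u\<in>Ei l. - (1/4) * Q (br X u) (br Y u))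
      + (\<Sum>Z\<in>qb p. - (ratio i * ratio j / 4) * Q (br X Z) (br Y Z))"
    unfolding trace_blocks[OF l] using p kkl by (intro arg_cong2[where f = "(+)"] sum.cong refl)
  also have "\<dots> = - (1/4) * (if i = j then \<kappa> i * Q X Y else 0)
      - (ratio i * ratio j / 4) * (if i = j then (1 - \<kappa> i) * Q X Y else 0)"
    unfolding sum_distrib_left[symmetric] sum_kk[OF i j X Y] sum_p[OF i j X Y] by simp
  finally show ?thesis
    unfolding ric_eq by (auto simp: power2_eq_square algebra_simps add_divide_distrib diff_divide_distrib)
qed

text \<open>\<open>nab\<close> respects the grading by k and p, so the operator under the trace
  exchanges k and p and has zero diagonal.\<close>

lemma ric_pk:
  assumes i: "i \<in> {1..r+s}" and X: "X \<in> kk i" and Y: "Y \<in> p"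
  shows "ric (form \<beta> \<alpha>) br X Y = 0" "ric (form \<beta> \<alpha>) br Y X = 0"
proof -
  have Xk: "X \<in> k" using kk_k[OF i X] .
  have l: "linear (\<lambda>Z. nab (nab Z X) Y)" for X Y
    using linear_compose[OF nab_linear_left nab_linear_left] by (simp add: comp_def)
  have kpp: "nab Z W \<in> p" if "l \<in> {1..r+s}" "Z \<in> kk l" "W \<in> p" for l Z W
    using that nab_kp[OF that] kk_k[OF that(1,2)] p_subspace by (simp add: br_kp subspace_scale)
  have pkp: "nab Z W \<in> p" if "l \<in> {1..r+s}" "W \<in> kk l" "Z \<in> p" for l Z W
    using that nab_pk[OF that] kk_k[OF that(1,2)] p_subspace by (simp add: br_pk subspace_scale subspace_neg)
  have ppk: "nab Z W \<in> k" if "Z \<in> p" "W \<in> p" for Z W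
    using that nab_pp[OF that] k_subspace by (simp add: br_pp subspace_scale)
  have "Q (nab (nab Z X) Y) Z = 0" if m: "l \<in> {1..r+s}" and "Z \<in> Ei l" for Z l
  proof -
    have Z: "Z \<in> kk l" using that onb_D(2)[OF onb_kk[OF m]] by blast
    have "nab Z X \<in> kk i"
      using nab_kk[OF m i Z X] kk_br[OF i kk_k[OF m Z] X] kk_subspace[OF i] by (simp add: subspace_scale)
    then show ?thesis using kpp[OF i _ Y] Q_pk kk_k[OF m Z] by blast
  qed
  moreover have "Q (nab (nab Z X) Y) Z = 0" if "Z \<in> qb p" for Z
    using that onb_D(2)[OF Ep] ppk[OF pkp[OF i X] Y] Q_kp by blast
  ultimately show "ric (form \<beta> \<alpha>) br X Y = 0" by (simp add: ric_eq trace_blocks[OF l])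
  have "Q (nab (nab Z Y) X) Z = 0" if m: "l \<in> {1..r+s}" and "Z \<in> Ei l" for Z l
  proof -
    have Z: "Z \<in> kk l" using that onb_D(2)[OF onb_kk[OF m]] by blast
    then show ?thesis using pkp[OF i X kpp[OF m Z Y]] Q_pk kk_k[OF m Z] by blast
  qed
  moreover have "Q (nab (nab Z Y) X) Z = 0" if "Z \<in> qb p" for Z
    using that onb_D(2)[OF Ep] nab_k_k[OF ppk[OF _ Y] Xk] Q_kp by blast
  ultimately show "ric (form \<beta> \<alpha>) br Y X = 0" by (simp add: ric_eq trace_blocks[OF l])
qed

lemma ric_bilinear: "bilinear (ric (form \<beta> \<alpha>) br)"
  unfolding bilinear_def
  by (auto intro!: linearI simp: ric_eq linear_add[OF nab_linear_left] linear_add[OF nab_linear_right]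
      linear_scale[OF nab_linear_left] linear_scale[OF nab_linear_right] trace_lin_def
      inner_add_left sum.distrib sum_distrib_left)

text \<open>Bilinearity reduces the identity to pairs of blocks, one use of
  \<open>linear_zero\<close> per argument. Only ratios of the coefficients enter, which reflects
  scale invariance.\<close>

lemma ric_form:
  "ric (form \<beta> \<alpha>) br = form (- (1/2 + (1/2) * (\<Sum>i=1..r+s. ratio i * cas i)))
     (\<lambda>i. (\<kappa> i + (1 - \<kappa> i) * (ratio i)\<^sup>2) / 4)"
  (is "?R = form ?b ?a")
proof (intro ext)
  fix X Y
  have lR: "linear (\<lambda>X. ?R X Y - form ?b ?a X Y)" "linear (\<lambda>Y. ?R X Y - form ?b ?a X Y)" for X Y
    using ric_bilinear form_bilinear[of ?b ?a] unfolding bilinear_def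
    by (auto intro: linear_compose_sub)
  have "?R X Y - form ?b ?a X Y = 0"
  proof (rule linear_zero[OF lR(1)]; rule linear_zero[OF lR(2)])
    show "?R X Y - form ?b ?a X Y = 0" if "X \<in> p" "Y \<in> p" for X Y
      using ric_pp[OF that] form_p[OF that(1)] by simp
    show "?R X Y - form ?b ?a X Y = 0" if "X \<in> p" "i \<in> {1..r+s}" "Y \<in> kk i" for X Y i
      using ric_pk(2)[OF that(2,3,1)] form_p[OF that(1)] Q_pk[OF kk_k[OF that(2,3)] that(1)] by simp
    show "?R X Y - form ?b ?a X Y = 0" if "i \<in> {1..r+s}" "X \<in> kk i" "Y \<in> p" for X Y i
      using ric_pk(1)[OF that] form_kk[OF that(1,2)] Q_kp[OF kk_k[OF that(1,2)] that(3)] by simp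
    show "?R X Y - form ?b ?a X Y = 0"
      if "i \<in> {1..r+s}" "X \<in> kk i" "j \<in> {1..r+s}" "Y \<in> kk j" for X Y i j
      using ric_kk[OF that(1,3,2,4)] form_kk[OF that(1,2)] kk_orth[OF that(1,3) _ that(2,4)] by auto
  qed
  then show "?R X Y = form ?b ?a X Y" by simp
qed

end

subsection \<open>The algebraic system for the prescribed Ricci curvature\<close>

text \<open>Solving the equations on the ideals of k for \<open>x\<^sub>i\<close> in terms of \<open>c\<close> gives \<open>X c i\<close>, and the equation
  on p becomes \<open>F c = 0\<close>. Critical points of the convex function \<open>F\<close> are given by \<open>crit\<close>.\<close>

locale ricci_system =
  fixes I :: "nat set" and n Tp :: real and d \<kappa> T :: "nat \<Rightarrow> real"
  assumes fin: "finite I" and ne: "I \<noteq> {}" and n: "n > 0" and Tp: "Tp > 0"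
    and d: "i \<in> I \<Longrightarrow> d i > 0" and \<kappa>0: "i \<in> I \<Longrightarrow> \<kappa> i \<ge> 0" and \<kappa>1: "i \<in> I \<Longrightarrow> \<kappa> i < 1"
    and T: "i \<in> I \<Longrightarrow> T i > 0"
begin

definition X :: "real \<Rightarrow> nat \<Rightarrow> real" where
  "X c i = sqrt ((4 * c * T i - \<kappa> i) / (1 - \<kappa> i))"

text \<open>The factor \<open>4 * n\<close> clears the denominators of the equation on p, including
  those of the Casimir scalars.\<close>

definition F :: "real \<Rightarrow> real" where
  "F c = 4 * n * c * Tp - 2 * n - 2 * (\<Sum>i\<in>I. d i * (1 - \<kappa> i) * X c i)"

definition dom :: "real set" where "dom = {c. \<forall>i\<in>I. \<kappa> i < 4 * c * T i}"

text \<open>On \<open>dom\<close> the derivative of \<open>X c i\<close> in \<open>c\<close> is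
  \<open>2 * T i / ((1 - \<kappa> i) * X c i)\<close>; the factors \<open>1 - \<kappa> i\<close>
  cancel in the derivative of \<open>F\<close>.\<close>

definition crit :: "real \<Rightarrow> bool" where
  "crit c \<longleftrightarrow> c \<in> dom \<and> (\<Sum>i\<in>I. d i * T i / X c i) = n * Tp"

lemma dom_pos: "c \<in> dom \<Longrightarrow> c > 0"
proof -
  assume c: "c \<in> dom"
  obtain i where i: "i \<in> I" using ne by blast
  then have "4 * c * T i > 0" using c \<kappa>0[OF i] by (force simp: dom_def)
  then show ?thesis using T[OF i] by (simp add: zero_less_mult_iff)
qed

lemma dom_mono: "c \<in> dom \<Longrightarrow> c \<le> c' \<Longrightarrow> c' \<in> dom"
proof -
  assume c: "c \<in> dom" "c \<le> c'"
  have "\<kappa> i < 4 * c' * T i" if i: "i \<in> I" for i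
  proof -
    have "c * T i \<le> c' * T i" using c T[OF i] by (simp add: mult_right_mono)
    then show ?thesis using c(1) i by (force simp: dom_def)
  qed
  then show ?thesis by (simp add: dom_def)
qed

lemma X_sq:
  assumes "i \<in> I" "\<kappa> i \<le> 4 * c * T i"
  shows "(X c i)\<^sup>2 = (4 * c * T i - \<kappa> i) / (1 - \<kappa> i)" "(1 - \<kappa> i) * (X c i)\<^sup>2 = 4 * c * T i - \<kappa> i"
    "X c i \<ge> 0"
  using assms \<kappa>1[OF assms(1)] by (auto simp: X_def)

lemma X_pos: "c \<in> dom \<Longrightarrow> i \<in> I \<Longrightarrow> X c i > 0"
  using \<kappa>1 by (auto simp: X_def dom_def)

lemma X_ge:
  assumes i: "i \<in> I" and t: "t \<ge> 0" and c: "\<kappa> i + (1 - \<kappa> i) * t\<^sup>2 \<le> 4 * c * T i"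
  shows "X c i \<ge> t"
  unfolding X_def using \<kappa>1[OF i] t c by (intro real_le_rsqrt) (simp add: le_divide_eq mult.commute)

lemma X_continuous: "continuous_on A (\<lambda>c. X c i)"
  unfolding X_def divide_inverse by (intro continuous_intros)

lemma F_continuous: "continuous_on A F"
  unfolding F_def by (intro continuous_intros X_continuous)

text \<open>Intermediate values for the sum in \<open>crit\<close>: at \<open>ca\<close> a single
  term already equals \<open>n * Tp\<close>, at \<open>cb\<close> each term is at most the fraction
  \<open>1 / N\<close> of it.\<close>

lemma crit_exists: "\<exists>c. crit c"
proof -
  have "Max ((\<lambda>i. \<kappa> i / T i) ` I) \<in> (\<lambda>i. \<kappa> i / T i) ` I"
    using fin ne by (intro Max_in) auto
  then obtain m where m: "m \<in> I" "Max ((\<lambda>i. \<kappa> i / T i) ` I) = \<kappa> m / T m" by blast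
  have mx: "\<kappa> i / T i \<le> \<kappa> m / T m" if "i \<in> I" for i
    unfolding m(2)[symmetric] using fin that by (intro Max_ge) auto
  note m = m(1)
  \<comment> \<open>The value of \<open>X c i\<close> for which the \<open>i\<close>-th term alone
    equals \<open>n * Tp\<close>.\<close>
  define \<xi> where "\<xi> i = d i * T i / (n * Tp)" for i
  have \<xi>: "\<xi> i > 0" if "i \<in> I" for i using d T n Tp that by (simp add: \<xi>_def)
  \<comment> \<open>Solves \<open>X ca m = \<xi> m\<close>; maximality of
    \<open>\<kappa> m / T m\<close> puts it into \<open>dom\<close>.\<close>
  define ca where "ca = (\<kappa> m + (1 - \<kappa> m) * (\<xi> m)\<^sup>2) / (4 * T m)"
  have "\<kappa> i < 4 * ca * T i" if i: "i \<in> I" for i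
  proof -
    have "\<kappa> m / T m < 4 * ca" using \<xi>[OF m] \<kappa>1[OF m] T[OF m] by (simp add: ca_def field_simps)
    then have "\<kappa> i / T i < 4 * ca" using mx[OF i] by linarith
    then show ?thesis using T[OF i] by (simp add: divide_less_eq)
  qed
  then have ca: "ca \<in> dom" by (simp add: dom_def)
  have "(4 * ca * T m - \<kappa> m) / (1 - \<kappa> m) = (\<xi> m)\<^sup>2"
    using \<kappa>1[OF m] T[OF m] by (simp add: ca_def field_simps)
  then have "X ca m = \<xi> m" using \<xi>[OF m] by (simp add: X_def)
  then have "n * Tp = d m * T m / X ca m"
    using d[OF m] T[OF m] n Tp by (simp add: \<xi>_def)
  also have "\<dots> \<le> (\<Sum>i\<in>I. d i * T i / X ca i)"
    using m fin X_pos[OF ca] d T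
    by (intro member_le_sum[where f = "\<lambda>i. d i * T i / X ca i"]) (auto intro!: less_imp_le[OF divide_pos_pos])
  finally have Ga: "n * Tp \<le> (\<Sum>i\<in>I. d i * T i / X ca i)" .
  define N where "N = real (card I)"
  have N: "N > 0" using fin ne by (simp add: N_def card_gt_0_iff)
  \<comment> \<open>Solves \<open>X (v i) i = N * \<xi> i\<close>; the sum of all \<open>v i\<close>
    dominates each of them.\<close>
  define v where "v i = (\<kappa> i + (1 - \<kappa> i) * (N * \<xi> i)\<^sup>2) / (4 * T i)" for i
  have v: "v i \<ge> 0" if "i \<in> I" for i using \<kappa>0[OF that] \<kappa>1[OF that] T[OF that] by (simp add: v_def)
  define cb where "cb = ca + (\<Sum>i\<in>I. v i)"
  have cb: "ca \<le> cb" using v by (simp add: cb_def sum_nonneg)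
  have Gb: "(\<Sum>i\<in>I. d i * T i / X cb i) \<le> n * Tp"
  proof -
    have "(\<Sum>i\<in>I. d i * T i / X cb i) \<le> (\<Sum>i\<in>I. n * Tp / N)"
    proof (rule sum_mono)
      fix i assume i: "i \<in> I"
      have "v i \<le> (\<Sum>i\<in>I. v i)" using i fin v by (intro member_le_sum) auto
      then have "v i \<le> cb" using dom_pos[OF ca] by (simp add: cb_def)
      then have "\<kappa> i + (1 - \<kappa> i) * (N * \<xi> i)\<^sup>2 \<le> 4 * cb * T i"
        using T[OF i] by (simp add: v_def divide_le_eq mult_ac)
      then have le: "N * \<xi> i \<le> X cb i" using X_ge[OF i] N \<xi>[OF i] by simp
      have "d i * T i / X cb i \<le> d i * T i / (N * \<xi> i)"
        using le N \<xi>[OF i] d[OF i] T[OF i] X_pos[OF dom_mono[OF ca cb] i]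
        by (intro divide_left_mono) (auto intro!: mult_pos_pos)
      also have "\<dots> = n * Tp / N" using d[OF i] T[OF i] n Tp N by (simp add: \<xi>_def)
      finally show "d i * T i / X cb i \<le> n * Tp / N" .
    qed
    also have "\<dots> = n * Tp" using N by (simp add: N_def)
    finally show ?thesis .
  qed
  have "continuous_on {ca..cb} (\<lambda>c. \<Sum>i\<in>I. d i * T i / X c i)"
    using X_pos[OF dom_mono[OF ca]] by (intro continuous_intros X_continuous) force
  then obtain c where "ca \<le> c" "(\<Sum>i\<in>I. d i * T i / X c i) = n * Tp"
    using IVT2'[of "\<lambda>c. \<Sum>i\<in>I. d i * T i / X c i" cb "n * Tp" ca] Ga Gb cb by blast
  then have "crit c" using dom_mono[OF ca] by (simp add: crit_def)
  then show ?thesis ..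
qed

text \<open>Multiplying the equation in \<open>crit\<close> by \<open>4 * c\<close> and replacing
  \<open>4 * c * T i\<close> by its expression in \<open>X c i\<close> eliminates \<open>c\<close>
  from \<open>F\<close>.\<close>

lemma F_crit:
  assumes "crit c"
  shows "F c = (\<Sum>i\<in>I. d i * \<kappa> i / X c i - d i * (1 - \<kappa> i) * X c i) - 2 * n"
proof -
  have c: "c \<in> dom" using assms by (simp add: crit_def)
  have "4 * n * c * Tp = 4 * c * (\<Sum>i\<in>I. d i * T i / X c i)" using assms by (simp add: crit_def)
  also have "\<dots> = (\<Sum>i\<in>I. d i * \<kappa> i / X c i + d i * (1 - \<kappa> i) * X c i)"
    unfolding sum_distrib_left
  proof (rule sum.cong[OF refl])
    fix i assume i: "i \<in> I"
    have "4 * c * T i = \<kappa> i + (1 - \<kappa> i) * (X c i)\<^sup>2"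
      using X_sq(2)[OF i, of c] c i by (force simp: dom_def)
    then have "4 * c * (d i * T i / X c i) = d i * (\<kappa> i + (1 - \<kappa> i) * (X c i)\<^sup>2) / X c i"
      by (metis mult.assoc mult.left_commute times_divide_eq_right)
    also have "\<dots> = d i * \<kappa> i / X c i + d i * (1 - \<kappa> i) * X c i"
      using X_pos[OF c i] by (simp add: field_simps power2_eq_square)
    finally show "4 * c * (d i * T i / X c i) = d i * \<kappa> i / X c i + d i * (1 - \<kappa> i) * X c i" .
  qed
  finally show ?thesis
    by (simp add: F_def sum.distrib sum_subtractf)
qed

text \<open>The terms of the sum in \<open>crit\<close> are positive, so each is at most
  \<open>n * Tp\<close>. This bounds \<open>1 / X c i\<close> from above and \<open>X c i\<close>
  from below, and both bounds enter \<open>F_crit\<close> with the right sign.\<close>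

lemma F_crit_le:
  assumes "crit c"
  shows "F c \<le> (\<Sum>i\<in>I. (n\<^sup>2 * \<kappa> i * Tp\<^sup>2 - (d i)\<^sup>2 * (1 - \<kappa> i) * (T i)\<^sup>2) / (n * Tp * T i)) - 2 * n"
  unfolding F_crit[OF assms]
proof (rule diff_right_mono, rule sum_mono)
  fix i assume i: "i \<in> I"
  have c: "c \<in> dom" using assms by (simp add: crit_def)
  note X = X_pos[OF c]
  have "d i * T i / X c i \<le> (\<Sum>i\<in>I. d i * T i / X c i)"
    using i fin X d T
    by (intro member_le_sum[where f = "\<lambda>i. d i * T i / X c i"]) (auto intro!: less_imp_le[OF divide_pos_pos])
  also have "\<dots> = n * Tp" using assms by (simp add: crit_def)
  finally have le: "d i * T i / X c i \<le> n * Tp" .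
  have 1: "d i / X c i \<le> n * Tp / T i"
    using le T[OF i] by (simp add: le_divide_eq)
  have "d i * T i \<le> n * Tp * X c i" using le X[OF i] by (simp add: divide_le_eq)
  then have 2: "d i * T i / (n * Tp) \<le> X c i" using n Tp by (simp add: divide_le_eq mult.commute)
  have "d i * \<kappa> i / X c i \<le> \<kappa> i * (n * Tp / T i)"
    using mult_left_mono[OF 1 \<kappa>0[OF i]] by (simp add: mult.commute)
  moreover have "d i * (1 - \<kappa> i) * (d i * T i / (n * Tp)) \<le> d i * (1 - \<kappa> i) * X c i"
    using 2 d[OF i] \<kappa>1[OF i] by (intro mult_left_mono) auto
  moreover have "\<kappa> i * (n * Tp / T i) - d i * (1 - \<kappa> i) * (d i * T i / (n * Tp))
    = (n\<^sup>2 * \<kappa> i * Tp\<^sup>2 - (d i)\<^sup>2 * (1 - \<kappa> i) * (T i)\<^sup>2) / (n * Tp * T i)"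
    using n Tp T[OF i] by (simp add: field_simps power2_eq_square)
  ultimately show "d i * \<kappa> i / X c i - d i * (1 - \<kappa> i) * X c i
    \<le> (n\<^sup>2 * \<kappa> i * Tp\<^sup>2 - (d i)\<^sup>2 * (1 - \<kappa> i) * (T i)\<^sup>2) / (n * Tp * T i)"
    by linarith
qed

lemma F_eventually_nonneg:
  assumes c1: "c1 \<in> dom"
  shows "\<exists>c\<ge>c1. F c \<ge> 0"
proof -
  define S where "S = (\<Sum>i\<in>I. T i)"
  have S: "S > 0" unfolding S_def using fin ne T by (intro sum_pos) auto
  \<comment> \<open>The weight of the AM-GM estimate below, chosen so that the bound on the sum uses
    exactly half of the linear term \<open>4 * n * c * Tp\<close>; the other half absorbs the
    constants for large \<open>c\<close>.\<close>
  define e where "e = n * Tp / (2 * S)"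
  have e: "e > 0" using n Tp S by (simp add: e_def)
  define C where "C = (\<Sum>i\<in>I. (d i)\<^sup>2 * (1 - \<kappa> i) / e)"
  define c where "c = max c1 ((2 * n + C) / (2 * n * Tp))"
  have c: "c \<in> dom" using dom_mono[OF c1] by (simp add: c_def)
  have "2 * (\<Sum>i\<in>I. d i * (1 - \<kappa> i) * X c i) \<le> (\<Sum>i\<in>I. 4 * c * e * T i + (d i)\<^sup>2 * (1 - \<kappa> i) / e)"
    unfolding sum_distrib_left
  proof (rule sum_mono)
    fix i assume i: "i \<in> I"
    have "2 * (d i * X c i) \<le> e * (X c i)\<^sup>2 + (d i)\<^sup>2 / e"
    proof -
      have "0 \<le> (e * X c i - d i)\<^sup>2 / e" using e by simp
      also have "\<dots> = e * (X c i)\<^sup>2 + (d i)\<^sup>2 / e - 2 * (d i * X c i)"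
        using e by (simp add: power2_eq_square field_simps)
      finally show ?thesis by simp
    qed
    then have "2 * (d i * X c i) * (1 - \<kappa> i) \<le> (e * (X c i)\<^sup>2 + (d i)\<^sup>2 / e) * (1 - \<kappa> i)"
      using \<kappa>1[OF i] by (intro mult_right_mono) auto
    also have "\<dots> = e * ((1 - \<kappa> i) * (X c i)\<^sup>2) + (d i)\<^sup>2 * (1 - \<kappa> i) / e"
      by (simp add: algebra_simps)
    also have "(1 - \<kappa> i) * (X c i)\<^sup>2 = 4 * c * T i - \<kappa> i"
      using X_sq(2)[OF i] c i by (force simp: dom_def)
    also have "e * \<dots> \<le> 4 * c * e * T i"
      using e \<kappa>0[OF i] by (simp add: algebra_simps)
    finally show "2 * (d i * (1 - \<kappa> i) * X c i) \<le> 4 * c * e * T i + (d i)\<^sup>2 * (1 - \<kappa> i) / e"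
      by (simp add: mult_ac)
  qed
  also have "\<dots> = 4 * c * e * S + C" by (simp add: S_def C_def sum.distrib sum_distrib_left)
  also have "4 * c * e * S = 2 * n * Tp * c" using S by (simp add: e_def)
  finally have 1: "2 * (\<Sum>i\<in>I. d i * (1 - \<kappa> i) * X c i) \<le> 2 * n * Tp * c + C" .
  have "(2 * n + C) / (2 * n * Tp) \<le> c" by (simp add: c_def)
  then have "2 * n + C \<le> 2 * n * Tp * c" using n Tp by (simp add: divide_le_eq mult_ac)
  then have "F c \<ge> 0" using 1 by (simp add: F_def mult_ac)
  moreover have "c \<ge> c1" by (simp add: c_def)
  ultimately show ?thesis by blast
qed

lemma root_above:
  assumes "crit c1" "F c1 \<le> 0"
  shows "\<exists>c\<ge>c1. F c = 0"
proof -
  have "c1 \<in> dom" using assms by (simp add: crit_def)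
  then obtain c2 where "c2 \<ge> c1" "F c2 \<ge> 0" using F_eventually_nonneg by blast
  then show ?thesis using IVT'[of F c1 0 c2] assms F_continuous by blast
qed

text \<open>At the left end of the domain the \<open>m\<close>-th root vanishes, and the others obey
  \<open>2 * X \<le> 1 + X^2\<close>, where \<open>X^2\<close> is affine in \<open>c\<close>. The
  hypothesis \<open>half\<close> is the sum of the Casimir scalars, multiplied by
  \<open>n\<close>.\<close>

lemma F_left_pos:
  assumes half: "(\<Sum>i\<in>I. d i * (1 - \<kappa> i)) = n / 2"
    and m: "m \<in> I" and mx: "\<And>i. i \<in> I \<Longrightarrow> \<kappa> i / T i \<le> \<kappa> m / T m"
    and cond: "\<kappa> m * (- n * Tp + (\<Sum>i\<in>I. d i * T i)) / T m < (\<Sum>i\<in>I. d i) + d m * (1 - \<kappa> m) - 3 * n"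
  shows "F (\<kappa> m / (4 * T m)) > 0"
proof -
  define c where "c = \<kappa> m / (4 * T m)"
  define t where "t = \<kappa> m / T m"
  have ct: "4 * c = t" by (simp add: c_def t_def)
  have tm: "t * T m = \<kappa> m" using T[OF m] by (simp add: t_def)
  have le: "\<kappa> i \<le> 4 * c * T i" if i: "i \<in> I" for i
    using mx[OF i] T[OF i] unfolding ct by (simp add: t_def divide_le_eq)
  have Xm: "X c m = 0" using tm unfolding X_def ct by simp
  \<comment> \<open>For \<open>i = m\<close> the general bound would be
    \<open>d m * (1 - \<kappa> m)\<close>, while the true value is 0. The subtracted gain is the
    term with \<open>d m\<close> in \<open>cond\<close>.\<close>
  have "2 * (\<Sum>i\<in>I. d i * (1 - \<kappa> i) * X c i)
      \<le> (\<Sum>i\<in>I. d i * (1 - 2 * \<kappa> i + t * T i) - (if i = m then d m * (1 - \<kappa> m) else 0))"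
    unfolding sum_distrib_left
  proof (rule sum_mono)
    fix i assume i: "i \<in> I"
    show "2 * (d i * (1 - \<kappa> i) * X c i) \<le> d i * (1 - 2 * \<kappa> i + t * T i) - (if i = m then d m * (1 - \<kappa> m) else 0)"
    proof (cases "i = m")
      case True
      then show ?thesis using Xm tm by simp
    next
      case False
      have "0 \<le> (X c i - 1)\<^sup>2" by simp
      then have "2 * X c i \<le> 1 + (X c i)\<^sup>2" by (simp add: power2_diff)
      then have "(1 - \<kappa> i) * (2 * X c i) \<le> (1 - \<kappa> i) * (1 + (X c i)\<^sup>2)"
        using \<kappa>1[OF i] by (intro mult_left_mono) auto
      also have "\<dots> = 1 - 2 * \<kappa> i + t * T i"
        using X_sq(2)[OF i le[OF i]] ct by (simp add: distrib_left)
      finally have "d i * ((1 - \<kappa> i) * (2 * X c i)) \<le> d i * (1 - 2 * \<kappa> i + t * T i)"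
        using d[OF i] by (intro mult_left_mono) auto
      then show ?thesis using False by (simp add: mult_ac)
    qed
  qed
  also have "\<dots> = (\<Sum>i\<in>I. 2 * (d i * (1 - \<kappa> i)) - d i + t * (d i * T i)) - d m * (1 - \<kappa> m)"
  proof -
    have "(\<Sum>i\<in>I. if i = m then d m * (1 - \<kappa> m) else 0) = d m * (1 - \<kappa> m)"
      using m fin by simp
    moreover have "(\<Sum>i\<in>I. d i * (1 - 2 * \<kappa> i + t * T i))
        = (\<Sum>i\<in>I. 2 * (d i * (1 - \<kappa> i)) - d i + t * (d i * T i))"
      by (intro sum.cong refl) (simp add: algebra_simps)
    ultimately show ?thesis by (simp only: sum_subtractf)
  qed
  also have "\<dots> = 2 * (\<Sum>i\<in>I. d i * (1 - \<kappa> i)) - (\<Sum>i\<in>I. d i) + t * (\<Sum>i\<in>I. d i * T i) - d m * (1 - \<kappa> m)"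
    by (simp add: sum.distrib sum_subtractf sum_distrib_left)
  finally have 1: "2 * (\<Sum>i\<in>I. d i * (1 - \<kappa> i) * X c i)
    \<le> n - (\<Sum>i\<in>I. d i) + t * (\<Sum>i\<in>I. d i * T i) - d m * (1 - \<kappa> m)"
    by (simp add: half)
  have "t * (- n * Tp + (\<Sum>i\<in>I. d i * T i)) < (\<Sum>i\<in>I. d i) + d m * (1 - \<kappa> m) - 3 * n"
    using cond by (simp add: t_def)
  then have 2: "- (n * Tp * t) + t * (\<Sum>i\<in>I. d i * T i) < (\<Sum>i\<in>I. d i) + d m * (1 - \<kappa> m) - 3 * n"
    by (simp add: algebra_simps)
  have "F c = n * Tp * t - 2 * n - 2 * (\<Sum>i\<in>I. d i * (1 - \<kappa> i) * X c i)"
    using ct[symmetric] by (simp add: F_def)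
  then show ?thesis using 1 2 unfolding c_def[symmetric] by linarith
qed

text \<open>The strict signs keep the root off both ends of the interval, so every radicand is
  positive there.\<close>

lemma root_below:
  assumes c1: "crit c1" "F c1 < 0"
    and m: "m \<in> I" and mx: "\<And>i. i \<in> I \<Longrightarrow> \<kappa> i / T i \<le> \<kappa> m / T m"
    and pos: "F (\<kappa> m / (4 * T m)) > 0"
  shows "\<exists>c\<in>dom. c < c1 \<and> F c = 0"
proof -
  let ?c0 = "\<kappa> m / (4 * T m)"
  have "\<kappa> m < 4 * c1 * T m" using c1 m by (simp add: crit_def dom_def)
  then have "?c0 < c1" using T[OF m] by (simp add: divide_less_eq mult_ac)
  then obtain c where c: "?c0 \<le> c" "c \<le> c1" "F c = 0"
    using IVT2'[of F c1 0 ?c0] c1 pos F_continuous by (auto simp: less_imp_le)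
  then have "?c0 \<noteq> c" "c \<noteq> c1" using c1 pos by auto
  then have lt: "?c0 < c" "c < c1" using c by auto
  have "\<kappa> i < 4 * c * T i" if i: "i \<in> I" for i
  proof -
    have "\<kappa> i / T i < 4 * c" using mx[OF i] lt(1) by simp
    then show ?thesis using T[OF i] by (simp add: divide_less_eq)
  qed
  then show ?thesis using lt c by (auto simp: dom_def)
qed

end

section \<open>Cubics with vanishing discriminant\<close>

lemma cubic_double_root:
  fixes a b c d :: real
  assumes D: "18 * a * b * c * d - 4 * b^3 * d + b^2 * c^2 - 4 * a * c^3 - 27 * a^2 * d^2 = 0"
    and a: "a \<noteq> 0" and e: "b^2 \<noteq> 3 * a * c"
  defines "u \<equiv> (9 * a * d - b * c) / (2 * (b^2 - 3 * a * c))"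
    and "v \<equiv> (4 * a * b * c - 9 * a^2 * d - b^3) / (a * (b^2 - 3 * a * c))"
  shows "a * y^3 + b * y^2 + c * y + d = a * (y - u)^2 * (y - v)"
proof -
  define e where "e = b^2 - 3 * a * c"
  have e0: "e \<noteq> 0" using e by (simp add: e_def)
  have u: "2 * e * u = 9 * a * d - b * c" using e0 by (simp add: u_def e_def)
  have v: "a * e * v = 4 * a * b * c - 9 * a^2 * d - b^3" using e0 a by (simp add: v_def e_def)
  \<comment> \<open>Three relations follow: Vieta for the sum of the roots, the vanishing of the
    derivative at \<open>u\<close>, and the vanishing of the cubic at \<open>u\<close> with
    \<open>c\<close> eliminated. Each is multiplied by a power of \<open>e\<close> that clears
    denominators.\<close>
  have "e * (a * (2 * u + v) + b) = 0"
    using u v unfolding e_def by algebra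
  then have "a * (2 * u + v) + b = 0" using e0 by simp
  then have 1: "a * v = - b - 2 * a * u" by (simp add: algebra_simps)
  have "e^2 * (3 * a * u^2 + 2 * b * u + c) = 0"
    using u D unfolding e_def by algebra
  then have 2: "c = - 3 * a * u^2 - 2 * b * u" using e0 by simp
  have "e^3 * (d - b * u^2 - 2 * a * u^3) = 0"
    using u D unfolding e_def by algebra
  then have 3: "d = b * u^2 + 2 * a * u^3" using e0 by simp
  have "a * (y - u)^2 * (y - v) = (y - u)^2 * (a * y - a * v)" by (simp add: algebra_simps)
  also have "\<dots> = a * y^3 + b * y^2 + c * y + d"
    unfolding 1 2 3 by (simp add: power2_eq_square power3_eq_cube algebra_simps)
  finally show ?thesis by simp
qed

lemma cubic_triple_root:
  fixes a b c d :: real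
  assumes D: "18 * a * b * c * d - 4 * b^3 * d + b^2 * c^2 - 4 * a * c^3 - 27 * a^2 * d^2 = 0"
    and a: "a \<noteq> 0" and e: "b^2 = 3 * a * c"
  shows "a * y^3 + b * y^2 + c * y + d = a * (y - (- b / (3 * a)))^3"
proof -
  \<comment> \<open>Under \<open>b^2 = 3 * a * c\<close> the discriminant equals
    \<open>- (b * c - 9 * a * d)^2 / 3\<close>.\<close>
  have "(b * c - 9 * a * d)^2 = 0" using D e by algebra
  then have bc: "b * c = 9 * a * d" by simp
  define t where "t = b / (3 * a)"
  have b: "b = 3 * a * t" using a by (simp add: t_def)
  have "3 * a * (c - 3 * a * t^2) = 0" using e b by algebra
  then have c: "c = 3 * a * t^2" using a by simp
  have "9 * a * (d - a * t^3) = 0" using bc b c by algebra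
  then have d: "d = a * t^3" using a by simp
  have "- b / (3 * a) = - t" by (simp add: t_def)
  then show ?thesis
    unfolding c d by (simp add: b power2_eq_square power3_eq_cube algebra_simps)
qed

section \<open>The case of two blocks\<close>

context ricci_system begin

definition ca where "ca = n * d 2 * (1 - \<kappa> 2) * Tp"
definition cb where "cb = (d 1)^2 * (1 - \<kappa> 1) * T 1 - (d 2)^2 * (1 - \<kappa> 2) * T 2 + 2 * n^2 * Tp
                 - n^2 * \<kappa> 1 * Tp^2 / T 1"
definition cc where "cc = - 2 * n * d 2 * T 2 + 2 * n * d 2 * \<kappa> 1 * Tp * T 2 / T 1 - n * d 2 * \<kappa> 2 * Tp"
definition cd where "cd = \<kappa> 2 * (d 2)^2 * T 2 - (d 2)^2 * \<kappa> 1 * T 2 ^ 2 / T 1"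

definition cubic :: "real \<Rightarrow> real" where "cubic y = ca * y^3 + cb * y^2 + cc * y + cd"

text \<open>Grouped by \<open>n * Tp * y - d 2 * T 2\<close>, which vanishes at the comparison point
  \<open>d 2 * T 2 / (n * Tp)\<close> and leaves only a positive square there; the same grouping
  appears when \<open>X c 1\<close> is eliminated.\<close>

lemma cubic_eq:
  assumes I: "I = {1, 2}"
  shows "cubic y = (d 1)^2 * (1 - \<kappa> 1) * T 1 * y^2 - \<kappa> 1 * (n * Tp * y - d 2 * T 2)^2 / T 1
    - (n * Tp * y - d 2 * T 2) * (d 2 * \<kappa> 2 - d 2 * (1 - \<kappa> 2) * y^2 - 2 * n * y)"
  using T[of 1] I
  by (simp add: cubic_def ca_def cb_def cc_def cd_def field_simps power2_eq_square power3_eq_cube)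

text \<open>For two blocks the equation in \<open>crit\<close> reads
  \<open>d 1 * T 1 * y = w * x\<close>, which eliminates \<open>x\<close> and shows
  \<open>w > 0\<close>. Multiplying \<open>F c\<close> by the positive number \<open>y * w\<close>
  clears the denominators.\<close>

lemma F_crit_cubic:
  assumes I: "I = {1, 2}" and c: "crit c"
  shows "X c 2 > d 2 * T 2 / (n * Tp)"
    and "F c * (X c 2 * (n * Tp * X c 2 - d 2 * T 2)) = - cubic (X c 2)"
proof -
  define x y w where "x = X c 1" and "y = X c 2" and "w = n * Tp * y - d 2 * T 2"
  have dom: "c \<in> dom" using c by (simp add: crit_def)
  have x: "x > 0" and y: "y > 0" using X_pos[OF dom] I by (auto simp: x_def y_def)
  have "(\<Sum>i\<in>I. d i * T i / X c i) = n * Tp" using c by (simp add: crit_def)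
  then have "d 1 * T 1 / x + d 2 * T 2 / y = n * Tp" by (simp add: I x_def y_def)
  then have w: "d 1 * T 1 * y = w * x" using x y by (simp add: w_def field_simps)
  have "d 1 * T 1 * y > 0" using d[of 1] T[of 1] y I by simp
  then have "w * x > 0" by (simp only: w)
  then have w0: "w > 0" using x by (simp add: zero_less_mult_iff)
  then show "X c 2 > d 2 * T 2 / (n * Tp)"
    using n Tp by (simp add: w_def y_def divide_less_eq mult_ac)
  have T1: "T 1 > 0" using T I by simp
  have 1: "d 1 * \<kappa> 1 / x * (y * w) = \<kappa> 1 * w^2 / T 1"
    using w x T1 by (simp add: field_simps power2_eq_square)
  have 2: "d 1 * (1 - \<kappa> 1) * x * (y * w) = (d 1)^2 * (1 - \<kappa> 1) * T 1 * y^2"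
  proof -
    have "d 1 * (1 - \<kappa> 1) * x * (y * w) = d 1 * (1 - \<kappa> 1) * y * (w * x)" by simp
    also have "\<dots> = (d 1)^2 * (1 - \<kappa> 1) * T 1 * y^2"
      unfolding w[symmetric] by (simp add: power2_eq_square)
    finally show ?thesis .
  qed
  have 3: "d 2 * \<kappa> 2 / y * (y * w) = d 2 * \<kappa> 2 * w" using y by simp
  have "F c = d 1 * \<kappa> 1 / x - d 1 * (1 - \<kappa> 1) * x + (d 2 * \<kappa> 2 / y - d 2 * (1 - \<kappa> 2) * y) - 2 * n"
    unfolding F_crit[OF c] using I by (simp add: x_def y_def)
  then have "F c * (y * w) = d 1 * \<kappa> 1 / x * (y * w) - d 1 * (1 - \<kappa> 1) * x * (y * w)
    + (d 2 * \<kappa> 2 / y * (y * w) - d 2 * (1 - \<kappa> 2) * y * (y * w)) - 2 * n * (y * w)"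
    by (simp only: left_diff_distrib distrib_right)
  also have "\<dots> = - cubic y"
    unfolding 1 2 3 cubic_eq[OF I] w_def[symmetric] by (simp add: algebra_simps power2_eq_square)
  finally show "F c * (X c 2 * (n * Tp * X c 2 - d 2 * T 2)) = - cubic (X c 2)"
    by (simp add: w_def y_def)
qed

lemma cubic_left_pos:
  assumes I: "I = {1, 2}"
  shows "cubic (d 2 * T 2 / (n * Tp)) > 0"
proof -
  have "n * Tp * (d 2 * T 2 / (n * Tp)) - d 2 * T 2 = 0" using n Tp by simp
  moreover have "(d 1)^2 * (1 - \<kappa> 1) * T 1 * (d 2 * T 2 / (n * Tp))^2 > 0"
    using d[of 1] \<kappa>1[of 1] T[of 1] d[of 2] T[of 2] n Tp I by simp
  ultimately show ?thesis unfolding cubic_eq[OF I] by simp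
qed

text \<open>A cubic with a double root \<open>u\<close> and a simple root \<open>v\<close> is positive at \<open>x = d\<^sub>2 T\<^sub>2 / (n T\<^sub>p)\<close> only
  if \<open>v < x\<close>, and then it is nonnegative to the right of \<open>x\<close>; a triple root cannot lie to the right of \<open>x\<close>.
  So conditions (i), (iii) and (iv) of part (3) never hold.\<close>

lemma F_crit_nonpos_cubic:
  assumes I: "I = {1, 2}" and c: "crit c"
    and D: "18 * ca * cb * cc * cd - 4 * cb^3 * cd + cb^2 * cc^2 - 4 * ca * cc^3 - 27 * ca^2 * cd^2 = 0"
    and triple: "cb^2 = 3 * ca * cc \<Longrightarrow> x < - cb / (3 * ca)"
    and x: "x = d 2 * T 2 / (n * Tp)"
  shows "F c \<le> 0"
proof -
  let ?y = "X c 2"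
  have a: "ca > 0" using I n d[of 2] \<kappa>1[of 2] Tp by (simp add: ca_def)
  have xy: "x < ?y" using F_crit_cubic(1)[OF I c] x by simp
  have px: "cubic x > 0" using cubic_left_pos[OF I] x by simp
  have "cubic ?y \<ge> 0"
  proof (cases "cb^2 = 3 * ca * cc")
    case True
    then have "x < - cb / (3 * ca)" by (rule triple)
    then have "(x - (- cb / (3 * ca)))^3 < 0" by (simp add: power_less_zero_eq)
    then have "cubic x < 0"
      using cubic_triple_root[OF D _ True, of x] a by (simp add: cubic_def mult_less_0_iff)
    then show ?thesis using px by simp
  next
    case False
    define v where "v = (4 * ca * cb * cc - 9 * ca^2 * cd - cb^3) / (ca * (cb^2 - 3 * ca * cc))"
    define u where "u = (9 * ca * cd - cb * cc) / (2 * (cb^2 - 3 * ca * cc))"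
    have eq: "cubic y = ca * (y - u)^2 * (y - v)" for y
      unfolding cubic_def u_def v_def using cubic_double_root[OF D _ False] a by simp
    have "v < x"
    proof (rule ccontr)
      assume "\<not> v < x"
      then have "cubic x \<le> 0" using a unfolding eq by (intro mult_nonneg_nonpos) auto
      then show False using px by simp
    qed
    then show ?thesis using a xy unfolding eq by simp
  qed
  moreover have "c \<in> dom" using c by (simp add: crit_def)
  then have "?y > 0" using I by (intro X_pos) auto
  moreover have "n * Tp * ?y - d 2 * T 2 > 0"
    using xy n Tp unfolding x by (simp add: divide_less_eq mult_ac)
  ultimately show ?thesis
    using F_crit_cubic(2)[OF I c] by (smt (verit) mult_pos_pos)
qed

end

section \<open>From roots of \<open>F\<close> to metrics\<close>

context cartan_kappa begin

lemma index_nonempty: "{1..r+s} \<noteq> {}"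
proof
  assume "{1..r+s} = {}"
  then show False using sum_casimir by simp
qed

lemma metric_solution:
  assumes x: "\<And>i. i \<in> {1..r+s} \<Longrightarrow> x i > 0"
    and p_eq: "c * Tp = 1/2 + (1/2) * (\<Sum>i=1..r+s. x i * cas i)"
    and k_eq: "\<And>i. i \<in> {1..r+s} \<Longrightarrow> c * T i = (\<kappa> i + (1 - \<kappa> i) * (x i)\<^sup>2) / 4"
  shows "form 1 x \<in> MK br k r s kk"
    "ric (form 1 x) br = (\<lambda>X Y. c * tensorT br k (r+s) kk Tp T X Y)"
proof -
  interpret naturally_reductive br k r s kk \<kappa> 1 x
    by standard (use x in auto)
  show "form 1 x \<in> MK br k r s kk"
    unfolding MK_def using x by (intro CollectI exI[of _ 1] exI[of _ x]) (auto simp: form_def fun_eq_iff)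
  show "ric (form 1 x) br = (\<lambda>X Y. c * tensorT br k (r+s) kk Tp T X Y)"
  proof (intro ext)
    fix X Y
    have "ric (form 1 x) br X Y = form (- (c * Tp)) (\<lambda>i. (\<kappa> i + (1 - \<kappa> i) * (x i)\<^sup>2) / 4) X Y"
      unfolding ric_form p_eq by simp
    also have "\<dots> = - (c * Tp) * Qres br k p X Y + (\<Sum>i=1..r+s. c * (T i * Qres br k (kk i) X Y))"
      unfolding form_def by (intro arg_cong2[where f = "(+)"] sum.cong refl) (simp flip: k_eq)
    also have "\<dots> = c * tensorT br k (r+s) kk Tp T X Y"
      by (simp add: tensorT_def right_diff_distrib sum_distrib_left)
    finally show "ric (form 1 x) br X Y = c * tensorT br k (r+s) kk Tp T X Y" .
  qed
qed

text \<open>Makes the constants comparable: two multiples of the tensor agree only if the factors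
  do.\<close>

lemma tensor_nonzero:
  assumes "Tp > 0" shows "\<exists>y. tensorT br k (r+s) kk Tp T y y \<noteq> 0"
proof -
  obtain y where y: "y \<in> p" "y \<noteq> 0" using p_nonzero by blast
  have "tensorT br k (r+s) kk Tp T = form (- Tp) T" by (simp add: tensorT_def form_def fun_eq_iff)
  then have "tensorT br k (r+s) kk Tp T y y = - Tp * Q y y" using form_p[OF y(1)] by simp
  then show ?thesis using assms q_pos[OF y(2)] by (intro exI[of _ y]) simp
qed

end

text \<open>The Koszul formula is homogeneous in the metric, so homothetic metrics have the same
  connection and hence the same curvature.\<close>

lemma ric_homothetic:
  assumes "homothetic g1 g2" shows "ric g1 br = ric g2 br"
proof -
  obtain t where t: "t > 0" "g1 = (\<lambda>x y. t * g2 x y)" using assms by (auto simp: homothetic_def)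
  have "(\<forall>Z. 2 * g1 U Z = g1 (br X Y) Z - g1 (br Y Z) X + g1 (br Z X) Y)
    \<longleftrightarrow> (\<forall>Z. 2 * g2 U Z = g2 (br X Y) Z - g2 (br Y Z) X + g2 (br Z X) Y)" for U X Y
  proof -
    have "2 * g1 U Z = g1 (br X Y) Z - g1 (br Y Z) X + g1 (br Z X) Y
      \<longleftrightarrow> t * (2 * g2 U Z) = t * (g2 (br X Y) Z - g2 (br Y Z) X + g2 (br Z X) Y)" for Z
      unfolding t(2) by (simp add: algebra_simps)
    then show ?thesis using t(1) by simp
  qed
  then have "lc g1 br = lc g2 br" by (simp add: lc_def fun_eq_iff)
  then show ?thesis by (simp add: ric_def curv_def fun_eq_iff)
qed

theorem theorem5p10:
  fixes br :: "'g::euclidean_space \<Rightarrow> 'g \<Rightarrow> 'g"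
    and k :: "'g set" and r s :: nat and kk :: "nat \<Rightarrow> 'g set"
    and n :: nat and d :: "nat \<Rightarrow> nat" and \<kappa> :: "nat \<Rightarrow> real"
    and Tp :: real and T :: "nat \<Rightarrow> real"
  assumes lie: "lie_algebra br" and simple: "simple_sub br UNIV" and nc: "noncompact br"
    and cartan: "cartan_k br k"
    and kdec: "k_decomp br k r s kk"
    and n_def: "n = dim (orthB br k)"
    and d_def: "\<forall>i\<in>{1..r+s}. d i = dim (kk i)"
    and kappa: "\<forall>i\<in>{1..r+s}. \<forall>x\<in>kk i. \<forall>y\<in>kk i. killing_on br (kk i) x y = \<kappa> i * killing br x y"
    and Tp_pos: "Tp > 0" and T_pos: "\<forall>i\<in>{1..r+s}. T i > 0"
  shows
   "(let TT = tensorT br k (r+s) kk Tp T;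
         trQ = - real n * Tp + (\<Sum>i=1..r+s. real (d i) * T i);
         condA = ((\<Sum>i=1..r+s. (real n ^ 2 * \<kappa> i * Tp ^ 2 - real (d i) ^ 2 * (1 - \<kappa> i) * T i ^ 2)
                                / (real n * Tp * T i)) - 2 * real n < 0)
     in
      (condA \<longrightarrow> (\<exists>g\<in>MK br k r s kk. \<exists>c>0. ric g br = (\<lambda>x y. c * TT x y)))
    \<and> (\<forall>m. condA \<and> m \<in> {1..r} \<and> (\<forall>i\<in>{1..r}. \<kappa> i / T i \<le> \<kappa> m / T m)
          \<and> \<kappa> m * trQ / T m < real (dim k) + real (d m) * (1 - \<kappa> m) - 3 * real n
          \<longrightarrow> (\<exists>g1\<in>MK br k r s kk. \<exists>g2\<in>MK br k r s kk. \<exists>c1>0. \<exists>c2>0.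
                 ric g1 br = (\<lambda>x y. c1 * TT x y) \<and> ric g2 br = (\<lambda>x y. c2 * TT x y)
                 \<and> \<not> homothetic g1 g2))
    \<and> (r + s = 2 \<longrightarrow>
        (let nn = real n; d1 = real (d 1); d2 = real (d 2);
             a = nn * d2 * (1 - \<kappa> 2) * Tp;
             b = d1^2 * (1 - \<kappa> 1) * T 1 - d2^2 * (1 - \<kappa> 2) * T 2 + 2 * nn^2 * Tp
                 - nn^2 * \<kappa> 1 * Tp^2 / T 1;
             c = - 2 * nn * d2 * T 2 + 2 * nn * d2 * \<kappa> 1 * Tp * T 2 / T 1 - nn * d2 * \<kappa> 2 * Tp;
             dd = \<kappa> 2 * d2^2 * T 2 - d2^2 * \<kappa> 1 * T 2 ^ 2 / T 1;
             D = 18 * a * b * c * dd - 4 * b^3 * dd + b^2 * c^2 - 4 * a * c^3 - 27 * a^2 * dd^2;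
             Rt = - b / (3 * a);
             Rd = (9 * a * dd - b * c) / (2 * (b^2 - 3 * a * c));
             Rs = (4 * a * b * c - 9 * a^2 * dd - b^3) / (a * (b^2 - 3 * a * c));
             x = d2 * T 2 / (nn * Tp)
         in ((D = 0 \<and> b^2 = 3 * a * c \<and> x < Rt)
             \<or> (D = 0 \<and> b^2 \<noteq> 3 * a * c \<and> Rs \<le> x \<and> x < Rd)
             \<or> (D = 0 \<and> b^2 \<noteq> 3 * a * c \<and> x < Rs \<and> Rs < Rd)
             \<or> (D = 0 \<and> b^2 \<noteq> 3 * a * c \<and> x < Rd \<and> Rd < Rs))
           \<longrightarrow> (\<exists>g\<in>MK br k r s kk. \<exists>c'>0. ric g br = (\<lambda>x y. c' * TT x y)))))"
proof -
  interpret cartan_kappa br k r s kk \<kappa>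
    by standard (fact lie cartan simple nc kdec kappa)+
  define I where "I = {1..r+s}"
  have dd: "real (d i) = real (dim (kk i))" if "i \<in> I" for i using d_def that by (simp add: I_def)
  have n0: "real n > 0" using dim_p_pos n_def by simp
  interpret R: ricci_system I "real n" Tp "\<lambda>i. real (d i)" \<kappa> T
    by standard
      (use n0 Tp_pos T_pos dd index_nonempty dim_kk_pos kappa_bounds in \<open>auto simp: I_def\<close>)
  have cas: "cas i = real (d i) * (1 - \<kappa> i) / real n" if "i \<in> I" for i
    using dd[OF that] n_def by (simp add: cas_def)
  let ?TT = "tensorT br k (r+s) kk Tp T"
  let ?M = "MK br k r s kk"
  have sol: "\<exists>g\<in>?M. ric g br = (\<lambda>x y. c * ?TT x y)" if c: "c \<in> R.dom" "R.F c = 0" for c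
  proof -
    have "4 * real n * (c * Tp) = 2 * real n + 2 * (\<Sum>i\<in>I. real (d i) * (1 - \<kappa> i) * R.X c i)"
      using c(2) by (simp add: R.F_def mult_ac)
    moreover have "(\<Sum>i\<in>I. real (d i) * (1 - \<kappa> i) * R.X c i) = real n * (\<Sum>i\<in>I. R.X c i * cas i)"
      unfolding sum_distrib_left using cas n0 by (intro sum.cong refl) simp
    ultimately have "4 * real n * (c * Tp) = 4 * real n * (1/2 + (1/2) * (\<Sum>i\<in>I. R.X c i * cas i))"
      by (simp add: algebra_simps)
    then have p_eq: "c * Tp = 1/2 + (1/2) * (\<Sum>i\<in>I. R.X c i * cas i)" using n0 by simp
    have k_eq: "c * T i = (\<kappa> i + (1 - \<kappa> i) * (R.X c i)\<^sup>2) / 4" if "i \<in> I" for i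
      using R.X_sq(2)[OF that, of c] c(1) that by (force simp: R.dom_def)
    show ?thesis
      using metric_solution[of "R.X c" c Tp T] R.X_pos[OF c(1)] p_eq k_eq unfolding I_def by blast
  qed
  obtain c1 where c1: "R.crit c1" using R.crit_exists by blast
  have c1d: "c1 \<in> R.dom" using c1 by (simp add: R.crit_def)
  have above: "\<exists>c\<in>R.dom. c \<ge> c1 \<and> R.F c = 0" if "R.F c1 \<le> 0"
    using R.root_above[OF c1 that] R.dom_mono[OF c1d] by blast
  have one: "\<exists>g\<in>?M. \<exists>c>0. ric g br = (\<lambda>x y. c * ?TT x y)" if "R.F c1 \<le> 0"
    using above[OF that] sol R.dom_pos by blast
  define condA where "condA \<longleftrightarrow> (\<Sum>i=1..r+s. (real n ^ 2 * \<kappa> i * Tp ^ 2 - real (d i) ^ 2 * (1 - \<kappa> i) * T i ^ 2)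
                                / (real n * Tp * T i)) - 2 * real n < 0"
  have A: "R.F c1 < 0" if condA
    using R.F_crit_le[OF c1] that by (simp add: condA_def I_def)
  have two: "\<exists>g1\<in>?M. \<exists>g2\<in>?M. \<exists>c1>0. \<exists>c2>0.
       ric g1 br = (\<lambda>x y. c1 * ?TT x y) \<and> ric g2 br = (\<lambda>x y. c2 * ?TT x y) \<and> \<not> homothetic g1 g2"
    if condA and m: "m \<in> {1..r}" and mx: "\<forall>i\<in>{1..r}. \<kappa> i / T i \<le> \<kappa> m / T m"
      and B: "\<kappa> m * (- real n * Tp + (\<Sum>i=1..r+s. real (d i) * T i)) / T m
        < real (dim k) + real (d m) * (1 - \<kappa> m) - 3 * real n" for m
  proof -
    have mI: "m \<in> I" using m by (simp add: I_def)
    \<comment> \<open>The hypothesis compares simple ideals only; the one possible further index is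
      the centre, where \<open>\<kappa>\<close> is 0.\<close>
    have mx': "\<kappa> i / T i \<le> \<kappa> m / T m" if "i \<in> I" for i
    proof (cases "i \<le> r")
      case True
      then show ?thesis using mx that by (simp add: I_def)
    next
      case False
      then have "i = r + 1" "s = 1" using that kdec by (auto simp: I_def k_decomp_def)
      then show ?thesis using kappa_centre R.\<kappa>0[OF mI] R.T[OF mI] by simp
    qed
    have "(\<Sum>i\<in>I. real (d i) * (1 - \<kappa> i)) = real n * (\<Sum>i\<in>I. cas i)"
      unfolding sum_distrib_left using cas n0 by (intro sum.cong refl) simp
    then have half: "(\<Sum>i\<in>I. real (d i) * (1 - \<kappa> i)) = real n / 2"
      using sum_casimir by (simp add: I_def)
    have "real (dim k) = (\<Sum>i\<in>I. real (d i))" using dim_k_sum dd by (simp add: I_def)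
    then have "R.F (\<kappa> m / (4 * T m)) > 0"
      using R.F_left_pos[OF half mI mx'] B by (simp add: I_def)
    \<comment> \<open>\<open>F\<close> is negative at \<open>c1\<close>, so it has a root on either
      side: the lower one from positivity at the left end, the upper one from growth at
      infinity.\<close>
    then obtain c2 where c2: "c2 \<in> R.dom" "c2 < c1" "R.F c2 = 0"
      using R.root_below[OF c1 A[OF \<open>condA\<close>] mI mx'] by blast
    obtain c3 where c3: "c3 \<in> R.dom" "c3 \<ge> c1" "R.F c3 = 0"
      using above A[OF \<open>condA\<close>] by force
    obtain g2 g3 where g: "g2 \<in> ?M" "ric g2 br = (\<lambda>x y. c2 * ?TT x y)"
        "g3 \<in> ?M" "ric g3 br = (\<lambda>x y. c3 * ?TT x y)"
      using sol c2 c3 by meson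
    \<comment> \<open>Homothetic metrics would have equal Ricci tensors, hence
      \<open>c2 = c3\<close>, but \<open>c2 < c1 \<le> c3\<close>.\<close>
    have "\<not> homothetic g2 g3"
    proof
      assume "homothetic g2 g3"
      then have "(\<lambda>x y. c2 * ?TT x y) = (\<lambda>x y. c3 * ?TT x y)" using ric_homothetic g by metis
      then have "c2 * ?TT y y = c3 * ?TT y y" for y by meson
      then show False using tensor_nonzero[OF Tp_pos, of T] c2 c3 by auto
    qed
    then show ?thesis using g R.dom_pos c2 c3 by blast
  qed
  have three: "\<exists>g\<in>?M. \<exists>c>0. ric g br = (\<lambda>x y. c * ?TT x y)"
    if "r + s = 2"
      and "18 * R.ca * R.cb * R.cc * R.cd - 4 * R.cb^3 * R.cd + R.cb^2 * R.cc^2 - 4 * R.ca * R.cc^3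
        - 27 * R.ca^2 * R.cd^2 = 0"
      and "R.cb^2 = 3 * R.ca * R.cc \<Longrightarrow> real (d 2) * T 2 / (real n * Tp) < - R.cb / (3 * R.ca)"
  proof (rule one, rule R.F_crit_nonpos_cubic[OF _ c1 that(2,3) refl])
    show "I = {1, 2}" using that(1) by (auto simp: I_def)
  qed
  show ?thesis
    unfolding Let_def condA_def[symmetric]
  proof (intro conjI allI impI, goal_cases)
    case 1
    then show ?case using one A by simp
  next
    case (2 m)
    then show ?case using two by blast
  next
    case 3
    note h = three[OF 3(1), unfolded R.ca_def R.cb_def R.cc_def R.cd_def]
    \<comment> \<open>Case (i) provides the inequality for the triple root; in (ii) to (iv) its
      premise \<open>b^2 = 3 * a * c\<close> is contradicted.\<close>
    from 3(2) show ?case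
      by (elim disjE conjE) (rule h; simp)+
  qed
qed

end
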